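(* Suppose that $\dim_{\mathbb{R}}V=\dim_{\mathbb{R}}W$ and $f:\mathfrak{X}_c(V)\to\mathfrak{X}(W)$ is a Lie algebra homomorphism. Then $f$ satisfies condition (i) below if and only if (ii) holds. (i) For any $w\in W$, $\mathcal{S}_{E_w\circ f}$ is a nonempty and compact subset of $V$; moreover, the tangent bundle $TV$ is trivial on an open neighborhood of $\mathcal{S}_{E_w\circ f}$; additionally, for any $x\in\mathfrak{X}_c(V)$ which does not vanish (at any point) on $\mathcal{S}_{E_w\circ f}$, we have $f(x)(w)\ne\mathbf{0}$; and, if $\dim_{\mathbb{R}}V=1$, it is further required that $\mathcal{S}_{E_w\circ f}$ consists of a single point for every $w\in W$. (ii) There exists a $C^\infty$ local diffeomorphism $\phi:W\to V$ such that $$f(x)(w)=(d_w\phi)^{-1}(x\circ\phi(w)),\qquad w\in W,\ x\in\mathfrak{X}_c(V),$$ where $(d_w\phi)^{-1}$ is the inverse of the differential of $\phi$ at $w$.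
   Context: All manifolds are Hausdorff. $V$ and $W$ are finite, positive dimensional $C^\infty$ manifolds, possibly with boundary, not necessarily paracompact or connected. $\mathfrak{X}(W)$ is the Lie algebra of all $C^\infty$ vector fields on $W$, and $\mathfrak{X}_c(V)$ is the Lie algebra of all $C^\infty$ vector fields with compact support on $V$. $E_w$ is evaluation at $w$. A point $v_0\in V$ is a support point of $E_w\circ f$ if for every open neighborhood $O$ of $v_0$ there is $\hat x\in\mathfrak{X}_c(V)$ with $\operatorname{supp}\hat x\subset O$ and $f(\hat x)(w)\ne\mathbf{0}$; $\mathcal{S}_{E_w\circ f}\subset V$ is the set of support points.
   Formalization: For W with boundary, "local diffeomorphism" means locally a diffeomorphism onto its image, which need not be open in V (equivalently, smooth with invertible differentials); with open images (i)⇒(ii) fails for W=[0,1), V=(-1,1), f = restriction. *)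

theory Defs
  imports "HOL-Analysis.Analysis"
begin

section \<open>Smooth maps on subsets of Euclidean space\<close>

text \<open>\<open>C_k_on k f S\<close> is used for open \<open>S\<close> only.  Since the domain is finite dimensional, it suffices
  to ask that each directional derivative of \<open>f\<close> is of class \<open>C\<^sup>k\<close> for \<open>f\<close> to be \<open>C\<^sup>k\<^sup>+\<^sup>1\<close>.\<close>

primrec C_k_on :: "nat \<Rightarrow> ('e::euclidean_space \<Rightarrow> 'h::real_normed_vector) \<Rightarrow> 'e set \<Rightarrow> bool" where
  "C_k_on 0 f S \<longleftrightarrow> continuous_on S f"
| "C_k_on (Suc k) f S \<longleftrightarrow>
     (\<forall>x\<in>S. f differentiable (at x)) \<and>
     (\<forall>v. C_k_on k (\<lambda>x. frechet_derivative f (at x) v) S)"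

text \<open>On a set that need not be open, smoothness means local extendability to a smooth function on
  an open subset of the ambient space.\<close>

definition smooth_on :: "('e::euclidean_space \<Rightarrow> 'h::real_normed_vector) \<Rightarrow> 'e set \<Rightarrow> bool" where
  "smooth_on f S \<longleftrightarrow>
     (\<forall>x\<in>S. \<exists>U g. open U \<and> x \<in> U \<and> (\<forall>k. C_k_on k g U) \<and> (\<forall>y\<in>S \<inter> U. g y = f y))"


section \<open>Manifolds with boundary\<close>

definition half_space :: "'e::euclidean_space set" where
  "half_space = {x. 0 \<le> x \<bullet> (SOME b. b \<in> Basis)}"

type_synonym ('a, 'e) chart = "'a set \<times> ('a \<Rightarrow> 'e)"

text \<open>The dimension is the dimension of the model space \<open>'e\<close>; in particular it is finite, positive
  and the same on every component.  The atlas need not be maximal.\<close>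

record ('a, 'e) manifold =
  top_of :: "'a topology"
  atlas :: "('a, 'e) chart set"

abbreviation points :: "('a, 'e) manifold \<Rightarrow> 'a set" where
  "points M \<equiv> topspace (top_of M)"

definition mdim :: "('a, 'e::euclidean_space) manifold \<Rightarrow> nat" where
  "mdim M = DIM('e)"

abbreviation cdom :: "('a, 'e) chart \<Rightarrow> 'a set" where
  "cdom c \<equiv> fst c"

abbreviation coord :: "('a, 'e) chart \<Rightarrow> 'a \<Rightarrow> 'e" where
  "coord c \<equiv> snd c"

abbreviation param :: "('a, 'e) chart \<Rightarrow> 'e \<Rightarrow> 'a" where
  "param c \<equiv> the_inv_into (cdom c) (coord c)"

definition is_chart :: "'a topology \<Rightarrow> ('a, 'e::euclidean_space) chart \<Rightarrow> bool" where
  "is_chart X c \<longleftrightarrow>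
     openin X (cdom c) \<and>
     (open (coord c ` cdom c) \<or> openin (top_of_set half_space) (coord c ` cdom c)) \<and>
     homeomorphic_map (subtopology X (cdom c)) (top_of_set (coord c ` cdom c)) (coord c)"

text \<open>Neither paracompactness nor connectedness is assumed.\<close>

definition smooth_manifold :: "('a, 'e::euclidean_space) manifold \<Rightarrow> bool" where
  "smooth_manifold M \<longleftrightarrow>
     Hausdorff_space (top_of M) \<and>
     (\<forall>c\<in>atlas M. is_chart (top_of M) c) \<and>
     (\<Union>c\<in>atlas M. cdom c) = points M \<and>
     (\<forall>c\<in>atlas M. \<forall>d\<in>atlas M.
        smooth_on (coord d \<circ> param c) (coord c ` (cdom c \<inter> cdom d)))"

definition charts_at :: "('a, 'e) manifold \<Rightarrow> 'a \<Rightarrow> ('a, 'e) chart set" where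
  "charts_at M p = {c \<in> atlas M. p \<in> cdom c}"


section \<open>Smooth maps and local diffeomorphisms\<close>

definition local_rep :: "('a, 'e) chart \<Rightarrow> ('b, 'f) chart \<Rightarrow> ('a \<Rightarrow> 'b) \<Rightarrow> 'e \<Rightarrow> 'f" where
  "local_rep c d \<phi> = coord d \<circ> \<phi> \<circ> param c"

definition smooth_map_on ::
  "('a, 'e::euclidean_space) manifold \<Rightarrow> 'a set \<Rightarrow> ('b, 'f::euclidean_space) manifold \<Rightarrow>
    ('a \<Rightarrow> 'b) \<Rightarrow> bool" where
  "smooth_map_on M S N \<phi> \<longleftrightarrow>
     continuous_map (subtopology (top_of M) S) (top_of N) \<phi> \<and>
     (\<forall>c\<in>atlas M. \<forall>d\<in>atlas N.
        smooth_on (local_rep c d \<phi>) (coord c ` {p \<in> cdom c \<inter> S. \<phi> p \<in> cdom d}))"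

text \<open>A local diffeomorphism restricts, near every point, to a diffeomorphism onto its image.  If the
  manifolds have equal dimension and the source has no boundary, then the images are automatically
  open.  If the source has a boundary, openness of the images must not be demanded: the inclusion
  of \<open>[0, 1)\<close> in \<open>(-1, 1)\<close> is to be a local diffeomorphism, since restriction of vector fields along
  it is given by the inverses of its (everywhere invertible) differentials.\<close>

definition local_diffeomorphism ::
  "('a, 'e::euclidean_space) manifold \<Rightarrow> ('b, 'f::euclidean_space) manifold \<Rightarrow>
    ('a \<Rightarrow> 'b) \<Rightarrow> bool" where
  "local_diffeomorphism M N \<phi> \<longleftrightarrow>
     smooth_map_on M (points M) N \<phi> \<and>
     (\<forall>p\<in>points M. \<exists>U. openin (top_of M) U \<and> p \<in> U \<and> inj_on \<phi> U \<and>
        smooth_map_on N (\<phi> ` U) M (the_inv_into U \<phi>))"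


section \<open>Tangent vectors\<close>

text \<open>A tangent vector at \<open>p\<close> is the family of its coordinate vectors in the charts around \<open>p\<close>, which
  transform by the derivatives of the chart changes.  For charts not around \<open>p\<close> the entry is \<open>0\<close>,
  so that equality of tangent vectors is equality of functions.\<close>

type_synonym ('a, 'e) tvec = "('a, 'e) chart \<Rightarrow> 'e"

definition zero_tvec :: "('a, 'e::euclidean_space) tvec" where
  "zero_tvec = (\<lambda>c. 0)"

definition coord_change ::
  "('a, 'e::euclidean_space) chart \<Rightarrow> ('a, 'e) chart \<Rightarrow> 'a \<Rightarrow> 'e \<Rightarrow> 'e" where
  "coord_change c d p =
     frechet_derivative (coord d \<circ> param c) (at (coord c p) within coord c ` (cdom c \<inter> cdom d))"

definition tangent_space :: "('a, 'e::euclidean_space) manifold \<Rightarrow> 'a \<Rightarrow> ('a, 'e) tvec set" where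
  "tangent_space M p =
     {v. (\<forall>c. c \<notin> charts_at M p \<longrightarrow> v c = 0) \<and>
         (\<forall>c\<in>charts_at M p. \<forall>d\<in>charts_at M p. v d = coord_change c d p (v c))}"

definition tvec_of_coord ::
  "('a, 'e::euclidean_space) manifold \<Rightarrow> 'a \<Rightarrow> ('a, 'e) chart \<Rightarrow> 'e \<Rightarrow> ('a, 'e) tvec" where
  "tvec_of_coord M p c u = (\<lambda>d. if d \<in> charts_at M p then coord_change c d p u else 0)"

text \<open>The result does not depend on the chosen chart \<open>c\<close> around \<open>p\<close>.\<close>

definition differential ::
  "('a, 'e::euclidean_space) manifold \<Rightarrow> ('b, 'f::euclidean_space) manifold \<Rightarrow> ('a \<Rightarrow> 'b) \<Rightarrow> 'a \<Rightarrow>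
    ('a, 'e) tvec \<Rightarrow> ('b, 'f) tvec" where
  "differential M N \<phi> p v =
     (let c = (SOME c. c \<in> charts_at M p) in
      (\<lambda>d. if d \<in> charts_at N (\<phi> p)
           then frechet_derivative (local_rep c d \<phi>)
                  (at (coord c p) within coord c ` {q \<in> cdom c. \<phi> q \<in> cdom d}) (v c)
           else 0))"

text \<open>Triviality of the restriction of the tangent bundle to an open set \<open>U\<close>: an isomorphism of
  vector bundles \<open>(p, v) \<mapsto> (p, \<Phi> p v)\<close> from \<open>TU\<close> to \<open>U \<times> 'e\<close>.  Smoothness of this map and of its
  inverse is expressed in the charts of the total space that are induced by the atlas; there the
  point of \<open>TU\<close> with coordinates \<open>(y, u)\<close> is the vector at \<open>param c y\<close> that has coordinates \<open>u\<close>.\<close>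

definition tangent_bundle_trivial_on ::
  "('a, 'e::euclidean_space) manifold \<Rightarrow> 'a set \<Rightarrow> bool" where
  "tangent_bundle_trivial_on M U \<longleftrightarrow>
     (\<exists>\<Phi> :: 'a \<Rightarrow> ('a, 'e) tvec \<Rightarrow> 'e.
        (\<forall>p\<in>U. bij_betw (\<Phi> p) (tangent_space M p) UNIV \<and>
           (\<forall>v\<in>tangent_space M p. \<forall>w\<in>tangent_space M p.
              \<Phi> p (\<lambda>c. v c + w c) = \<Phi> p v + \<Phi> p w) \<and>
           (\<forall>r. \<forall>v\<in>tangent_space M p. \<Phi> p (\<lambda>c. r *\<^sub>R v c) = r *\<^sub>R \<Phi> p v)) \<and>
        (\<forall>c\<in>atlas M.
           smooth_on (\<lambda>(y, u). \<Phi> (param c y) (tvec_of_coord M (param c y) c u))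
             (coord c ` (cdom c \<inter> U) \<times> UNIV) \<and>
           smooth_on (\<lambda>(y, z). the_inv_into (tangent_space M (param c y)) (\<Phi> (param c y)) z c)
             (coord c ` (cdom c \<inter> U) \<times> UNIV)))"


section \<open>Lie algebras of vector fields\<close>

text \<open>Vector fields are \<open>0\<close> outside the manifold, so that equality of vector fields is equality of
  functions.\<close>

type_synonym ('a, 'e) vfield = "'a \<Rightarrow> ('a, 'e) tvec"

definition vfield_rep :: "('a, 'e::euclidean_space) vfield \<Rightarrow> ('a, 'e) chart \<Rightarrow> 'e \<Rightarrow> 'e" where
  "vfield_rep x c = (\<lambda>y. x (param c y) c)"

definition vector_fields :: "('a, 'e::euclidean_space) manifold \<Rightarrow> ('a, 'e) vfield set" where
  "vector_fields M =
     {x. (\<forall>p\<in>points M. x p \<in> tangent_space M p) \<and>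
         (\<forall>p. p \<notin> points M \<longrightarrow> x p = zero_tvec) \<and>
         (\<forall>c\<in>atlas M. smooth_on (vfield_rep x c) (coord c ` cdom c))}"

definition supp :: "('a, 'e::euclidean_space) manifold \<Rightarrow> ('a, 'e) vfield \<Rightarrow> 'a set" where
  "supp M x = top_of M closure_of {p \<in> points M. x p \<noteq> zero_tvec}"

definition compact_vector_fields ::
  "('a, 'e::euclidean_space) manifold \<Rightarrow> ('a, 'e) vfield set" where
  "compact_vector_fields M = {x \<in> vector_fields M. compactin (top_of M) (supp M x)}"

text \<open>In coordinates \<open>[x, y] = Dy(x) - Dx(y)\<close>, i.e. \<open>[x, y] g = x (y g) - y (x g)\<close> on functions.\<close>

definition lie_bracket ::
  "('a, 'e::euclidean_space) manifold \<Rightarrow> ('a, 'e) vfield \<Rightarrow> ('a, 'e) vfield \<Rightarrow> ('a, 'e) vfield" where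
  "lie_bracket M x y =
     (\<lambda>p c. if c \<in> charts_at M p
        then frechet_derivative (vfield_rep y c) (at (coord c p) within coord c ` cdom c) (x p c)
           - frechet_derivative (vfield_rep x c) (at (coord c p) within coord c ` cdom c) (y p c)
        else 0)"

text \<open>A homomorphism from \<open>\<XX>\<^sub>c(M)\<close> to \<open>\<XX>(N)\<close>; its values outside \<open>\<XX>\<^sub>c(M)\<close> are irrelevant.\<close>

definition lie_homomorphism ::
  "('a, 'e::euclidean_space) manifold \<Rightarrow> ('b, 'f::euclidean_space) manifold \<Rightarrow>
    (('a, 'e) vfield \<Rightarrow> ('b, 'f) vfield) \<Rightarrow> bool" where
  "lie_homomorphism M N f \<longleftrightarrow>
     (\<forall>x\<in>compact_vector_fields M. f x \<in> vector_fields N) \<and>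
     (\<forall>x\<in>compact_vector_fields M. \<forall>y\<in>compact_vector_fields M.
        f (\<lambda>p c. x p c + y p c) = (\<lambda>q d. f x q d + f y q d)) \<and>
     (\<forall>r. \<forall>x\<in>compact_vector_fields M. f (\<lambda>p c. r *\<^sub>R x p c) = (\<lambda>q d. r *\<^sub>R f x q d)) \<and>
     (\<forall>x\<in>compact_vector_fields M. \<forall>y\<in>compact_vector_fields M.
        f (lie_bracket M x y) = lie_bracket N (f x) (f y))"

definition eval_at :: "'b \<Rightarrow> ('b, 'f) vfield \<Rightarrow> ('b, 'f) tvec" where
  "eval_at w x = x w"

definition support_points ::
  "('a, 'e::euclidean_space) manifold \<Rightarrow>
    (('a, 'e) vfield \<Rightarrow> ('b, 'f::euclidean_space) tvec) \<Rightarrow> 'a set" where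
  "support_points M L =
     {p \<in> points M. \<forall>U. openin (top_of M) U \<and> p \<in> U \<longrightarrow>
        (\<exists>x\<in>compact_vector_fields M. supp M x \<subseteq> U \<and> L x \<noteq> zero_tvec)}"

end

theory Submission
  imports Defs
begin

text \<open>Fix \<open>w\<close>. In a frame over the support \<open>S\<close>, condition (i) makes \<open>x \<mapsto> f x w\<close> restricted to constant
  combinations of the frame an isomorphism, so \<open>f x w\<close> becomes a coordinate vector \<open>\<Lambda> x\<close>, and as \<open>x - \<Lambda> x\<close>
  lies in the kernel it has a zero on \<open>S\<close>: \<open>\<Lambda> x\<close> is one of the values on \<open>S\<close> of the coordinates of \<open>x\<close>. As in the
  Gleason-Kahane-Zelazko theorem, a linear functional with this property is evaluation at a single point
  \<open>\<phi> w\<close>; in dimension one this is part of the hypothesis. So \<open>f x w\<close> vanishes iff \<open>x (\<phi> w)\<close> does, whence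
  \<open>f (g x) = (g \<circ> \<phi>) f x\<close> for functions \<open>g\<close>. Hence \<open>g \<circ> \<phi>\<close> is locally a quotient of smooth functions, and
  applying \<open>f\<close> to \<open>[x, g x] = (x g) x\<close> gives \<open>(f x) (g \<circ> \<phi>) = (x g) \<circ> \<phi>\<close>, i.e. \<open>d\<phi> (f x) = x \<circ> \<phi>\<close>.
  Conversely, for \<open>f\<close> as in (ii) the support at \<open>w\<close> is the point \<open>\<phi> w\<close>.\<close>

section \<open>Calculus of smooth maps on open sets\<close>

text \<open>The obstacle is that \<open>f\<close> is a purely algebraic map: neither continuity nor
  locality nor linearity over functions is given, so all information on \<open>f x w\<close> comes
  from zeros of fields on the support. Each test field supplies its own zero, and the difficulty is
  to find one point that serves all fields. Two independent frame directions let a single test field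
  compare two functions at the same point. With one direction the functional is only known to take a
  value in the range of each function, as an average over a connected set also does; hence the extra
  clause in dimension one. Manifolds that are not paracompact leave only cutoffs near compact sets
  in place of partitions of unity. Boundary points shape the calculus: derivatives are taken within
  chart images, where positive basis directions keep them unique, and local inverses come from
  inverting a smooth extension across the boundary.\<close>

lemma C_k_on_cong:
  assumes "open S" "\<And>x. x \<in> S \<Longrightarrow> f x = g x" "C_k_on k f S"
  shows "C_k_on k g S"
  using assms(2,3)
proof (induction k arbitrary: f g)
  case 0
  then show ?case using continuous_on_cong[of S S f g] by simp
next
  case (Suc k)
  have d: "g differentiable (at x)" if "x \<in> S" for x
  proof -
    have "(f has_derivative frechet_derivative f (at x)) (at x)"
      using Suc.prems(2) that by (simp add: frechet_derivative_works[symmetric])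
    from has_derivative_transform_within_open[OF this \<open>open S\<close> that Suc.prems(1)]
    show ?thesis by (rule differentiableI)
  qed
  have eq: "frechet_derivative f (at x) v = frechet_derivative g (at x) v" if "x \<in> S" for x v
    using frechet_derivative_transform_within_open[of f x S g] Suc.prems that \<open>open S\<close> by auto
  have "C_k_on k (\<lambda>x. frechet_derivative g (at x) v) S" for v
    by (rule Suc.IH[of "\<lambda>x. frechet_derivative f (at x) v"]) (use eq Suc.prems in auto)
  then show ?case using d by simp
qed

lemma C_k_on_subset:
  assumes "T \<subseteq> S" "C_k_on k f S"
  shows "C_k_on k f T"
  using assms(2)
proof (induction k arbitrary: f)
  case 0
  then show ?case using assms(1) continuous_on_subset by auto
qed (use assms(1) in auto)

text \<open>\<open>frechet_derivative\<close> is a choice operator. Uniqueness of derivatives lets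
  any explicit formula \<open>f'\<close> take its place; the closure properties that follow are
  mostly inductions on \<open>k\<close> through this rule.\<close>

lemma C_k_on_SucI:
  assumes "open S" "\<And>x. x \<in> S \<Longrightarrow> (f has_derivative f' x) (at x)"
    and "\<And>v. C_k_on k (\<lambda>x. f' x v) S"
  shows "C_k_on (Suc k) f S"
proof -
  have eq: "f' x v = frechet_derivative f (at x) v" if "x \<in> S" for x v
    using frechet_derivative_at[OF assms(2)[OF that]] by simp
  have "C_k_on k (\<lambda>x. frechet_derivative f (at x) v) S" for v
    by (rule C_k_on_cong[OF assms(1) eq assms(3)[of v]])
  moreover have "f differentiable (at x)" if "x \<in> S" for x
    using assms(2)[OF that] by (rule differentiableI)
  ultimately show ?thesis unfolding C_k_on.simps by blast
qed

lemma C_k_on_SucD: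
  assumes "C_k_on (Suc k) f S" "x \<in> S"
  shows "(f has_derivative frechet_derivative f (at x)) (at x)"
proof -
  have "f differentiable (at x)" using assms by simp
  then show ?thesis by (simp only: frechet_derivative_works)
qed

lemma C_k_on_frechet_derivative:
  "C_k_on (Suc k) f S \<Longrightarrow> C_k_on k (\<lambda>x. frechet_derivative f (at x) v) S"
  by simp

lemma C_k_on_continuous_on: "C_k_on k f S \<Longrightarrow> continuous_on S f"
  by (cases k) (simp_all add: continuous_at_imp_continuous_on differentiable_imp_continuous_within)

lemma C_k_on_lower:
  assumes "C_k_on (Suc k) f S"
  shows "C_k_on k f S"
  using assms
proof (induction k arbitrary: f)
  case 0
  then show ?case using C_k_on_continuous_on[OF 0] by simp
next
  case (Suc k)
  have "C_k_on k (\<lambda>x. frechet_derivative f (at x) v) S" for v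
    using Suc.prems by (intro Suc.IH) (simp only: C_k_on.simps(2)[of "Suc k"])
  moreover have "\<forall>x\<in>S. f differentiable (at x)" using Suc.prems by simp
  ultimately show ?case unfolding C_k_on.simps(2)[of k f] by blast
qed

lemma C_k_on_const: "open S \<Longrightarrow> C_k_on k (\<lambda>x. c) S"
proof (induction k arbitrary: c)
  case (Suc k)
  then show ?case by (intro C_k_on_SucI[where f'="\<lambda>x v. 0"]) auto
qed auto

lemma C_k_on_bounded_linear:
  assumes "bounded_linear L" "open S" "C_k_on k f S"
  shows "C_k_on k (\<lambda>x. L (f x)) S"
  using assms(3)
proof (induction k arbitrary: f)
  case 0
  then show ?case using assms(1) by (auto intro: bounded_linear.continuous_on)
next
  case (Suc k)
  show ?case
  proof (rule C_k_on_SucI[OF assms(2)])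
    show "((\<lambda>x. L (f x)) has_derivative (\<lambda>v. L (frechet_derivative f (at x) v))) (at x)" if "x \<in> S" for x
      using bounded_linear.has_derivative[OF assms(1) C_k_on_SucD[OF Suc.prems that]] .
  qed (use Suc in auto)
qed

lemma C_k_on_id: "open S \<Longrightarrow> C_k_on k (\<lambda>x. x) S"
proof (cases k)
  case (Suc k')
  assume "open S"
  show ?thesis unfolding Suc
    by (rule C_k_on_SucI[where f'="\<lambda>x v. v"]) (auto simp: \<open>open S\<close> C_k_on_const)
qed auto

lemma C_k_on_add:
  assumes "open S" "C_k_on k f S" "C_k_on k g S"
  shows "C_k_on k (\<lambda>x. f x + g x) S"
  using assms(2,3)
proof (induction k arbitrary: f g)
  case 0
  then show ?case by (auto intro: continuous_on_add)
next
  case (Suc k)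
  show ?case
  proof (rule C_k_on_SucI[OF assms(1)])
    show "((\<lambda>x. f x + g x) has_derivative
        (\<lambda>v. frechet_derivative f (at x) v + frechet_derivative g (at x) v)) (at x)" if "x \<in> S" for x
      using has_derivative_add[OF Suc.prems[THEN C_k_on_SucD, OF that]] .
  qed (use Suc in auto)
qed

lemma C_k_on_sum:
  assumes "open S" "finite I" "\<And>i. i \<in> I \<Longrightarrow> C_k_on k (f i) S"
  shows "C_k_on k (\<lambda>x. \<Sum>i\<in>I. f i x) S"
  using assms(2,3)
  by (induction I rule: finite_induct) (auto simp: C_k_on_const C_k_on_add assms(1))

text \<open>The derivative is again a sum of two values of \<open>B\<close>, so a single induction
  covers products, scaling and inner products alike.\<close>

lemma C_k_on_bilinear:
  assumes "bounded_bilinear B" "open S" "C_k_on k f S" "C_k_on k g S"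
  shows "C_k_on k (\<lambda>x. B (f x) (g x)) S"
  using assms(3,4)
proof (induction k arbitrary: f g)
  case 0
  then show ?case using assms(1) by (auto intro: bounded_bilinear.continuous_on)
next
  case (Suc k)
  show ?case
  proof (rule C_k_on_SucI[OF assms(2)])
    show "((\<lambda>x. B (f x) (g x)) has_derivative
        (\<lambda>v. B (f x) (frechet_derivative g (at x) v) + B (frechet_derivative f (at x) v) (g x))) (at x)"
      if "x \<in> S" for x
      using bounded_bilinear.FDERIV[OF assms(1) Suc.prems[THEN C_k_on_SucD, OF that]] .
    show "C_k_on k (\<lambda>x. B (f x) (frechet_derivative g (at x) v) + B (frechet_derivative f (at x) v) (g x)) S" for v
      by (intro C_k_on_add assms(2) Suc.IH Suc.prems[THEN C_k_on_lower]
          Suc.prems[THEN C_k_on_frechet_derivative])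
  qed
qed

lemmas C_k_on_scaleR = C_k_on_bilinear[OF bounded_bilinear_scaleR]
lemmas C_k_on_mult = C_k_on_bilinear[OF bounded_bilinear_mult]
lemmas C_k_on_inner = C_k_on_bilinear[OF bounded_bilinear_inner]

lemma linear_euclidean_sum:
  fixes f :: "'a::euclidean_space \<Rightarrow> 'b::real_vector"
  assumes "linear f"
  shows "f v = (\<Sum>b\<in>Basis. (v \<bullet> b) *\<^sub>R f b)"
proof -
  have "f v = f (\<Sum>b\<in>Basis. (v \<bullet> b) *\<^sub>R b)" by (simp add: euclidean_representation)
  also have "\<dots> = (\<Sum>b\<in>Basis. (v \<bullet> b) *\<^sub>R f b)"
    using assms by (simp add: linear_sum linear_scale)
  finally show ?thesis .
qed

text \<open>The definition controls derivatives in fixed directions only, whereas in the chain rule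
  the direction \<open>?Dg x v\<close> moves with \<open>x\<close>. Expanding it in the basis of the
  intermediate space leaves finitely many fixed directions with scalar coefficients, and the
  induction hypothesis applies to each.\<close>

lemma C_k_on_compose:
  fixes g :: "'a::euclidean_space \<Rightarrow> 'b::euclidean_space"
  assumes "open S" "open T" "\<And>x. x \<in> S \<Longrightarrow> g x \<in> T" "C_k_on k f T" "C_k_on k g S"
  shows "C_k_on k (\<lambda>x. f (g x)) S"
  using assms(4,5)
proof (induction k arbitrary: f)
  case 0
  then show ?case using assms(3) by (auto intro: continuous_on_compose2)
next
  case (Suc k)
  let ?Df = "\<lambda>x. frechet_derivative f (at x)"
  let ?Dg = "\<lambda>x. frechet_derivative g (at x)"
  show ?case
  proof (rule C_k_on_SucI[OF assms(1)])
    fix x assume x: "x \<in> S"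
    have f: "(f has_derivative ?Df (g x)) (at (g x))" using C_k_on_SucD[OF Suc.prems(1)] assms(3) x by blast
    then have l: "linear (?Df (g x))" by (simp add: has_derivative_linear)
    have "((\<lambda>x. f (g x)) has_derivative (\<lambda>v. ?Df (g x) (?Dg x v))) (at x)"
      using has_derivative_compose[OF C_k_on_SucD[OF Suc.prems(2) x] f] .
    moreover have "(\<lambda>v. ?Df (g x) (?Dg x v)) = (\<lambda>v. \<Sum>b\<in>Basis. (?Dg x v \<bullet> b) *\<^sub>R ?Df (g x) b)"
      using linear_euclidean_sum[OF l] by blast
    ultimately show "((\<lambda>x. f (g x)) has_derivative (\<lambda>v. \<Sum>b\<in>Basis. (?Dg x v \<bullet> b) *\<^sub>R ?Df (g x) b)) (at x)"
      by simp
  next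
    fix v
    show "C_k_on k (\<lambda>x. \<Sum>b\<in>Basis. (?Dg x v \<bullet> b) *\<^sub>R ?Df (g x) b) S"
    proof (intro C_k_on_sum C_k_on_scaleR assms(1) finite_Basis)
      fix b :: 'b
      show "C_k_on k (\<lambda>x. ?Dg x v \<bullet> b) S"
        using Suc.prems(2) by (intro C_k_on_inner C_k_on_const assms(1)) auto
      show "C_k_on k (\<lambda>x. ?Df (g x) b) S"
        using Suc.prems C_k_on_lower by (intro Suc.IH) auto
    qed
  qed
qed

lemma C_k_on_inverse: "C_k_on k (inverse :: real \<Rightarrow> real) (-{0})"
proof (induction k)
  case 0
  show ?case by (auto intro!: continuous_intros)
next
  case (Suc k)
  show ?case
  proof (rule C_k_on_SucI[where f'="\<lambda>x h. - (inverse x * h * inverse x)"])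
    show "(inverse has_derivative (\<lambda>h. - (inverse x * h * inverse x))) (at x)" if "x \<in> -{0}" for x :: real
      using has_derivative_inverse'[of x] that by auto
    fix v :: real
    have "C_k_on k (\<lambda>x. inverse x * (- v) * inverse x) (- {0})"
      by (intro C_k_on_mult C_k_on_const Suc) auto
    then show "C_k_on k (\<lambda>x. - (inverse x * v * inverse x)) (- {0})" by simp
  qed auto
qed


section \<open>A smooth step function\<close>

text \<open>The derivatives of exp (-1/t) leave that function but stay in the span of this family;
  carrying the exponent \<open>m\<close> is what lets the induction for smoothness close.\<close>

definition flat_exp :: "nat \<Rightarrow> real \<Rightarrow> real" where
  "flat_exp m t = (if 0 < t then exp (- (1 / t)) / t ^ m else 0)"

text \<open>This is the difference quotient at 0, the only point where the derivative is in doubt.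
  On the right, s = 1/t turns it into s^(m+1) / exp s.\<close>

lemma flat_exp_tendsto: "((\<lambda>t. flat_exp m t / t) \<longlongrightarrow> 0) (at 0)"
proof -
  have "((\<lambda>t::real. exp (- (1 / t)) / t ^ m / t) \<longlongrightarrow> 0) (at_right 0)"
  proof -
    have "((\<lambda>x::real. x ^ Suc m / exp x) \<longlongrightarrow> 0) at_top"
      by (rule tendsto_power_div_exp_0)
    then have "((\<lambda>t::real. (inverse t) ^ Suc m / exp (inverse t)) \<longlongrightarrow> 0) (at_right 0)"
      using filterlim_compose[OF _ filterlim_inverse_at_top_right] by blast
    then show ?thesis by (simp add: exp_minus field_simps)
  qed
  then have r: "((\<lambda>t. flat_exp m t / t) \<longlongrightarrow> 0) (at_right 0)"
    by (rule Lim_transform_eventually)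
      (auto simp: flat_exp_def eventually_at_filter)
  have l: "((\<lambda>t. flat_exp m t / t) \<longlongrightarrow> 0) (at_left 0)"
    by (rule tendsto_eventually) (auto simp: flat_exp_def eventually_at_filter)
  show ?thesis using l r by (simp add: filterlim_split_at)
qed

lemma flat_exp_has_derivative:
  "(flat_exp m has_derivative (\<lambda>h. (flat_exp (m + 2) t - real m * flat_exp (Suc m) t) * h)) (at t)"
proof -
  consider "t > 0" | "t < 0" | "t = 0" by linarith
  then have "(flat_exp m has_real_derivative (flat_exp (m + 2) t - real m * flat_exp (Suc m) t)) (at t)"
  proof cases
    case 1
    \<comment> \<open>The power rule produces the truncated exponent \<open>m - Suc 0\<close>; for
      \<open>m = 0\<close> the factor \<open>real m\<close> annihilates both sides.\<close>
    have "real m * (t * t ^ (m - Suc 0)) = real m * t ^ m"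
      by (cases m) auto
    then have "((\<lambda>t. exp (- (1 / t)) / t ^ m) has_real_derivative
        (flat_exp (m + 2) t - real m * flat_exp (Suc m) t)) (at t)"
      using 1 by (auto intro!: derivative_eq_intros simp: flat_exp_def divide_simps power2_eq_square)
        (auto simp: algebra_simps)
    then show ?thesis
      by (rule has_field_derivative_transform_within_open[where S="{0<..}"])
        (use 1 in \<open>auto simp: flat_exp_def\<close>)
  next
    case 2
    have "((\<lambda>t. 0) has_real_derivative (flat_exp (m + 2) t - real m * flat_exp (Suc m) t)) (at t)"
      using 2 by (simp add: flat_exp_def)
    then show ?thesis
      by (rule has_field_derivative_transform_within_open[where S="{..<0}"])
        (use 2 in \<open>auto simp: flat_exp_def\<close>)
  next
    case 3
    then show ?thesis using flat_exp_tendsto[of m]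
      by (simp add: has_field_derivative_iff flat_exp_def)
  qed
  then show ?thesis by (simp add: has_field_derivative_def)
qed

lemma C_k_on_flat_exp: "C_k_on k (flat_exp m) UNIV"
proof (induction k arbitrary: m)
  case 0
  show ?case using has_derivative_continuous[OF flat_exp_has_derivative]
    by (auto simp: continuous_on_eq_continuous_at)
next
  case (Suc k)
  have "C_k_on k (\<lambda>t. (flat_exp (m + 2) t + (- real m) * flat_exp (Suc m) t) * v) UNIV" for v
    by (intro C_k_on_mult C_k_on_add C_k_on_const Suc open_UNIV)
  then show ?case
    by (intro C_k_on_SucI[OF open_UNIV flat_exp_has_derivative]) auto
qed

text \<open>One of t < 2 and t > 1 always holds, so the denominator is positive. Applied to the
  squared distance divided by the square of r, the function is 1 up to distance r and 0 from
  distance sqrt 2 * r on, hence beyond 2 * r.\<close>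

definition smooth_step :: "real \<Rightarrow> real" where
  "smooth_step t = flat_exp 0 (2 - t) * inverse (flat_exp 0 (2 - t) + flat_exp 0 (t - 1))"

lemma smooth_step_eq_1: "t \<le> 1 \<Longrightarrow> smooth_step t = 1"
  by (simp add: smooth_step_def flat_exp_def)

lemma smooth_step_eq_0: "t \<ge> 2 \<Longrightarrow> smooth_step t = 0"
  by (simp add: smooth_step_def flat_exp_def)

lemma C_k_on_smooth_step: "C_k_on k smooth_step UNIV"
proof -
  have a: "C_k_on k (\<lambda>t. flat_exp 0 (2 - t)) UNIV"
    using C_k_on_add[OF open_UNIV C_k_on_const[OF open_UNIV]
         C_k_on_bounded_linear[OF bounded_linear_minus[OF bounded_linear_ident] open_UNIV C_k_on_id[OF open_UNIV]], of k 2]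
    by (intro C_k_on_compose[OF open_UNIV open_UNIV _ C_k_on_flat_exp]) auto
  have b: "C_k_on k (\<lambda>t. flat_exp 0 (t - 1)) UNIV"
    using C_k_on_add[OF open_UNIV C_k_on_id[OF open_UNIV] C_k_on_const[OF open_UNIV], of k "-1"]
    by (intro C_k_on_compose[OF open_UNIV open_UNIV _ C_k_on_flat_exp]) auto
  have "flat_exp 0 (2 - t) + flat_exp 0 (t - 1) \<noteq> 0" for t
    by (cases "t < 2") (auto simp: flat_exp_def add_pos_pos less_imp_neq[symmetric] intro: add_pos_nonneg)
  then have "C_k_on k (\<lambda>t. inverse (flat_exp 0 (2 - t) + flat_exp 0 (t - 1))) UNIV"
    by (intro C_k_on_compose[OF open_UNIV _ _ C_k_on_inverse] C_k_on_add a b) auto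
  then show ?thesis unfolding smooth_step_def[abs_def] by (intro C_k_on_mult a open_UNIV)
qed

section \<open>The inverse function theorem for smooth maps\<close>

text \<open>Since \<open>a x = 0\<close>, the error against the constant factor \<open>c x\<close>
  is (c y - c x) times a y, a null factor times a quantity of order \<open>norm (y - x)\<close>. The
  lemma serves the derivative of an inverse function, whose own derivative is at that stage only
  known to be continuous.\<close>

lemma has_derivative_scaleR_vanishing:
  fixes a :: "'a::real_normed_vector \<Rightarrow> 'b::real_normed_vector"
  assumes "isCont c x" "(a has_derivative a') (at x)" "a x = 0"
  shows "((\<lambda>y. c y *\<^sub>R a y) has_derivative (\<lambda>h. c x *\<^sub>R a' h)) (at x)"
proof -
  let ?e = "\<lambda>y. norm (a y - a x - a' (y - x)) / norm (y - x)"
  have bl: "bounded_linear a'" using assms(2) by (rule has_derivative_bounded_linear)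
  have e: "(?e \<longlongrightarrow> 0) (at x)" using assms(2) by (simp add: has_derivative_iff_norm)
  have bound: "norm (((c y - c x) *\<^sub>R a y)) / norm (y - x) \<le> \<bar>c y - c x\<bar> * (?e y + onorm a')" for y
  proof -
    have "norm (a y) \<le> norm (a y - a x - a' (y - x)) + onorm a' * norm (y - x)"
      using norm_triangle_ineq[of "a y - a' (y - x)" "a' (y - x)"] onorm[OF bl, of "y - x"] assms(3)
      by simp
    then have "norm (a y) / norm (y - x) \<le> ?e y + onorm a'"
      using onorm_pos_le[OF bl] by (cases "y = x") (auto simp: field_simps)
    from mult_left_mono[OF this, of "\<bar>c y - c x\<bar>"] show ?thesis by simp
  qed
  have "((\<lambda>y. \<bar>c y - c x\<bar> * (?e y + onorm a')) \<longlongrightarrow> \<bar>c x - c x\<bar> * (0 + onorm a')) (at x)"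
    using assms(1) e unfolding isCont_def by (intro tendsto_intros) auto
  then have lim: "((\<lambda>y. \<bar>c y - c x\<bar> * (?e y + onorm a')) \<longlongrightarrow> 0) (at x)" by simp
  have "((\<lambda>y. norm ((c y - c x) *\<^sub>R a y) / norm (y - x)) \<longlongrightarrow> 0) (at x)"
    by (rule Lim_null_comparison[OF _ lim]) (simp only: norm_divide real_norm_def abs_divide abs_norm_cancel bound eventually_True)
  then have "((\<lambda>y. (c y - c x) *\<^sub>R a y) has_derivative (\<lambda>h. 0)) (at x)"
    using assms(3) by (simp add: has_derivative_iff_norm)
  from has_derivative_add[OF this has_derivative_scaleR_right[OF assms(2), of "c x"]]
  show ?thesis by (simp add: algebra_simps)
qed

text \<open>Differentiating \<open>DG (H y) (H' y v) = v\<close> expresses the derivative of \<open>H'\<close> as a polynomial in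
  \<open>H'\<close> and the second derivatives of \<open>G\<close> at \<open>H y\<close>, so smoothness of \<open>H\<close> bootstraps.\<close>

lemma smooth_local_inverse:
  fixes G :: "'a::euclidean_space \<Rightarrow> 'b::euclidean_space"
  assumes "open U" "open V" and G: "\<And>k. C_k_on k G U"
    and HU: "\<And>y. y \<in> V \<Longrightarrow> H y \<in> U"
    and H': "\<And>y. y \<in> V \<Longrightarrow> (H has_derivative H' y) (at y)"
    and right: "\<And>y v. y \<in> V \<Longrightarrow> frechet_derivative G (at (H y)) (H' y v) = v"
    and left: "\<And>y u. y \<in> V \<Longrightarrow> H' y (frechet_derivative G (at (H y)) u) = u"
  shows "C_k_on k H V"
proof -
  define B where "B = (\<lambda>b x. frechet_derivative G (at x) b)"
  have B: "C_k_on k (B b) U" for k b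
    unfolding B_def using G by (rule C_k_on_frechet_derivative)
  have dB: "(B b has_derivative frechet_derivative (B b) (at x)) (at x)" if "x \<in> U" for b x
    using C_k_on_SucD[OF B that] .
  have lin_G: "linear (\<lambda>b. B b x)" if "x \<in> U" for x
    unfolding B_def using has_derivative_linear[OF C_k_on_SucD[OF G that]] .
  have lin_H: "bounded_linear (H' y)" if "y \<in> V" for y
    using H'[OF that] by (rule has_derivative_bounded_linear)
  \<comment> \<open>\<open>a y b z\<close> is the change of the vector DG(.) b between
    \<open>H y\<close> and \<open>H z\<close>, pulled back by \<open>H' y\<close>. It vanishes at
    \<open>z = y\<close> and is differentiable there, although \<open>H' z\<close> is not yet known
    to be.\<close>
  define a where "a = (\<lambda>y b z. H' y (B b (H z) - B b (H y)))"
  define a' where "a' = (\<lambda>y b h. H' y (frechet_derivative (B b) (at (H y)) (H' y h)))"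
  have da: "(a y b has_derivative a' y b) (at y)" if y: "y \<in> V" for y b
    unfolding a_def a'_def
    using has_derivative_diff[OF has_derivative_compose[OF H'[OF y] dB[OF HU[OF y]]] has_derivative_const]
    by (intro bounded_linear.has_derivative[OF lin_H[OF y]]) auto
  \<comment> \<open>The resolvent identity P^-1 - Q^-1 = - Q^-1 (P - Q) P^-1 for P = DG(H z) and Q =
    DG(H y), written in a basis.\<close>
  have diff: "H' z v - H' y v = - (\<Sum>b\<in>Basis. (H' z v \<bullet> b) *\<^sub>R a y b z)"
    if y: "y \<in> V" and z: "z \<in> V" for y z v
  proof -
    have "(\<Sum>b\<in>Basis. (H' z v \<bullet> b) *\<^sub>R a y b z) =
        H' y ((\<Sum>b\<in>Basis. (H' z v \<bullet> b) *\<^sub>R B b (H z)) - (\<Sum>b\<in>Basis. (H' z v \<bullet> b) *\<^sub>R B b (H y)))"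
      using lin_H[OF y, THEN bounded_linear.linear]
      by (simp add: a_def linear_diff linear_sum linear_scale scaleR_diff_right sum_subtractf)
    also have "(\<Sum>b\<in>Basis. (H' z v \<bullet> b) *\<^sub>R B b (H z)) = v"
      using linear_euclidean_sum[OF lin_G[OF HU[OF z]], of "H' z v"] right[OF z] by (simp add: B_def)
    also have "(\<Sum>b\<in>Basis. (H' z v \<bullet> b) *\<^sub>R B b (H y)) = frechet_derivative G (at (H y)) (H' z v)"
      using linear_euclidean_sum[OF lin_G[OF HU[OF y]], of "H' z v"] by (simp add: B_def)
    also have "H' y (v - frechet_derivative G (at (H y)) (H' z v)) = H' y v - H' z v"
      using lin_H[OF y, THEN bounded_linear.linear] left[OF y] by (simp add: linear_diff)
    finally show ?thesis by simp
  qed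
  \<comment> \<open>By \<open>diff\<close> the increment is at most \<open>r z\<close> times
    \<open>norm (H' z v)\<close>, where \<open>r z\<close> tends to 0. Once \<open>r z\<close> is
    below 1/2 the increment can be absorbed, which bounds \<open>norm (H' z v)\<close> by twice
    \<open>norm (H' y v)\<close>.\<close>
  have cont: "isCont (\<lambda>z. H' z v) y" if y: "y \<in> V" for y v
  proof -
    define r where "r = (\<lambda>z. \<Sum>b\<in>Basis. norm (a y b z))"
    have "isCont (a y b) y" for b using da[OF y] by (rule has_derivative_continuous)
    then have r: "(r \<longlongrightarrow> 0) (at y)"
      unfolding r_def isCont_def by (intro tendsto_null_sum tendsto_norm_zero) (auto simp: a_def
          linear_0[OF bounded_linear.linear[OF lin_H[OF y]]])
    have est: "norm (H' z v - H' y v) \<le> r z * norm (H' z v)" if "z \<in> V" for z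
    proof -
      have "norm (H' z v - H' y v) \<le> (\<Sum>b\<in>Basis. norm ((H' z v \<bullet> b) *\<^sub>R a y b z))"
        unfolding diff[OF y that] norm_minus_cancel by (rule norm_sum)
      also have "\<dots> \<le> (\<Sum>b\<in>Basis. norm (H' z v) * norm (a y b z))"
        by (intro sum_mono) (auto intro!: mult_right_mono simp: Basis_le_norm)
      finally show ?thesis by (simp add: r_def sum_distrib_left mult.commute)
    qed
    have "\<forall>\<^sub>F z in at y. r z < 1/2" using r by (rule order_tendstoD) simp
    moreover have "\<forall>\<^sub>F z in at y. z \<in> V" using y \<open>open V\<close> by (simp add: eventually_at_in_open')
    ultimately have "\<forall>\<^sub>F z in at y. norm (H' z v - H' y v) \<le> r z * (2 * norm (H' y v))"
    proof eventually_elim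
      case (elim z)
      have r0: "r z \<ge> 0" by (simp add: r_def sum_nonneg)
      have "norm (H' z v) \<le> norm (H' y v) + norm (H' z v - H' y v)"
        using norm_triangle_ineq[of "H' y v" "H' z v - H' y v"] by simp
      also have "\<dots> \<le> norm (H' y v) + 1/2 * norm (H' z v)"
        using est[OF elim(2)] mult_right_mono[of "r z" "1/2" "norm (H' z v)"] elim(1) by simp
      finally have "norm (H' z v) \<le> 2 * norm (H' y v)" by simp
      then show ?case using est[OF elim(2)] mult_left_mono[OF _ r0] by (meson order_trans)
    qed
    moreover have "((\<lambda>z. r z * (2 * norm (H' y v))) \<longlongrightarrow> 0) (at y)"
      using tendsto_mult_right[OF r, of "2 * norm (H' y v)"] by simp
    ultimately have "((\<lambda>z. H' z v - H' y v) \<longlongrightarrow> 0) (at y)" by (rule Lim_null_comparison)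
    then show ?thesis by (simp add: isCont_def LIM_zero_iff)
  qed
  define D where "D = (\<lambda>v y h. - (\<Sum>b\<in>Basis. (H' y v \<bullet> b) *\<^sub>R a' y b h))"
  have dH': "((\<lambda>z. H' z v) has_derivative D v y) (at y)" if y: "y \<in> V" for y v
  proof -
    have "((\<lambda>z. H' y v - (\<Sum>b\<in>Basis. (H' z v \<bullet> b) *\<^sub>R a y b z)) has_derivative (\<lambda>h. 0 - (\<Sum>b\<in>Basis. (H' y v \<bullet> b) *\<^sub>R a' y b h))) (at y)"
      using cont[OF y] da[OF y] linear_0[OF bounded_linear.linear[OF lin_H[OF y]]]
      by (intro has_derivative_diff has_derivative_const has_derivative_sum has_derivative_scaleR_vanishing)
        (auto simp: a_def intro!: continuous_intros)
    then have "((\<lambda>z. H' z v) has_derivative (\<lambda>h. 0 - (\<Sum>b\<in>Basis. (H' y v \<bullet> b) *\<^sub>R a' y b h))) (at y)"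
    proof (rule has_derivative_transform_within_open[OF _ \<open>open V\<close> y])
      fix z assume "z \<in> V"
      have "H' z v = H' y v + (H' z v - H' y v)" by simp
      also have "\<dots> = H' y v - (\<Sum>b\<in>Basis. (H' z v \<bullet> b) *\<^sub>R a y b z)"
        unfolding diff[OF y \<open>z \<in> V\<close>] by simp
      finally show "H' y v - (\<Sum>b\<in>Basis. (H' z v \<bullet> b) *\<^sub>R a y b z) = H' z v" by simp
    qed
    then show ?thesis by (simp add: D_def)
  qed
  \<comment> \<open>The three vectors that move with \<open>y\<close> are expanded in bases. What
    remains are values of \<open>H'\<close> and second derivatives of \<open>G\<close> in fixed
    directions, to which the induction hypothesis applies.\<close>
  have D_eq: "D v y h = - (\<Sum>b\<in>Basis. (H' y v \<bullet> b) *\<^sub>R (\<Sum>c\<in>Basis. (H' y h \<bullet> c) *\<^sub>R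
      (\<Sum>d\<in>Basis. (frechet_derivative (B b) (at (H y)) c \<bullet> d) *\<^sub>R H' y d)))"
    if y: "y \<in> V" for v y h
  proof -
    have "a' y b h = (\<Sum>c\<in>Basis. (H' y h \<bullet> c) *\<^sub>R H' y (frechet_derivative (B b) (at (H y)) c))" for b
      unfolding a'_def
      using linear_euclidean_sum[OF linear_compose[OF has_derivative_linear[OF dB[OF HU[OF y], of b]]
           bounded_linear.linear[OF lin_H[OF y]]], of "H' y h"] by (simp add: o_def)
    moreover have "H' y (frechet_derivative (B b) (at (H y)) c) =
        (\<Sum>d\<in>Basis. (frechet_derivative (B b) (at (H y)) c \<bullet> d) *\<^sub>R H' y d)" for b c
      using linear_euclidean_sum[OF bounded_linear.linear[OF lin_H[OF y]]] .
    ultimately show ?thesis by (simp add: D_def)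
  qed
  have contH: "continuous_on V H"
    using H' has_derivative_continuous continuous_at_imp_continuous_on by blast
  \<comment> \<open>\<open>H\<close> and its directional derivatives are treated together: raising
    the order of \<open>H\<close> uses them at order \<open>k\<close>, and their own derivatives
    involve \<open>H\<close>.\<close>
  have "C_k_on k H V \<and> (\<forall>v. C_k_on k (\<lambda>y. H' y v) V)"
  proof (induction k)
    case 0
    have "continuous_on V (\<lambda>y. H' y v)" for v
      using cont by (intro continuous_at_imp_continuous_on ballI)
    then show ?case using contH by simp
  next
    case (Suc k)
    have IH: "C_k_on k H V" "\<And>v. C_k_on k (\<lambda>y. H' y v) V" using Suc by blast+
    have H: "C_k_on (Suc k) H V"
      by (rule C_k_on_SucI[OF \<open>open V\<close> H' IH(2)])
    have "C_k_on k (\<lambda>y. D v y h) V" for v h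
    proof -
      have "C_k_on k (\<lambda>y. frechet_derivative (B b) (at (H y)) c) V" for b c
        by (rule C_k_on_compose[OF \<open>open V\<close> \<open>open U\<close> HU C_k_on_frechet_derivative[OF B] IH(1)])
      then have "C_k_on k (\<lambda>y. (-1) *\<^sub>R (\<Sum>b\<in>Basis. (H' y v \<bullet> b) *\<^sub>R (\<Sum>c\<in>Basis. (H' y h \<bullet> c) *\<^sub>R
      (\<Sum>d\<in>Basis. (frechet_derivative (B b) (at (H y)) c \<bullet> d) *\<^sub>R H' y d)))) V"
        by (intro C_k_on_sum C_k_on_scaleR C_k_on_inner C_k_on_const finite_Basis IH \<open>open V\<close>)
      then show ?thesis
        by (rule C_k_on_cong[OF \<open>open V\<close>, rotated]) (simp add: D_eq)
    qed
    then have "C_k_on (Suc k) (\<lambda>y. H' y v) V" for v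
      by (intro C_k_on_SucI[OF \<open>open V\<close> dH'])
    then show ?case using H by blast
  qed
  then show ?thesis by blast
qed

text \<open>Composition with \<open>A\<close>, the inverse of the derivative at \<open>x\<close>,
  turns \<open>G\<close> into a map of \<open>'a\<close> into itself with identity derivative at
  \<open>x\<close>, so that the C^1 inverse function theorem applies. It yields an inverse and its
  derivative; \<open>smooth_local_inverse\<close> raises the regularity.\<close>

lemma smooth_inverse_function:
  fixes G :: "'a::euclidean_space \<Rightarrow> 'b::euclidean_space"
  assumes "open U" "x \<in> U" and G: "\<And>k. C_k_on k G U"
    and bij: "bij (frechet_derivative G (at x))"
  obtains U' V H where "open U'" "U' \<subseteq> U" "x \<in> U'" "open V" "homeomorphism U' V G H"
    "\<And>k. C_k_on k H V"
proof -
  define A where "A = inv (frechet_derivative G (at x))"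
  have dG: "(G has_derivative frechet_derivative G (at z)) (at z)" if "z \<in> U" for z
    using C_k_on_SucD[OF G that] .
  have linA: "linear A"
  proof (rule linearI)
    have lin: "linear (frechet_derivative G (at x))"
      using has_derivative_linear[OF dG[OF \<open>x \<in> U\<close>]] .
    have r: "frechet_derivative G (at x) (A y) = y" for y
      unfolding A_def using bij by (simp add: bij_is_surj surj_f_inv_f)
    have l: "A y = u" if "frechet_derivative G (at x) u = y" for u y
      unfolding A_def using bij that by (auto simp: bij_is_inj inv_f_f)
    show "A (y + z) = A y + A z" for y z by (rule l) (simp add: linear_add[OF lin] r)
    show "A (c *\<^sub>R y) = c *\<^sub>R A y" for c y by (rule l) (simp add: linear_scale[OF lin] r)
  qed
  then have blA: "bounded_linear A" by (simp add: linear_conv_bounded_linear)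
  have bijA: "bij A" unfolding A_def using bij by (rule bij_imp_bij_inv)
  define f' where "f' = (\<lambda>z. Blinfun (\<lambda>v. A (frechet_derivative G (at z) v)))"
  have bl: "bounded_linear (\<lambda>v. A (frechet_derivative G (at z) v))" if "z \<in> U" for z
    using bounded_linear_compose[OF blA has_derivative_bounded_linear[OF dG[OF that]]] .
  have f': "blinfun_apply (f' z) = (\<lambda>v. A (frechet_derivative G (at z) v))" if "z \<in> U" for z
    using bounded_linear_Blinfun_apply[OF bl[OF that]] by (simp add: f'_def)
  have d: "((\<lambda>z. A (G z)) has_derivative blinfun_apply (f' z)) (at z)" if "z \<in> U" for z
    unfolding f'[OF that] using bounded_linear.has_derivative[OF blA dG[OF that]] .
  have cont: "continuous_on U f'"
  proof (rule continuous_on_blinfun_componentwise)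
    fix i :: 'a assume "i \<in> Basis"
    have "continuous_on U (\<lambda>z. A (frechet_derivative G (at z) i))"
      by (rule bounded_linear.continuous_on[OF blA C_k_on_continuous_on[OF C_k_on_frechet_derivative[OF G]]])
    then show "continuous_on U (\<lambda>z. blinfun_apply (f' z) i)"
      by (rule continuous_on_eq) (simp add: f')
  qed
  have "f' x = id_blinfun"
    using bij by (intro blinfun_eqI) (simp add: f' \<open>x \<in> U\<close> A_def inv_f_f bij_is_inj)
  then have inv: "id_blinfun o\<^sub>L f' x = id_blinfun"
    by (intro blinfun_eqI) simp
  obtain U' W g g' where U': "open U'" "U' \<subseteq> U" "x \<in> U'" and W: "open W" "A (G x) \<in> W"
    and hom: "homeomorphism U' W (\<lambda>z. A (G z)) g"
    and g': "\<And>y. y \<in> W \<Longrightarrow> (g has_derivative (g' y)) (at y)"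
      "\<And>y. y \<in> W \<Longrightarrow> g' y = inv (blinfun_apply (f' (g y)))"
      "\<And>y. y \<in> W \<Longrightarrow> bij (blinfun_apply (f' (g y)))"
    using inverse_function_theorem[OF \<open>open U\<close> d cont \<open>x \<in> U\<close> inv] by blast
  define V where "V = A -` W"
  define H where "H = (\<lambda>y. g (A y))"
  have contA: "continuous_on S A" for S using blA by (rule linear_continuous_on)
  have "open V" unfolding V_def using W(1) contA by (rule open_vimage)
  have HU': "H y \<in> U'" if "y \<in> V" for y
    using hom that by (auto simp: V_def H_def homeomorphism_def)
  have hom': "homeomorphism U' V G H"
  proof (rule homeomorphismI)
    show "continuous_on U' G" by (rule continuous_on_subset[OF C_k_on_continuous_on[OF G] U'(2)])
    show "continuous_on V H" unfolding H_def
      using hom contA by (intro continuous_on_compose2[of W g V A]) (auto simp: V_def homeomorphism_def)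
    show "G ` U' \<subseteq> V" using hom by (auto simp: V_def homeomorphism_def)
    show "H ` V \<subseteq> U'" using HU' by blast
    show "H (G z) = z" if "z \<in> U'" for z
      using hom that by (auto simp: H_def homeomorphism_def)
    show "G (H y) = y" if "y \<in> V" for y
    proof -
      have "A (G (H y)) = A y" using hom that by (auto simp: V_def H_def homeomorphism_def)
      then show ?thesis using bijA by (simp add: bij_is_inj inj_eq)
    qed
  qed
  have "C_k_on k H V" for k
  proof (rule smooth_local_inverse[OF \<open>open U\<close> \<open>open V\<close> G, where H' = "\<lambda>y v. g' (A y) (A v)"])
    fix y assume y: "y \<in> V"
    then have Ay: "A y \<in> W" by (simp add: V_def)
    show HU: "H y \<in> U" using HU'[OF y] U'(2) by blast
    show "(H has_derivative (\<lambda>v. g' (A y) (A v))) (at y)"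
      unfolding H_def using has_derivative_compose[OF bounded_linear_imp_has_derivative[OF blA] g'(1)[OF Ay]] .
    have f: "f' (g (A y)) v = A (frechet_derivative G (at (H y)) v)" for v
      using f'[OF HU] by (simp add: H_def)
    have "A (frechet_derivative G (at (H y)) (g' (A y) (A v))) = A v" for v
      unfolding f[symmetric] g'(2)[OF Ay] using g'(3)[OF Ay] by (simp add: bij_is_surj surj_f_inv_f)
    then show "frechet_derivative G (at (H y)) (g' (A y) (A v)) = v" for v
      using bijA by (simp add: bij_is_inj inj_eq)
    show "g' (A y) (A (frechet_derivative G (at (H y)) u)) = u" for u
      unfolding f[symmetric] g'(2)[OF Ay] using g'(3)[OF Ay] by (simp add: bij_is_inj inv_f_f)
  qed
  then show thesis using that[OF U' \<open>open V\<close> hom'] by blast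
qed

section \<open>Smooth maps on arbitrary subsets\<close>

lemma smooth_onE:
  assumes "smooth_on f S" "x \<in> S"
  obtains U g where "open U" "x \<in> U" "\<And>k. C_k_on k g U" "\<And>y. y \<in> S \<Longrightarrow> y \<in> U \<Longrightarrow> g y = f y"
proof -
  from assms obtain U g where "open U \<and> x \<in> U \<and> (\<forall>k. C_k_on k g U) \<and> (\<forall>y\<in>S \<inter> U. g y = f y)"
    unfolding smooth_on_def by meson
  then show thesis by (intro that[of U g]) blast+
qed

lemma smooth_onI:
  assumes "\<And>x. x \<in> S \<Longrightarrow>
    \<exists>U g. open U \<and> x \<in> U \<and> (\<forall>k. C_k_on k g U) \<and> (\<forall>y\<in>S \<inter> U. g y = f y)"
  shows "smooth_on f S"
  using assms unfolding smooth_on_def by blast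

lemma smooth_on_open:
  assumes "open S" "\<And>k. C_k_on k f S"
  shows "smooth_on f S"
proof (rule smooth_onI)
  fix x assume "x \<in> S"
  then show "\<exists>U g. open U \<and> x \<in> U \<and> (\<forall>k. C_k_on k g U) \<and> (\<forall>y\<in>S \<inter> U. g y = f y)"
    using assms by (intro exI[of _ S] exI[of _ f]) blast
qed

lemma smooth_on_subset: "smooth_on f S \<Longrightarrow> T \<subseteq> S \<Longrightarrow> smooth_on f T"
proof (rule smooth_onI)
  fix x assume "smooth_on f S" "T \<subseteq> S" "x \<in> T"
  then obtain U g where "open U" "x \<in> U" "\<And>k. C_k_on k g U" "\<And>y. y \<in> S \<Longrightarrow> y \<in> U \<Longrightarrow> g y = f y"
    using smooth_onE[of f S x] by blast
  then show "\<exists>U g. open U \<and> x \<in> U \<and> (\<forall>k. C_k_on k g U) \<and> (\<forall>y\<in>T \<inter> U. g y = f y)"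
    using \<open>T \<subseteq> S\<close> by (intro exI[of _ U] exI[of _ g]) blast
qed

lemma smooth_on_local:
  assumes "\<And>x. x \<in> S \<Longrightarrow> \<exists>U. open U \<and> x \<in> U \<and> smooth_on f (S \<inter> U)"
  shows "smooth_on f S"
proof (rule smooth_onI)
  fix x assume x: "x \<in> S"
  from assms[OF x] obtain U where U: "open U" "x \<in> U" "smooth_on f (S \<inter> U)" by blast
  obtain V g where g: "open V" "x \<in> V" "\<And>k. C_k_on k g V" "\<And>y. y \<in> S \<inter> U \<Longrightarrow> y \<in> V \<Longrightarrow> g y = f y"
    using smooth_onE[OF U(3)] x U(2) by blast
  have "C_k_on k g (U \<inter> V)" for k using C_k_on_subset[OF _ g(3)] by blast
  then show "\<exists>U g. open U \<and> x \<in> U \<and> (\<forall>k. C_k_on k g U) \<and> (\<forall>y\<in>S \<inter> U. g y = f y)"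
    using U g by (intro exI[of _ "U \<inter> V"] exI[of _ g]) (simp add: open_Int)
qed

lemma smooth_on_cong:
  assumes "smooth_on f S" "\<And>x. x \<in> S \<Longrightarrow> f x = g x"
  shows "smooth_on g S"
  using assms unfolding smooth_on_def by (metis IntD1)

lemma smooth_on_imp_continuous_on:
  assumes "smooth_on f S"
  shows "continuous_on S f"
  unfolding continuous_on_eq_continuous_within
proof
  fix x assume x: "x \<in> S"
  obtain U g where g: "open U" "x \<in> U" "\<And>k. C_k_on k g U" "\<And>y. y \<in> S \<Longrightarrow> y \<in> U \<Longrightarrow> g y = f y"
    using smooth_onE[OF assms x] by blast
  have "continuous (at x within S) g"
    using C_k_on_continuous_on[OF g(3)] g(1,2) continuous_at_imp_continuous_at_within
    by (metis continuous_on_eq_continuous_at)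
  moreover have "\<forall>\<^sub>F y in at x within S. g y = f y"
    using g(1,2,4) by (auto simp: eventually_at_topological)
  ultimately show "continuous (at x within S) f"
    using g(2,4) x unfolding continuous_within by (metis Lim_transform_eventually)
qed

lemma smooth_on_const: "smooth_on (\<lambda>x. c) S"
  by (rule smooth_on_subset[OF smooth_on_open[OF open_UNIV C_k_on_const[OF open_UNIV]]]) simp

lemma smooth_on_id: "smooth_on (\<lambda>x. x) S"
  by (rule smooth_on_subset[OF smooth_on_open[OF open_UNIV C_k_on_id[OF open_UNIV]]]) simp

lemma smooth_on_compose:
  fixes g :: "'a::euclidean_space \<Rightarrow> 'b::euclidean_space"
  assumes "smooth_on f T" "smooth_on g S" "\<And>x. x \<in> S \<Longrightarrow> g x \<in> T"
  shows "smooth_on (\<lambda>x. f (g x)) S"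
proof (rule smooth_onI)
  fix x assume x: "x \<in> S"
  obtain U g1 where g: "open U" "x \<in> U" "\<And>k. C_k_on k g1 U" "\<And>y. y \<in> S \<Longrightarrow> y \<in> U \<Longrightarrow> g1 y = g y"
    using smooth_onE[OF assms(2) x] by blast
  obtain V f1 where f: "open V" "g x \<in> V" "\<And>k. C_k_on k f1 V" "\<And>y. y \<in> T \<Longrightarrow> y \<in> V \<Longrightarrow> f1 y = f y"
    using smooth_onE[OF assms(1) assms(3)[OF x]] by blast
  \<comment> \<open>The extension \<open>g1\<close> may leave \<open>V\<close> away from
    \<open>S\<close>, so its domain is cut down to a preimage.\<close>
  define N where "N = U \<inter> g1 -` V"
  have "open N"
    unfolding N_def using continuous_open_preimage[OF C_k_on_continuous_on[OF g(3)] g(1) f(1)] .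
  moreover have "C_k_on k (\<lambda>x. f1 (g1 x)) N" for k
    by (rule C_k_on_compose[OF \<open>open N\<close> f(1) _ f(3) C_k_on_subset[OF _ g(3)]]) (auto simp: N_def)
  moreover have "x \<in> N" using g f x by (simp add: N_def)
  moreover have "\<forall>y\<in>S \<inter> N. f1 (g1 y) = f (g y)"
  proof
    fix y assume y: "y \<in> S \<inter> N"
    then have "g1 y = g y" using g(4) by (simp add: N_def)
    then show "f1 (g1 y) = f (g y)" using f(4)[of "g y"] assms(3)[of y] y by (simp add: N_def)
  qed
  ultimately show "\<exists>U h. open U \<and> x \<in> U \<and> (\<forall>k. C_k_on k h U) \<and> (\<forall>y\<in>S \<inter> U. h y = f (g y))"
    by (intro exI[of _ N] exI[of _ "\<lambda>x. f1 (g1 x)"]) blast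
qed

lemma smooth_on_bounded_linear:
  assumes "bounded_linear L" "smooth_on f S"
  shows "smooth_on (\<lambda>x. L (f x)) S"
proof (rule smooth_onI)
  fix x assume x: "x \<in> S"
  obtain U g where g: "open U" "x \<in> U" "\<And>k. C_k_on k g U" "\<And>y. y \<in> S \<Longrightarrow> y \<in> U \<Longrightarrow> g y = f y"
    using smooth_onE[OF assms(2) x] by blast
  then show "\<exists>U h. open U \<and> x \<in> U \<and> (\<forall>k. C_k_on k h U) \<and> (\<forall>y\<in>S \<inter> U. h y = L (f y))"
    using C_k_on_bounded_linear[OF assms(1) g(1,3)]
    by (intro exI[of _ U] exI[of _ "\<lambda>x. L (g x)"]) simp
qed

lemma smooth_on_common_domain:
  assumes "smooth_on f S" "smooth_on h S" "x \<in> S"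
  obtains U f1 h1 where "open U" "x \<in> U" "\<And>k. C_k_on k f1 U" "\<And>k. C_k_on k h1 U"
    "\<And>y. y \<in> S \<Longrightarrow> y \<in> U \<Longrightarrow> f1 y = f y" "\<And>y. y \<in> S \<Longrightarrow> y \<in> U \<Longrightarrow> h1 y = h y"
proof -
  obtain U f1 where f: "open U" "x \<in> U" "\<And>k. C_k_on k f1 U" "\<And>y. y \<in> S \<Longrightarrow> y \<in> U \<Longrightarrow> f1 y = f y"
    using smooth_onE[OF assms(1,3)] by blast
  obtain V h1 where h: "open V" "x \<in> V" "\<And>k. C_k_on k h1 V" "\<And>y. y \<in> S \<Longrightarrow> y \<in> V \<Longrightarrow> h1 y = h y"
    using smooth_onE[OF assms(2,3)] by blast
  show thesis
  proof (rule that)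
    show "open (U \<inter> V)" "x \<in> U \<inter> V" using f h by auto
    show "C_k_on k f1 (U \<inter> V)" for k by (rule C_k_on_subset[OF _ f(3)]) simp
    show "C_k_on k h1 (U \<inter> V)" for k by (rule C_k_on_subset[OF _ h(3)]) simp
  qed (use f(4) h(4) in auto)
qed

lemma smooth_on_bilinear:
  assumes "bounded_bilinear B" "smooth_on f S" "smooth_on h S"
  shows "smooth_on (\<lambda>x. B (f x) (h x)) S"
proof (rule smooth_onI)
  fix x assume x: "x \<in> S"
  obtain U f1 h1 where "open U" "x \<in> U" and *: "\<And>k. C_k_on k f1 U" "\<And>k. C_k_on k h1 U"
    and "\<And>y. y \<in> S \<Longrightarrow> y \<in> U \<Longrightarrow> f1 y = f y" "\<And>y. y \<in> S \<Longrightarrow> y \<in> U \<Longrightarrow> h1 y = h y"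
    by (rule smooth_on_common_domain[OF assms(2,3) x]) (rule that; assumption)
  then show "\<exists>U g. open U \<and> x \<in> U \<and> (\<forall>k. C_k_on k g U) \<and> (\<forall>y\<in>S \<inter> U. g y = B (f y) (h y))"
    using C_k_on_bilinear[OF assms(1) \<open>open U\<close> *]
    by (intro exI[of _ U] exI[of _ "\<lambda>x. B (f1 x) (h1 x)"]) simp
qed

lemmas smooth_on_scaleR = smooth_on_bilinear[OF bounded_bilinear_scaleR]
lemmas smooth_on_mult = smooth_on_bilinear[OF bounded_bilinear_mult]
lemmas smooth_on_inner = smooth_on_bilinear[OF bounded_bilinear_inner]

lemma smooth_on_add:
  assumes "smooth_on f S" "smooth_on h S"
  shows "smooth_on (\<lambda>x. f x + h x) S"
proof (rule smooth_onI)
  fix x assume x: "x \<in> S"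
  obtain U f1 h1 where "open U" "x \<in> U" and *: "\<And>k. C_k_on k f1 U" "\<And>k. C_k_on k h1 U"
    and "\<And>y. y \<in> S \<Longrightarrow> y \<in> U \<Longrightarrow> f1 y = f y" "\<And>y. y \<in> S \<Longrightarrow> y \<in> U \<Longrightarrow> h1 y = h y"
    by (rule smooth_on_common_domain[OF assms x]) (rule that; assumption)
  then show "\<exists>U g. open U \<and> x \<in> U \<and> (\<forall>k. C_k_on k g U) \<and> (\<forall>y\<in>S \<inter> U. g y = f y + h y)"
    using C_k_on_add[OF \<open>open U\<close> *]
    by (intro exI[of _ U] exI[of _ "\<lambda>x. f1 x + h1 x"]) simp
qed

lemma smooth_on_sum:
  "finite I \<Longrightarrow> (\<And>i. i \<in> I \<Longrightarrow> smooth_on (f i) S) \<Longrightarrow> smooth_on (\<lambda>x. \<Sum>i\<in>I. f i x) S"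
  by (induction I rule: finite_induct) (simp_all add: smooth_on_const smooth_on_add)

lemma smooth_on_inverse:
  fixes f :: "'a::euclidean_space \<Rightarrow> real"
  assumes "smooth_on f S" "\<And>x. x \<in> S \<Longrightarrow> f x \<noteq> 0"
  shows "smooth_on (\<lambda>x. inverse (f x)) S"
  by (rule smooth_on_compose[OF smooth_on_open[OF _ C_k_on_inverse] assms(1)]) (use assms(2) in auto)

lemma smooth_on_Pair:
  assumes "smooth_on f S" "smooth_on g S"
  shows "smooth_on (\<lambda>x. (f x, g x)) S"
proof -
  have "bounded_linear (\<lambda>u::'b. (u, 0::'c))" "bounded_linear (\<lambda>u::'c. (0::'b, u))"
    by (intro bounded_linear_Pair bounded_linear_ident bounded_linear_zero)+
  from smooth_on_add[OF smooth_on_bounded_linear[OF this(1) assms(1)] smooth_on_bounded_linear[OF this(2) assms(2)]]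
  show ?thesis by simp
qed

lemma smooth_on_componentwise:
  fixes f :: "'a::euclidean_space \<Rightarrow> 'b::euclidean_space"
  assumes "\<And>b. b \<in> Basis \<Longrightarrow> smooth_on (\<lambda>x. f x \<bullet> b) S"
  shows "smooth_on f S"
proof -
  have "smooth_on (\<lambda>x. \<Sum>b\<in>Basis. (f x \<bullet> b) *\<^sub>R b) S"
    by (intro smooth_on_sum smooth_on_scaleR smooth_on_const assms finite_Basis)
  then show ?thesis by (simp add: euclidean_representation)
qed


section \<open>Derivatives on relatively open subsets of the half space\<close>

text \<open>Chart images and their relatively open subsets are of this kind, so interior and
  boundary charts need no separate calculus. What the calculus draws from it is uniqueness of
  derivatives within such sets.\<close>

definition half_open :: "'e::euclidean_space set \<Rightarrow> bool" where
  "half_open S \<longleftrightarrow> open S \<or> openin (top_of_set half_space) S"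

lemma half_open_openin:
  assumes "half_open S" "openin (top_of_set S) T"
  shows "half_open T"
  using assms unfolding half_open_def by (metis open_openin openin_open_trans openin_trans)

text \<open>A small positive multiple of a basis vector does not lead out of the half space, its
  inner product with the distinguished basis vector being 0 or 1. Approach along every basis
  direction is what uniqueness of the derivative within a set requires.\<close>

lemma half_open_approach:
  fixes S :: "'e::euclidean_space set"
  assumes "half_open S" "x \<in> S" "i \<in> Basis" "0 < e"
  shows "\<exists>d. 0 < \<bar>d\<bar> \<and> \<bar>d\<bar> < e \<and> x + d *\<^sub>R i \<in> S"
proof -
  obtain U where U: "open U" "x \<in> U" "S = U \<or> S = half_space \<inter> U"
    using assms(1,2) unfolding half_open_def openin_open by auto
  then obtain r where r: "r > 0" "ball x r \<subseteq> U" by (meson open_contains_ball)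
  define d where "d = min (r / 2) (e / 2)"
  have d: "0 < d" "d < e" "d < r" using r assms(4) by (auto simp: d_def)
  have "x + d *\<^sub>R i \<in> U"
    using r(2) d assms(3) by (intro subsetD[OF r(2)]) (simp add: dist_norm)
  moreover have "x + d *\<^sub>R i \<in> half_space" if "x \<in> half_space"
  proof -
    have "(SOME b. b \<in> (Basis :: 'e set)) \<in> Basis" by (meson assms(3) someI)
    then have "0 \<le> i \<bullet> (SOME b. b \<in> Basis)" using assms(3) by (simp add: inner_Basis)
    then show ?thesis using that d(1) by (simp add: half_space_def inner_add_left)
  qed
  ultimately have "x + d *\<^sub>R i \<in> S" using U(3) assms(2) by auto
  then show ?thesis using d by (intro exI[of _ d]) auto
qed

lemma half_open_derivative_unique:
  assumes "half_open S" "x \<in> S" "(f has_derivative f') (at x within S)" "(f has_derivative f'') (at x within S)"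
  shows "f' = f''"
  using frechet_derivative_unique_within[OF assms(3,4)] half_open_approach[OF assms(1,2)] by blast

lemma frechet_derivative_within_eqI:
  assumes "half_open S" "x \<in> S" "(f has_derivative f') (at x within S)"
  shows "frechet_derivative f (at x within S) = f'"
proof -
  have "(f has_derivative frechet_derivative f (at x within S)) (at x within S)"
    using differentiableI[OF assms(3)] by (simp only: frechet_derivative_works)
  then show ?thesis by (rule half_open_derivative_unique[OF assms(1,2) _ assms(3)])
qed

lemma has_derivative_within_extension:
  assumes "open U" "x \<in> U" "x \<in> S" "C_k_on (Suc k) g U" "\<And>y. y \<in> S \<Longrightarrow> y \<in> U \<Longrightarrow> g y = f y"
  shows "(f has_derivative frechet_derivative g (at x)) (at x within S)"
proof -
  have "(g has_derivative frechet_derivative g (at x)) (at x within S)"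
    using C_k_on_SucD[OF assms(4,2)] by (rule has_derivative_at_withinI)
  obtain r where r: "ball x r \<subseteq> U" "r > 0" using assms(1,2) by (meson open_contains_ball)
  from \<open>(g has_derivative _) _\<close> show ?thesis
  proof (rule has_derivative_transform_within[OF _ r(2) assms(3)])
    fix y assume "y \<in> S" "dist y x < r"
    then show "g y = f y" using r(1) assms(5) by (auto simp: dist_commute)
  qed
qed

lemma smooth_on_has_derivative:
  assumes "smooth_on f S" "x \<in> S"
  shows "(f has_derivative frechet_derivative f (at x within S)) (at x within S)"
proof -
  obtain U g where g: "open U" "x \<in> U" "\<And>k. C_k_on k g U" "\<And>y. y \<in> S \<Longrightarrow> y \<in> U \<Longrightarrow> g y = f y"
    using smooth_onE[OF assms] by blast
  have "f differentiable (at x within S)"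
    by (rule differentiableI[OF has_derivative_within_extension[OF g(1,2) assms(2) g(3,4)]])
  then show ?thesis by (simp only: frechet_derivative_works)
qed

lemma linear_frechet_derivative_within:
  assumes "smooth_on f S" "x \<in> S"
  shows "linear (frechet_derivative f (at x within S))"
  using smooth_on_has_derivative[OF assms] by (rule has_derivative_linear)

text \<open>The derivative within \<open>S\<close> is also one within \<open>T\<close>, and there it
  is unique. This reconciles derivatives whose domains are different overlaps of charts.\<close>

lemma frechet_derivative_within_subset:
  assumes "half_open T" "T \<subseteq> S" "x \<in> T" "smooth_on f S" "\<And>y. y \<in> T \<Longrightarrow> f y = g y"
  shows "frechet_derivative f (at x within S) = frechet_derivative g (at x within T)"
proof -
  have "(f has_derivative frechet_derivative f (at x within S)) (at x within T)"
    using smooth_on_has_derivative[OF assms(4)] assms(2,3) has_derivative_subset by blast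
  then have "(g has_derivative frechet_derivative f (at x within S)) (at x within T)"
    by (rule has_derivative_transform_within[where d=1]) (use assms in auto)
  then show ?thesis by (rule frechet_derivative_within_eqI[OF assms(1,3), symmetric])
qed

lemma frechet_derivative_within_compose:
  fixes g :: "'a::euclidean_space \<Rightarrow> 'b::euclidean_space"
  assumes "half_open S" "x \<in> S" "smooth_on f T" "smooth_on g S" "\<And>y. y \<in> S \<Longrightarrow> g y \<in> T"
  shows "frechet_derivative (\<lambda>y. f (g y)) (at x within S) v =
    frechet_derivative f (at (g x) within T) (frechet_derivative g (at x within S) v)"
proof -
  have "(f has_derivative frechet_derivative f (at (g x) within T)) (at (g x) within g ` S)"
    using assms(5) by (intro has_derivative_subset[OF smooth_on_has_derivative[OF assms(3) assms(5)[OF assms(2)]]]) auto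
  from diff_chain_within[OF smooth_on_has_derivative[OF assms(4,2)] this]
  have "((\<lambda>y. f (g y)) has_derivative (\<lambda>v. frechet_derivative f (at (g x) within T)
      (frechet_derivative g (at x within S) v))) (at x within S)" by (simp add: o_def)
  from frechet_derivative_within_eqI[OF assms(1,2) this] show ?thesis by simp
qed

text \<open>Near each point the derivative within \<open>S\<close> is that of a smooth extension,
  hence a sum of derivatives in fixed directions with coefficients linear in the vector. Smoothness
  jointly in point and vector serves both vector fields and the charts of the tangent
  bundle.\<close>

lemma smooth_on_frechet_derivative_Pair:
  fixes f :: "'a::euclidean_space \<Rightarrow> 'b::real_normed_vector"
  assumes "half_open S" "smooth_on f S"
  shows "smooth_on (\<lambda>(x, v). frechet_derivative f (at x within S) v) (S \<times> UNIV)"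
proof (rule smooth_onI)
  fix p assume "p \<in> S \<times> (UNIV :: 'a set)"
  then obtain x v where p: "p = (x, v)" "x \<in> S" by auto
  obtain U g where g: "open U" "x \<in> U" "\<And>k. C_k_on k g U" "\<And>y. y \<in> S \<Longrightarrow> y \<in> U \<Longrightarrow> g y = f y"
    using smooth_onE[OF assms(2) p(2)] by blast
  let ?N = "U \<times> (UNIV :: 'a set)"
  let ?h = "\<lambda>p. \<Sum>b\<in>Basis. (snd p \<bullet> b) *\<^sub>R frechet_derivative g (at (fst p)) b"
  have N: "open ?N" using g(1) by (simp add: open_Times)
  have "C_k_on k ?h ?N" for k
  proof (intro C_k_on_sum C_k_on_scaleR C_k_on_inner C_k_on_const N finite_Basis)
    show "C_k_on k snd ?N"
      using C_k_on_bounded_linear[OF bounded_linear_snd N C_k_on_id[OF N]] by simp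
    have "C_k_on k fst ?N"
      using C_k_on_bounded_linear[OF bounded_linear_fst N C_k_on_id[OF N]] by simp
    then show "C_k_on k (\<lambda>p. frechet_derivative g (at (fst p)) b) ?N" for b
      by (rule C_k_on_compose[OF N g(1) _ C_k_on_frechet_derivative[OF g(3)], rotated]) auto
  qed
  moreover have "?h q = (case q of (x, v) \<Rightarrow> frechet_derivative f (at x within S) v)"
    if "q \<in> (S \<times> UNIV) \<inter> ?N" for q
  proof -
    obtain y w where "q = (y, w)" by (cases q)
    with that have q: "q = (y, w)" "y \<in> S" "y \<in> U" by simp_all
    have "frechet_derivative f (at y within S) = frechet_derivative g (at y)"
      by (rule frechet_derivative_within_eqI[OF assms(1) q(2) has_derivative_within_extension[OF g(1) q(3,2) g(3,4)]])
    then show ?thesis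
      using linear_euclidean_sum[OF has_derivative_linear[OF C_k_on_SucD[OF g(3) q(3)]], of w] q(1) by simp
  qed
  ultimately show "\<exists>U h. open U \<and> p \<in> U \<and> (\<forall>k. C_k_on k h U) \<and>
      (\<forall>y\<in>S \<times> UNIV \<inter> U. h y = (case y of (x, v) \<Rightarrow> frechet_derivative f (at x within S) v))"
    using N p g(2) by (intro exI[of _ ?N] exI[of _ ?h]) blast
qed

lemma smooth_on_frechet_derivative:
  fixes f :: "'a::euclidean_space \<Rightarrow> 'b::real_normed_vector"
  assumes "half_open S" "smooth_on f S" "smooth_on v T" "T \<subseteq> S"
  shows "smooth_on (\<lambda>x. frechet_derivative f (at x within S) (v x)) T"
  using smooth_on_compose[OF smooth_on_frechet_derivative_Pair[OF assms(1,2)]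
      smooth_on_Pair[OF smooth_on_id assms(3)]] assms(4) by auto

section \<open>Charts\<close>

locale smooth_mfd =
  fixes M :: "('a, 'e::euclidean_space) manifold"
  assumes smooth_manifold: "smooth_manifold M"
begin

lemma Hausdorff: "Hausdorff_space (top_of M)"
  using smooth_manifold by (simp add: smooth_manifold_def)

lemma is_chart: "c \<in> atlas M \<Longrightarrow> is_chart (top_of M) c"
  using smooth_manifold by (simp add: smooth_manifold_def)

lemma openin_cdom: "c \<in> atlas M \<Longrightarrow> openin (top_of M) (cdom c)"
  using is_chart by (simp add: is_chart_def)

lemma cdom_subset: "c \<in> atlas M \<Longrightarrow> cdom c \<subseteq> points M"
  using openin_cdom openin_subset by blast

lemma cdom_Int_points [simp]: "c \<in> atlas M \<Longrightarrow> cdom c \<inter> points M = cdom c"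
  using cdom_subset by blast

lemma chart_atE:
  assumes "p \<in> points M"
  obtains c where "c \<in> atlas M" "p \<in> cdom c"
  using assms smooth_manifold unfolding smooth_manifold_def by blast

lemma charts_at_iff: "c \<in> charts_at M p \<longleftrightarrow> c \<in> atlas M \<and> p \<in> cdom c"
  by (simp add: charts_at_def)

lemma homeomorphic_coord:
  assumes "c \<in> atlas M"
  shows "homeomorphic_map (subtopology (top_of M) (cdom c)) (top_of_set (coord c ` cdom c)) (coord c)"
  using is_chart[OF assms] by (simp add: is_chart_def)

lemma topspace_cdom: "c \<in> atlas M \<Longrightarrow> topspace (subtopology (top_of M) (cdom c)) = cdom c"
  by (simp add: Int_absorb1 cdom_subset)

lemma inj_on_coord: "c \<in> atlas M \<Longrightarrow> inj_on (coord c) (cdom c)"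
  using homeomorphic_imp_injective_map[OF homeomorphic_coord] topspace_cdom by metis

lemma param_coord [simp]: "c \<in> atlas M \<Longrightarrow> p \<in> cdom c \<Longrightarrow> param c (coord c p) = p"
  using inj_on_coord by (rule the_inv_into_f_f)

lemma param_in_cdom: "c \<in> atlas M \<Longrightarrow> y \<in> coord c ` cdom c \<Longrightarrow> param c y \<in> cdom c"
  by (auto simp: the_inv_into_f_f inj_on_coord)

lemma openin_coord_image:
  assumes "c \<in> atlas M" "openin (top_of M) U"
  shows "openin (top_of_set (coord c ` cdom c)) (coord c ` (cdom c \<inter> U))"
proof -
  have "openin (subtopology (top_of M) (cdom c)) (cdom c \<inter> U)"
    using assms(2) by (simp add: openin_subtopology_Int2)
  then show ?thesis
    using homeomorphic_map_openness[OF homeomorphic_coord[OF assms(1)], of "cdom c \<inter> U"]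
      openin_subset[OF assms(2)] by (simp add: topspace_cdom[OF assms(1)] le_infI2)
qed

lemma half_open_coord_image:
  assumes "c \<in> atlas M" "openin (top_of M) U"
  shows "half_open (coord c ` (cdom c \<inter> U))"
  using half_open_openin[OF _ openin_coord_image[OF assms]] is_chart[OF assms(1)]
  by (simp add: half_open_def is_chart_def)

lemma half_open_coord_cdom: "c \<in> atlas M \<Longrightarrow> half_open (coord c ` cdom c)"
  using is_chart by (simp add: half_open_def is_chart_def)

lemma continuous_map_coord:
  "c \<in> atlas M \<Longrightarrow> continuous_map (subtopology (top_of M) (cdom c)) euclidean (coord c)"
  using homeomorphic_imp_continuous_map[OF homeomorphic_coord] by (simp add: continuous_map_in_subtopology)

lemma continuous_map_param:
  assumes "c \<in> atlas M"
  shows "continuous_map (top_of_set (coord c ` cdom c)) (top_of M) (param c)"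
  unfolding continuous_map_def
proof (intro conjI allI impI)
    show "param c \<in> topspace (top_of_set (coord c ` cdom c)) \<rightarrow> topspace (top_of M)"
      using param_in_cdom[OF assms] cdom_subset[OF assms] by auto
    fix U assume "openin (top_of M) U"
    moreover have "{y \<in> topspace (top_of_set (coord c ` cdom c)). param c y \<in> U} = coord c ` (cdom c \<inter> U)"
      using assms by (auto simp: rev_image_eqI)
    ultimately show "openin (top_of_set (coord c ` cdom c))
        {y \<in> topspace (top_of_set (coord c ` cdom c)). param c y \<in> U}"
      using openin_coord_image[OF assms] by simp
qed

lemma openin_coord_vimage:
  assumes "c \<in> atlas M" "open A"
  shows "openin (top_of M) {p \<in> cdom c. coord c p \<in> A}"
proof -
  have "openin (subtopology (top_of M) (cdom c)) {p \<in> cdom c. coord c p \<in> A}"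
    using openin_continuous_map_preimage[OF continuous_map_coord[OF assms(1)], of A] assms(2)
    unfolding topspace_cdom[OF assms(1)] by simp
  then show ?thesis using openin_cdom[OF assms(1)] openin_trans_full by blast
qed

lemma openin_chart_vimage:
  assumes c: "c \<in> atlas M" and F: "continuous_on (coord c ` cdom c) F" and A: "open A"
  shows "openin (top_of M) {p \<in> cdom c. F (coord c p) \<in> A}"
proof -
  obtain B where B: "open B" "B \<inter> coord c ` cdom c = F -` A \<inter> coord c ` cdom c"
    using F A unfolding continuous_on_open_invariant by meson
  have "{p \<in> cdom c. F (coord c p) \<in> A} = {p \<in> cdom c. coord c p \<in> B}"
    using B(2) by blast
  then show ?thesis using openin_coord_vimage[OF c B(1)] by simp
qed

lemma smooth_on_transition:
  assumes "c \<in> atlas M" "d \<in> atlas M"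
  shows "smooth_on (\<lambda>y. coord d (param c y)) (coord c ` (cdom c \<inter> cdom d))"
  using smooth_manifold assms by (simp add: smooth_manifold_def o_def)

lemma smooth_on_chart_local:
  assumes c: "c \<in> atlas M"
    and loc: "\<And>p. p \<in> cdom c \<Longrightarrow> p \<in> U \<Longrightarrow>
      \<exists>N. openin (top_of M) N \<and> p \<in> N \<and> smooth_on F (coord c ` (cdom c \<inter> (U \<inter> N)))"
  shows "smooth_on F (coord c ` (cdom c \<inter> U))"
proof (rule smooth_on_local)
  fix y assume "y \<in> coord c ` (cdom c \<inter> U)"
  then obtain p where p: "p \<in> cdom c" "p \<in> U" "y = coord c p" by blast
  then obtain N where N: "openin (top_of M) N" "p \<in> N" "smooth_on F (coord c ` (cdom c \<inter> (U \<inter> N)))"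
    using loc by meson
  obtain A where A: "open A" "coord c ` (cdom c \<inter> N) = coord c ` cdom c \<inter> A"
    using openin_coord_image[OF c N(1)] by (auto simp: openin_open)
  have "coord c ` (cdom c \<inter> U) \<inter> A \<subseteq> coord c ` (cdom c \<inter> (U \<inter> N))"
  proof
    fix z assume "z \<in> coord c ` (cdom c \<inter> U) \<inter> A"
    then obtain q where q: "q \<in> cdom c" "q \<in> U" "z = coord c q" "z \<in> A" by blast
    then have "z \<in> coord c ` (cdom c \<inter> N)" using A(2) by blast
    then obtain q' where q': "q' \<in> cdom c" "q' \<in> N" "z = coord c q'" by blast
    then have "q' = q" using q inj_on_coord[OF c] by (metis inj_onD)
    then show "z \<in> coord c ` (cdom c \<inter> (U \<inter> N))" using q q' by blast
  qed
  then have "smooth_on F (coord c ` (cdom c \<inter> U) \<inter> A)"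
    using smooth_on_subset[OF N(3)] by blast
  moreover have "y \<in> A" using A(2) p N(2) by blast
  ultimately show "\<exists>A. open A \<and> y \<in> A \<and> smooth_on F (coord c ` (cdom c \<inter> U) \<inter> A)"
    using A(1) by blast
qed


section \<open>Tangent spaces\<close>

lemma coord_change_eq:
  assumes "c \<in> charts_at M p" "d \<in> charts_at M p" "openin (top_of M) N" "p \<in> N" "N \<subseteq> cdom d"
  shows "coord_change c d p =
    frechet_derivative (\<lambda>y. coord d (param c y)) (at (coord c p) within coord c ` (cdom c \<inter> N))"
proof -
  have "frechet_derivative (\<lambda>y. coord d (param c y)) (at (coord c p) within coord c ` (cdom c \<inter> cdom d))
      = frechet_derivative (\<lambda>y. coord d (param c y)) (at (coord c p) within coord c ` (cdom c \<inter> N))"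
    using assms by (intro frechet_derivative_within_subset half_open_coord_image smooth_on_transition)
      (auto simp: charts_at_iff)
  then show ?thesis by (simp add: coord_change_def o_def)
qed

lemma linear_coord_change:
  assumes "c \<in> charts_at M p" "d \<in> charts_at M p"
  shows "linear (coord_change c d p)"
  unfolding coord_change_def o_def
  using assms by (intro linear_frechet_derivative_within smooth_on_transition) (auto simp: charts_at_iff)

text \<open>The chain rule for transition maps on the triple overlap; \<open>coord_change_eq\<close>
  accounts for the three derivatives being defined within different overlaps.\<close>

lemma coord_change_cocycle:
  assumes "c \<in> charts_at M p" "d \<in> charts_at M p" "e \<in> charts_at M p"
  shows "coord_change d e p (coord_change c d p u) = coord_change c e p u"
proof -
  have at: "c \<in> atlas M" "d \<in> atlas M" "e \<in> atlas M" "p \<in> cdom c" "p \<in> cdom d" "p \<in> cdom e"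
    using assms by (auto simp: charts_at_iff)
  let ?N = "cdom d \<inter> cdom e"
  let ?S = "coord c ` (cdom c \<inter> ?N)"
  have N: "openin (top_of M) ?N" using at openin_cdom by blast
  have ho: "half_open ?S" using half_open_coord_image[OF at(1) N] .
  have pS: "coord c p \<in> ?S" using at by blast
  have eq: "coord e (param c y) = coord e (param d (coord d (param c y)))" if "y \<in> ?S" for y
    using that at by auto
  have "frechet_derivative (\<lambda>y. coord e (param d (coord d (param c y)))) (at (coord c p) within ?S) u =
    frechet_derivative (\<lambda>y. coord e (param d y)) (at (coord d (param c (coord c p))) within coord d ` (cdom d \<inter> cdom e))
      (frechet_derivative (\<lambda>y. coord d (param c y)) (at (coord c p) within ?S) u)"
  proof (rule frechet_derivative_within_compose[OF ho pS smooth_on_transition[OF at(2,3)]])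
    show "smooth_on (\<lambda>y. coord d (param c y)) ?S" by (rule smooth_on_subset[OF smooth_on_transition[OF at(1,2)]]) blast
    show "coord d (param c y) \<in> coord d ` (cdom d \<inter> cdom e)" if "y \<in> ?S" for y
      using that at(1) by auto
  qed
  also have "\<dots> = coord_change d e p (coord_change c d p u)"
    using at coord_change_eq[OF assms(1,2) N] by (simp add: coord_change_def[of d e] o_def)
  also have "frechet_derivative (\<lambda>y. coord e (param d (coord d (param c y)))) (at (coord c p) within ?S) =
      frechet_derivative (\<lambda>y. coord e (param c y)) (at (coord c p) within ?S)"
    by (rule frechet_derivative_within_subset[OF ho subset_refl pS _ eq, symmetric])
      (rule smooth_on_subset[OF smooth_on_transition[OF at(1,3)]], blast)
  also have "\<dots> = coord_change c e p"
    using at coord_change_eq[OF assms(1,3) N] by simp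
  finally show ?thesis by simp
qed

lemma coord_change_self:
  assumes "c \<in> charts_at M p"
  shows "coord_change c c p u = u"
proof -
  have at: "c \<in> atlas M" "p \<in> cdom c" using assms by (auto simp: charts_at_iff)
  have "((\<lambda>y. coord c (param c y)) has_derivative (\<lambda>v. v)) (at (coord c p) within coord c ` (cdom c \<inter> cdom c))"
    by (rule has_derivative_transform[OF _ _ has_derivative_ident]) (use at in auto)
  from frechet_derivative_within_eqI[OF half_open_coord_image[OF at(1) openin_cdom[OF at(1)]] _ this]
  show ?thesis using at by (simp add: coord_change_def o_def)
qed

lemma tvec_of_coord_self: "c \<in> charts_at M p \<Longrightarrow> tvec_of_coord M p c u c = u"
  by (simp add: tvec_of_coord_def coord_change_self)

lemma tvec_of_coord_in_tangent_space:
  "c \<in> charts_at M p \<Longrightarrow> tvec_of_coord M p c u \<in> tangent_space M p"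
  by (auto simp: tangent_space_def tvec_of_coord_def coord_change_cocycle)

lemma tangent_space_change:
  "v \<in> tangent_space M p \<Longrightarrow> c \<in> charts_at M p \<Longrightarrow> d \<in> charts_at M p \<Longrightarrow> v d = coord_change c d p (v c)"
  unfolding tangent_space_def by blast

lemma tangent_space_outside: "v \<in> tangent_space M p \<Longrightarrow> c \<notin> charts_at M p \<Longrightarrow> v c = 0"
  unfolding tangent_space_def by blast

lemma tangent_space_eqI:
  assumes "v \<in> tangent_space M p" "w \<in> tangent_space M p" "c \<in> charts_at M p" "v c = w c"
  shows "v = w"
proof
  fix d show "v d = w d"
    using assms tangent_space_change[of _ p c d] tangent_space_outside[of _ p d] by metis
qed

lemma tvec_of_coord_eq:
  "v \<in> tangent_space M p \<Longrightarrow> c \<in> charts_at M p \<Longrightarrow> tvec_of_coord M p c (v c) = v"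
  by (rule tangent_space_eqI[OF tvec_of_coord_in_tangent_space]) (auto simp: tvec_of_coord_self)

lemma zero_in_tangent_space: "zero_tvec \<in> tangent_space M p"
  by (auto simp: tangent_space_def zero_tvec_def linear_0[OF linear_coord_change])

lemma tangent_space_eq_zero_iff:
  "v \<in> tangent_space M p \<Longrightarrow> c \<in> charts_at M p \<Longrightarrow> v = zero_tvec \<longleftrightarrow> v c = 0"
  using tangent_space_eqI[OF _ zero_in_tangent_space, of v p c] by (auto simp: zero_tvec_def)

lemma tangent_spaceI:
  assumes "\<And>c. c \<notin> charts_at M p \<Longrightarrow> v c = 0"
    and "\<And>c d. c \<in> charts_at M p \<Longrightarrow> d \<in> charts_at M p \<Longrightarrow> v d = coord_change c d p (v c)"
  shows "v \<in> tangent_space M p"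
  unfolding tangent_space_def using assms by blast

lemma tangent_space_add:
  assumes "v \<in> tangent_space M p" "w \<in> tangent_space M p"
  shows "(\<lambda>c. v c + w c) \<in> tangent_space M p"
proof (rule tangent_spaceI)
  show "v c + w c = 0" if "c \<notin> charts_at M p" for c
    using assms[THEN tangent_space_outside, OF that] by simp
  show "v d + w d = coord_change c d p (v c + w c)" if "c \<in> charts_at M p" "d \<in> charts_at M p" for c d
    unfolding linear_add[OF linear_coord_change[OF that]] assms[THEN tangent_space_change, OF that] ..
qed

lemma tangent_space_scaleR:
  assumes "v \<in> tangent_space M p"
  shows "(\<lambda>c. r *\<^sub>R v c) \<in> tangent_space M p"
proof (rule tangent_spaceI)
  show "r *\<^sub>R v c = 0" if "c \<notin> charts_at M p" for c
    using tangent_space_outside[OF assms that] by simp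
  show "r *\<^sub>R v d = coord_change c d p (r *\<^sub>R v c)" if "c \<in> charts_at M p" "d \<in> charts_at M p" for c d
    unfolding linear_scale[OF linear_coord_change[OF that]] tangent_space_change[OF assms that] ..
qed

lemma smooth_on_coord_change:
  assumes "c \<in> atlas M" "d \<in> atlas M" "smooth_on F (coord c ` (cdom c \<inter> U))" "U \<subseteq> cdom d"
  shows "smooth_on (\<lambda>y. coord_change c d (param c y) (F y)) (coord c ` (cdom c \<inter> U))"
proof -
  have "smooth_on (\<lambda>y. frechet_derivative (\<lambda>y. coord d (param c y)) (at y within coord c ` (cdom c \<inter> cdom d)) (F y))
      (coord c ` (cdom c \<inter> U))"
    using assms by (intro smooth_on_frechet_derivative half_open_coord_image smooth_on_transition openin_cdom) auto
  then show ?thesis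
    by (rule smooth_on_cong) (use assms in \<open>auto simp: coord_change_def o_def\<close>)
qed


section \<open>Smooth functions and vector fields\<close>

definition smooth_fun_on :: "'a set \<Rightarrow> ('a \<Rightarrow> 'h::real_normed_vector) \<Rightarrow> bool" where
  "smooth_fun_on U g \<longleftrightarrow> (\<forall>c\<in>atlas M. smooth_on (\<lambda>y. g (param c y)) (coord c ` (cdom c \<inter> U)))"

definition vector_field_on :: "'a set \<Rightarrow> ('a, 'e) vfield \<Rightarrow> bool" where
  "vector_field_on U x \<longleftrightarrow> (\<forall>p\<in>U. x p \<in> tangent_space M p) \<and>
    (\<forall>c\<in>atlas M. smooth_on (vfield_rep x c) (coord c ` (cdom c \<inter> U)))"

lemma smooth_fun_onD:
  "smooth_fun_on U g \<Longrightarrow> c \<in> atlas M \<Longrightarrow> smooth_on (\<lambda>y. g (param c y)) (coord c ` (cdom c \<inter> U))"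
  by (simp add: smooth_fun_on_def)

lemma smooth_on_change_chart:
  assumes c: "c \<in> atlas M" and d: "d \<in> atlas M"
    and F: "smooth_on F (coord c ` (cdom c \<inter> U))"
  shows "smooth_on (\<lambda>y. F (coord c (param d y))) (coord d ` (cdom d \<inter> (cdom c \<inter> U)))"
  by (rule smooth_on_compose[OF F smooth_on_subset[OF smooth_on_transition[OF d c]]])
    (use d in auto)

lemma smooth_fun_onI_local:
  assumes "\<And>p. p \<in> U \<Longrightarrow> \<exists>N c. openin (top_of M) N \<and> p \<in> N \<and> c \<in> charts_at M p \<and>
      smooth_on (\<lambda>y. g (param c y)) (coord c ` (cdom c \<inter> (U \<inter> N)))"
  shows "smooth_fun_on U g"
  unfolding smooth_fun_on_def
proof
  fix d assume d: "d \<in> atlas M"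
  show "smooth_on (\<lambda>y. g (param d y)) (coord d ` (cdom d \<inter> U))"
  proof (rule smooth_on_chart_local[OF d])
    fix p assume p: "p \<in> cdom d" "p \<in> U"
    obtain N c where N: "openin (top_of M) N" "p \<in> N" "c \<in> atlas M" "p \<in> cdom c"
      and sm: "smooth_on (\<lambda>y. g (param c y)) (coord c ` (cdom c \<inter> (U \<inter> N)))"
      using assms[OF p(2)] unfolding charts_at_iff by blast
    have "smooth_on (\<lambda>y. g (param c (coord c (param d y)))) (coord d ` (cdom d \<inter> (cdom c \<inter> (U \<inter> N))))"
      using smooth_on_change_chart[OF N(3) d sm] .
    then have "smooth_on (\<lambda>y. g (param d y)) (coord d ` (cdom d \<inter> (U \<inter> (cdom c \<inter> N))))"
      by (rule smooth_on_cong[OF smooth_on_subset]) (use d N in auto)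
    then show "\<exists>N. openin (top_of M) N \<and> p \<in> N \<and> smooth_on (\<lambda>y. g (param d y)) (coord d ` (cdom d \<inter> (U \<inter> N)))"
      using N openin_cdom[OF N(3)] by (intro exI[of _ "cdom c \<inter> N"]) auto
  qed
qed

text \<open>Components in another chart arise through \<open>coord_change\<close>, which is smooth
  in the point and linear in the vector; hence one chart near each point decides for the whole
  atlas.\<close>

lemma vector_field_onI_local:
  assumes T: "\<And>p. p \<in> U \<Longrightarrow> x p \<in> tangent_space M p"
    and loc: "\<And>p. p \<in> U \<Longrightarrow> \<exists>N c. openin (top_of M) N \<and> p \<in> N \<and> c \<in> charts_at M p \<and>
      smooth_on (vfield_rep x c) (coord c ` (cdom c \<inter> (U \<inter> N)))"
  shows "vector_field_on U x"
  unfolding vector_field_on_def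
proof (intro conjI ballI T)
  fix d assume d: "d \<in> atlas M"
  show "smooth_on (vfield_rep x d) (coord d ` (cdom d \<inter> U))"
  proof (rule smooth_on_chart_local[OF d])
    fix p assume p: "p \<in> cdom d" "p \<in> U"
    obtain N c where N: "openin (top_of M) N" "p \<in> N" "c \<in> atlas M" "p \<in> cdom c"
      and sm: "smooth_on (vfield_rep x c) (coord c ` (cdom c \<inter> (U \<inter> N)))"
      using loc[OF p(2)] unfolding charts_at_iff by blast
    have "smooth_on (vfield_rep x c) (coord c ` (cdom c \<inter> (U \<inter> N \<inter> cdom d)))"
      by (rule smooth_on_subset[OF sm]) blast
    from smooth_on_change_chart[OF N(3) d smooth_on_coord_change[OF N(3) d this]]
    have "smooth_on (\<lambda>y. coord_change c d (param c (coord c (param d y))) (vfield_rep x c (coord c (param d y))))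
        (coord d ` (cdom d \<inter> (cdom c \<inter> (U \<inter> N \<inter> cdom d))))" by blast
    then have "smooth_on (vfield_rep x d) (coord d ` (cdom d \<inter> (U \<inter> (cdom c \<inter> N))))"
    proof (rule smooth_on_cong[OF smooth_on_subset])
      fix y assume "y \<in> coord d ` (cdom d \<inter> (U \<inter> (cdom c \<inter> N)))"
      then obtain q where q: "q \<in> cdom d" "q \<in> U" "q \<in> cdom c" "y = coord d q" by blast
      then show "coord_change c d (param c (coord c (param d y))) (vfield_rep x c (coord c (param d y))) = vfield_rep x d y"
        using tangent_space_change[OF T, of q c d] N(3) d by (simp add: vfield_rep_def charts_at_iff)
    qed blast
    then show "\<exists>N. openin (top_of M) N \<and> p \<in> N \<and> smooth_on (vfield_rep x d) (coord d ` (cdom d \<inter> (U \<inter> N)))"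
      using N openin_cdom[OF N(3)] by (intro exI[of _ "cdom c \<inter> N"]) auto
  qed
qed

lemma vector_fields_iff:
  "x \<in> vector_fields M \<longleftrightarrow> vector_field_on (points M) x \<and> (\<forall>p. p \<notin> points M \<longrightarrow> x p = zero_tvec)"
  by (auto simp: vector_fields_def vector_field_on_def)

lemma vector_fieldsD:
  assumes "x \<in> vector_fields M"
  shows "p \<in> points M \<Longrightarrow> x p \<in> tangent_space M p"
    and "c \<in> atlas M \<Longrightarrow> smooth_on (vfield_rep x c) (coord c ` cdom c)"
    and "p \<notin> points M \<Longrightarrow> x p = zero_tvec"
  using assms by (auto simp: vector_fields_def)

lemma compact_vector_fieldsD: "x \<in> compact_vector_fields M \<Longrightarrow> x \<in> vector_fields M"
  by (simp add: compact_vector_fields_def)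

lemma smooth_fun_on_subset: "smooth_fun_on U g \<Longrightarrow> T \<subseteq> U \<Longrightarrow> smooth_fun_on T g"
  unfolding smooth_fun_on_def by (meson Int_mono image_mono order_refl smooth_on_subset)

lemma smooth_fun_on_const: "smooth_fun_on U (\<lambda>p. c)"
  by (simp add: smooth_fun_on_def smooth_on_const)

lemma smooth_fun_on_add:
  "smooth_fun_on U g \<Longrightarrow> smooth_fun_on U h \<Longrightarrow> smooth_fun_on U (\<lambda>p. g p + h p)"
  by (simp add: smooth_fun_on_def smooth_on_add)

lemma smooth_fun_on_scaleR:
  "smooth_fun_on U g \<Longrightarrow> smooth_fun_on U h \<Longrightarrow> smooth_fun_on U (\<lambda>p. g p *\<^sub>R h p)"
  by (simp add: smooth_fun_on_def smooth_on_scaleR)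

lemma smooth_fun_on_mult:
  fixes g h :: "'a \<Rightarrow> real"
  shows "smooth_fun_on U g \<Longrightarrow> smooth_fun_on U h \<Longrightarrow> smooth_fun_on U (\<lambda>p. g p * h p)"
  by (simp add: smooth_fun_on_def smooth_on_mult)

lemma vector_field_on_add:
  "vector_field_on U x \<Longrightarrow> vector_field_on U y \<Longrightarrow> vector_field_on U (\<lambda>p c. x p c + y p c)"
  by (simp add: vector_field_on_def vfield_rep_def smooth_on_add tangent_space_add)

lemma vector_field_on_scaleR:
  "smooth_fun_on U g \<Longrightarrow> vector_field_on U x \<Longrightarrow> vector_field_on U (\<lambda>p c. g p *\<^sub>R x p c)"
  by (simp add: vector_field_on_def vfield_rep_def smooth_fun_on_def smooth_on_scaleR tangent_space_scaleR)

lemma smooth_fun_imp_openin: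
  assumes "smooth_fun_on (points M) g" "open A"
  shows "openin (top_of M) {p \<in> points M. g p \<in> A}"
proof (subst openin_subopen, intro ballI)
  fix p assume p: "p \<in> {p \<in> points M. g p \<in> A}"
  then obtain c where c: "c \<in> atlas M" "p \<in> cdom c" using chart_atE by blast
  have "continuous_on (coord c ` cdom c) (\<lambda>y. g (param c y))"
    using smooth_on_imp_continuous_on[OF smooth_fun_onD[OF assms(1) c(1)]] c by simp
  then have "openin (top_of M) {q \<in> cdom c. g (param c (coord c q)) \<in> A}"
    by (rule openin_chart_vimage[OF c(1) _ assms(2)])
  moreover have "p \<in> {q \<in> cdom c. g (param c (coord c q)) \<in> A}" using p c by simp
  moreover have "{q \<in> cdom c. g (param c (coord c q)) \<in> A} \<subseteq> {p \<in> points M. g p \<in> A}"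
    using c(1) cdom_subset[OF c(1)] by auto
  ultimately show "\<exists>T. openin (top_of M) T \<and> p \<in> T \<and> T \<subseteq> {p \<in> points M. g p \<in> A}"
    by blast
qed

text \<open>The open sets \<open>U\<close> and \<open>points M - K\<close> cover the manifold, and
  on their overlap the product is already 0. Closedness of \<open>K\<close> in the whole manifold
  keeps the behaviour of \<open>h\<close> near the edge of \<open>U\<close> harmless.\<close>

lemma smooth_fun_extend_by_zero:
  fixes g :: "'a \<Rightarrow> real"
  assumes g: "smooth_fun_on (points M) g" and U: "openin (top_of M) U" and K: "closedin (top_of M) K" "K \<subseteq> U"
    and zero: "\<And>p. p \<in> points M \<Longrightarrow> p \<notin> K \<Longrightarrow> g p = 0" and h: "smooth_fun_on U h"
  shows "smooth_fun_on (points M) (\<lambda>p. if p \<in> U then g p *\<^sub>R h p else 0)"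
proof (rule smooth_fun_onI_local)
  fix p assume p: "p \<in> points M"
  obtain c where c: "c \<in> atlas M" "p \<in> cdom c" using chart_atE[OF p] .
  let ?F = "\<lambda>p. if p \<in> U then g p *\<^sub>R h p else 0"
  have "\<exists>N. openin (top_of M) N \<and> p \<in> N \<and> smooth_on (\<lambda>y. ?F (param c y)) (coord c ` (cdom c \<inter> (points M \<inter> N)))"
  proof (cases "p \<in> U")
    case True
    have "smooth_on (\<lambda>y. g (param c y) *\<^sub>R h (param c y)) (coord c ` (cdom c \<inter> U))"
      using smooth_fun_onD[OF smooth_fun_on_scaleR[OF smooth_fun_on_subset[OF g openin_subset[OF U]] h] c(1)] .
    then have "smooth_on (\<lambda>y. ?F (param c y)) (coord c ` (cdom c \<inter> (points M \<inter> U)))"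
      by (rule smooth_on_cong[OF smooth_on_subset]) (use c in auto)
    then show ?thesis using True U by blast
  next
    case False
    have "smooth_on (\<lambda>y. ?F (param c y)) (coord c ` (cdom c \<inter> (points M \<inter> (points M - K))))"
      by (rule smooth_on_cong[OF smooth_on_const[of 0]]) (use c zero in auto)
    moreover have "openin (top_of M) (points M - K)" using K(1) by blast
    ultimately show ?thesis using False p K(2) by blast
  qed
  then show "\<exists>N c. openin (top_of M) N \<and> p \<in> N \<and> c \<in> charts_at M p \<and>
      smooth_on (\<lambda>y. ?F (param c y)) (coord c ` (cdom c \<inter> (points M \<inter> N)))"
    using c unfolding charts_at_iff by blast
qed

lemma vector_field_extend_by_zero:
  fixes g :: "'a \<Rightarrow> real"
  assumes g: "smooth_fun_on (points M) g" and U: "openin (top_of M) U" and K: "closedin (top_of M) K" "K \<subseteq> U"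
    and zero: "\<And>p. p \<in> points M \<Longrightarrow> p \<notin> K \<Longrightarrow> g p = 0" and x: "vector_field_on U x"
  shows "(\<lambda>p c. if p \<in> U then g p *\<^sub>R x p c else 0) \<in> vector_fields M"
  unfolding vector_fields_iff
proof (intro conjI allI impI vector_field_onI_local)
  let ?F = "\<lambda>p c. if p \<in> U then g p *\<^sub>R x p c else 0"
  show "?F p = zero_tvec" if "p \<notin> points M" for p
  proof -
    have "p \<notin> U" using that openin_subset[OF U] by blast
    then show ?thesis by (simp add: zero_tvec_def)
  qed
  fix p assume p: "p \<in> points M"
  show "?F p \<in> tangent_space M p"
    using x zero_in_tangent_space[of p]
    by (cases "p \<in> U") (simp_all add: vector_field_on_def tangent_space_scaleR zero_tvec_def)
  obtain c where c: "c \<in> atlas M" "p \<in> cdom c" using chart_atE[OF p] .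
  have "\<exists>N. openin (top_of M) N \<and> p \<in> N \<and> smooth_on (vfield_rep ?F c) (coord c ` (cdom c \<inter> (points M \<inter> N)))"
  proof (cases "p \<in> U")
    case True
    have "vector_field_on U (\<lambda>p c. g p *\<^sub>R x p c)"
      using vector_field_on_scaleR[OF smooth_fun_on_subset[OF g openin_subset[OF U]] x] .
    then have "smooth_on (vfield_rep (\<lambda>p c. g p *\<^sub>R x p c) c) (coord c ` (cdom c \<inter> U))"
      using c(1) by (simp add: vector_field_on_def)
    then have "smooth_on (vfield_rep ?F c) (coord c ` (cdom c \<inter> (points M \<inter> U)))"
      by (rule smooth_on_cong[OF smooth_on_subset]) (use c in \<open>auto simp: vfield_rep_def\<close>)
    then show ?thesis using True U by blast
  next
    case False
    have "smooth_on (vfield_rep ?F c) (coord c ` (cdom c \<inter> (points M \<inter> (points M - K))))"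
      by (rule smooth_on_cong[OF smooth_on_const[of 0]]) (use c zero in \<open>auto simp: vfield_rep_def\<close>)
    moreover have "openin (top_of M) (points M - K)" using K(1) by blast
    ultimately show ?thesis using False p K(2) by blast
  qed
  then show "\<exists>N c. openin (top_of M) N \<and> p \<in> N \<and> c \<in> charts_at M p \<and>
      smooth_on (vfield_rep ?F c) (coord c ` (cdom c \<inter> (points M \<inter> N)))"
    using c unfolding charts_at_iff by blast
qed

section \<open>Supports and compactly supported vector fields\<close>

lemma supp_subset:
  assumes "closedin (top_of M) K" "\<And>p. p \<in> points M \<Longrightarrow> p \<notin> K \<Longrightarrow> x p = zero_tvec"
  shows "supp M x \<subseteq> K"
  unfolding supp_def using assms by (intro closure_of_minimal) auto

lemma zero_outside_supp: "p \<in> points M \<Longrightarrow> p \<notin> supp M x \<Longrightarrow> x p = zero_tvec"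
  unfolding supp_def by (metis (mono_tags, lifting) closure_of_subset_Int in_mono IntI mem_Collect_eq)

text \<open>The Hausdorff property makes the compact set \<open>K\<close> closed, so it contains the
  closure that defines the support.\<close>

lemma compact_vector_fieldsI:
  assumes "x \<in> vector_fields M" "compactin (top_of M) K" "\<And>p. p \<in> points M \<Longrightarrow> p \<notin> K \<Longrightarrow> x p = zero_tvec"
  shows "x \<in> compact_vector_fields M"
proof -
  have "closedin (top_of M) K" using compactin_imp_closedin[OF Hausdorff assms(2)] .
  then have "supp M x \<subseteq> K" using supp_subset assms(3) by blast
  then have "compactin (top_of M) (supp M x)"
    using closed_compactin[OF assms(2)] by (simp add: supp_def)
  then show ?thesis using assms(1) by (simp add: compact_vector_fields_def)
qed

lemma compact_vector_fields_add:
  assumes "x \<in> compact_vector_fields M" "y \<in> compact_vector_fields M"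
  shows "(\<lambda>p c. x p c + y p c) \<in> compact_vector_fields M"
proof (rule compact_vector_fieldsI)
  show "(\<lambda>p c. x p c + y p c) \<in> vector_fields M"
    using assms[THEN compact_vector_fieldsD] by (auto simp: vector_fields_iff vector_field_on_add zero_tvec_def)
  show "compactin (top_of M) (supp M x \<union> supp M y)"
    using assms by (simp add: compact_vector_fields_def compactin_Un)
  show "(\<lambda>c. x p c + y p c) = zero_tvec" if "p \<in> points M" "p \<notin> supp M x \<union> supp M y" for p
    using that zero_outside_supp by (simp add: zero_tvec_def)
qed

lemma compact_vector_fields_scaleR:
  assumes "x \<in> compact_vector_fields M" "smooth_fun_on (points M) g"
  shows "(\<lambda>p c. g p *\<^sub>R x p c) \<in> compact_vector_fields M"
proof (rule compact_vector_fieldsI)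
  show "(\<lambda>p c. g p *\<^sub>R x p c) \<in> vector_fields M"
    using compact_vector_fieldsD[OF assms(1)] assms(2)
    by (auto simp: vector_fields_iff vector_field_on_scaleR zero_tvec_def)
  show "compactin (top_of M) (supp M x)"
    using assms by (simp add: compact_vector_fields_def)
  show "(\<lambda>c. g p *\<^sub>R x p c) = zero_tvec" if "p \<in> points M" "p \<notin> supp M x" for p
    using that zero_outside_supp by (simp add: zero_tvec_def)
qed

end

context smooth_mfd
begin

section \<open>Bump functions\<close>

text \<open>A smooth step of the squared coordinate distance, extended by 0 outside the chart. The
  extension is smooth because its carrier \<open>K\<close> is compact, hence closed in the whole
  Hausdorff manifold and not merely in the chart domain.\<close>

lemma bump_function:
  assumes U: "openin (top_of M) U" "p0 \<in> U"
  obtains \<beta> :: "'a \<Rightarrow> real" and K N where "smooth_fun_on (points M) \<beta>" "compactin (top_of M) K" "K \<subseteq> U"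
    "openin (top_of M) N" "p0 \<in> N" "N \<subseteq> K" "\<And>p. p \<in> N \<Longrightarrow> \<beta> p = 1" "\<And>p. p \<notin> K \<Longrightarrow> \<beta> p = 0"
proof -
  have "p0 \<in> points M" using U openin_subset by blast
  then obtain c where c: "c \<in> atlas M" "p0 \<in> cdom c" using chart_atE by blast
  define y0 where "y0 = coord c p0"
  \<comment> \<open>\<open>H\<close> is the whole space or the closed half space. Being closed, it
    meets a closed ball in a compact set; as the chart image is relatively open in it, a small such
    set stays inside the image, which near a boundary point a ball would not.\<close>
  obtain H where H: "closed H" "coord c ` cdom c \<subseteq> H" "openin (top_of_set H) (coord c ` cdom c)"
  proof (cases "open (coord c ` cdom c)")
    case True
    then show thesis using that[of UNIV] by simp
  next
    case False
    then have *: "openin (top_of_set half_space) (coord c ` cdom c)"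
      using is_chart[OF c(1)] by (simp add: is_chart_def)
    have "half_space = {x :: 'e. (SOME b. b \<in> Basis) \<bullet> x \<ge> 0}"
      by (auto simp: half_space_def inner_commute)
    then have "closed (half_space :: 'e set)" using closed_halfspace_ge by metis
    then show thesis using that[of half_space] * openin_imp_subset by blast
  qed
  obtain A where A: "open A" "coord c ` (cdom c \<inter> U) = H \<inter> A"
    using openin_trans[OF openin_coord_image[OF c(1) U(1)] H(3)] by (auto simp: openin_open)
  have "y0 \<in> A" using A(2) U(2) c(2) by (auto simp: y0_def)
  then obtain r0 where r0: "r0 > 0" "cball y0 r0 \<subseteq> A" using A(1) by (meson open_contains_cball)
  define r where "r = r0 / 2"
  have r: "r > 0" "cball y0 (2 * r) \<subseteq> A" using r0 by (auto simp: r_def)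
  define K' where "K' = H \<inter> cball y0 (2 * r)"
  define K where "K = param c ` K'"
  define s where "s = (\<lambda>y. smooth_step (((y - y0) \<bullet> (y - y0)) * inverse (r\<^sup>2)))"
  define \<beta> where "\<beta> = (\<lambda>p. if p \<in> cdom c then s (coord c p) else 0)"
  define N where "N = {p \<in> cdom c. coord c p \<in> ball y0 r} \<inter> U"
  have K'sub: "K' \<subseteq> coord c ` (cdom c \<inter> U)" using A(2) r(2) by (auto simp: K'_def)
  have "compact K'" unfolding K'_def using H(1) by (simp add: closed_Int_compact)
  then have "compactin (top_of_set (coord c ` cdom c)) K'"
    using K'sub by (auto simp: compactin_subtopology)
  then have K: "compactin (top_of M) K"
    unfolding K_def using continuous_map_param[OF c(1)] by (rule image_compactin)
  have KU: "K \<subseteq> U"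
  proof
    fix p assume "p \<in> K"
    then obtain y where "y \<in> K'" "p = param c y" by (auto simp: K_def)
    with K'sub obtain q where "q \<in> cdom c" "q \<in> U" "p = param c (coord c q)" by blast
    then show "p \<in> U" using c(1) by simp
  qed
  have inK: "p \<in> K" if "p \<in> cdom c" "dist y0 (coord c p) \<le> 2 * r" for p
  proof -
    have "coord c p \<in> K'" using that H(2) by (auto simp: K'_def)
    then show ?thesis unfolding K_def using that(1) c(1) by (metis imageI param_coord)
  qed
  have s0: "s y = 0" if "dist y0 y > 2 * r" for y
  proof -
    have "(2 * r)\<^sup>2 \<le> (norm (y - y0))\<^sup>2"
      using that r(1) by (intro power_mono) (auto simp: dist_norm norm_minus_commute)
    then have "4 * r\<^sup>2 \<le> (y - y0) \<bullet> (y - y0)"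
      by (simp add: power2_norm_eq_inner power_mult_distrib)
    then have "2 * r\<^sup>2 \<le> (y - y0) \<bullet> (y - y0)"
      using zero_le_power2[of r] by linarith
    then have "2 \<le> ((y - y0) \<bullet> (y - y0)) * inverse (r\<^sup>2)"
      using r(1) by (simp add: field_simps)
    then show ?thesis by (simp add: s_def smooth_step_eq_0)
  qed
  have s1: "s y = 1" if "dist y0 y < r" for y
  proof -
    have "(norm (y - y0))\<^sup>2 \<le> r\<^sup>2"
      using that r(1) by (intro power_mono) (auto simp: dist_norm norm_minus_commute)
    then have "((y - y0) \<bullet> (y - y0)) * inverse (r\<^sup>2) \<le> 1"
      using r(1) by (simp add: power2_norm_eq_inner field_simps)
    then show ?thesis by (simp add: s_def smooth_step_eq_1)
  qed
  have \<beta>0: "\<beta> p = 0" if "p \<notin> K" for p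
    using inK[of p] s0[of "coord c p"] that by (force simp: \<beta>_def)
  have diff: "smooth_on (\<lambda>y. y - y0) S" for S
    using smooth_on_add[OF smooth_on_id smooth_on_const[of "- y0"], of S] by simp
  have sm: "smooth_on s S" for S
    unfolding s_def
    by (rule smooth_on_compose[OF smooth_on_open[OF open_UNIV C_k_on_smooth_step]
          smooth_on_mult[OF smooth_on_inner[OF diff diff] smooth_on_const]]) simp
  have "smooth_fun_on (points M) \<beta>"
  proof (rule smooth_fun_onI_local)
    fix p assume p: "p \<in> points M"
    show "\<exists>N c. openin (top_of M) N \<and> p \<in> N \<and> c \<in> charts_at M p \<and>
        smooth_on (\<lambda>y. \<beta> (param c y)) (coord c ` (cdom c \<inter> (points M \<inter> N)))"
    proof (cases "p \<in> cdom c")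
      case True
      have "smooth_on (\<lambda>y. \<beta> (param c y)) (coord c ` (cdom c \<inter> (points M \<inter> cdom c)))"
        by (rule smooth_on_cong[OF sm]) (use c(1) in \<open>auto simp: \<beta>_def\<close>)
      then show ?thesis using True c(1) openin_cdom[OF c(1)] unfolding charts_at_iff by blast
    next
      case False
      obtain d where d: "d \<in> atlas M" "p \<in> cdom d" using chart_atE[OF p] .
      have "smooth_on (\<lambda>y. \<beta> (param d y)) (coord d ` (cdom d \<inter> (points M \<inter> (points M - K))))"
        by (rule smooth_on_cong[OF smooth_on_const[of 0]]) (use d(1) \<beta>0 in auto)
      moreover have "openin (top_of M) (points M - K)"
        using compactin_imp_closedin[OF Hausdorff K] by blast
      moreover have "p \<notin> K"
      proof
        assume "p \<in> K"
        then obtain y where "y \<in> K'" "p = param c y" by (auto simp: K_def)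
        then have "p \<in> cdom c" using K'sub param_in_cdom[OF c(1), of y] by blast
        with False show False ..
      qed
      ultimately show ?thesis using p d unfolding charts_at_iff by blast
    qed
  qed
  moreover have "openin (top_of M) N"
    unfolding N_def using openin_coord_vimage[OF c(1) open_ball] U(1) by blast
  moreover have "p0 \<in> N" using U(2) c(2) r(1) by (simp add: N_def y0_def)
  moreover have "N \<subseteq> K" using inK r(1) by (force simp: N_def)
  moreover have "\<beta> p = 1" if "p \<in> N" for p
    using that s1 by (simp add: N_def \<beta>_def)
  ultimately show thesis by (intro that[of \<beta> K N] K KU \<beta>0)
qed

text \<open>Finitely many neighbourhoods on which a bump function is 1 cover \<open>S\<close>, and
  the functions are merged two at a time. This takes the place of a partition of unity.\<close>

lemma plateau_function:
  assumes S: "compactin (top_of M) S" and U: "openin (top_of M) U" "S \<subseteq> U"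
  obtains \<kappa> :: "'a \<Rightarrow> real" and K where "smooth_fun_on (points M) \<kappa>" "compactin (top_of M) K" "K \<subseteq> U"
    "\<And>p. p \<in> S \<Longrightarrow> \<kappa> p = 1" "\<And>p. p \<notin> K \<Longrightarrow> \<kappa> p = 0"
proof -
  define plateau where "plateau = (\<lambda>N. \<exists>(\<kappa> :: 'a \<Rightarrow> real) K. smooth_fun_on (points M) \<kappa> \<and> compactin (top_of M) K \<and>
    K \<subseteq> U \<and> (\<forall>p\<in>N. \<kappa> p = 1) \<and> (\<forall>p. p \<notin> K \<longrightarrow> \<kappa> p = 0))"
  have un: "plateau (\<Union>\<F>)" if "finite \<F>" "\<And>N. N \<in> \<F> \<Longrightarrow> plateau N" for \<F>
    using that
  proof (induction \<F> rule: finite_induct)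
    case empty
    show ?case unfolding plateau_def
      by (intro exI[of _ "\<lambda>_. 0"] exI[of _ "{}"]) (simp add: smooth_fun_on_const)
  next
    case (insert N \<F>)
    then have pl: "plateau N" "plateau (\<Union>\<F>)" by auto
    obtain \<kappa> :: "'a \<Rightarrow> real" and K where
      \<kappa>: "smooth_fun_on (points M) \<kappa>" "compactin (top_of M) K" "K \<subseteq> U" "\<forall>p\<in>N. \<kappa> p = 1" "\<forall>p. p \<notin> K \<longrightarrow> \<kappa> p = 0"
      using pl(1) unfolding plateau_def by (elim exE conjE)
    obtain \<psi> :: "'a \<Rightarrow> real" and L where
      \<psi>: "smooth_fun_on (points M) \<psi>" "compactin (top_of M) L" "L \<subseteq> U" "\<forall>p\<in>\<Union>\<F>. \<psi> p = 1" "\<forall>p. p \<notin> L \<longrightarrow> \<psi> p = 0"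
      using pl(2) unfolding plateau_def by (elim exE conjE)
    \<comment> \<open>This is 1 - (1 - \<kappa>)(1 - \<psi>): it equals 1 where either function does
      and 0 where both vanish.\<close>
    let ?h = "\<lambda>p. \<kappa> p + (\<psi> p + (-1) * (\<kappa> p * \<psi> p))"
    have "smooth_fun_on (points M) ?h"
      by (intro smooth_fun_on_add smooth_fun_on_mult smooth_fun_on_const \<kappa> \<psi>)
    moreover have "compactin (top_of M) (K \<union> L)" using \<kappa>(2) \<psi>(2) by (rule compactin_Un)
    moreover have "\<forall>p\<in>\<Union>(insert N \<F>). ?h p = 1" using \<kappa>(4) \<psi>(4) by auto
    moreover have "K \<union> L \<subseteq> U" "\<forall>p. p \<notin> K \<union> L \<longrightarrow> ?h p = 0" using \<kappa>(3,5) \<psi>(3,5) by auto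
    ultimately show ?case unfolding plateau_def
      by (intro exI[of _ ?h] exI[of _ "K \<union> L"] conjI)
  qed
  have "\<exists>N. openin (top_of M) N \<and> p \<in> N \<and> plateau N" if "p \<in> S" for p
  proof -
    from that U(2) have "p \<in> U" by blast
    obtain \<beta> :: "'a \<Rightarrow> real" and K N where "smooth_fun_on (points M) \<beta>" "compactin (top_of M) K" "K \<subseteq> U"
      "openin (top_of M) N" "p \<in> N" "N \<subseteq> K" "\<And>p. p \<in> N \<Longrightarrow> \<beta> p = 1" "\<And>p. p \<notin> K \<Longrightarrow> \<beta> p = 0"
      by (rule bump_function[OF U(1) \<open>p \<in> U\<close>]) (rule that)
    then show ?thesis unfolding plateau_def
      by (intro exI[of _ N] exI[of _ \<beta>] exI[of _ K] conjI ballI allI impI)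
  qed
  then have "S \<subseteq> \<Union>{N. openin (top_of M) N \<and> plateau N}" by blast
  then obtain \<F> where \<F>: "finite \<F>" "\<F> \<subseteq> {N. openin (top_of M) N \<and> plateau N}" "S \<subseteq> \<Union>\<F>"
    using compactinD[OF S, of "{N. openin (top_of M) N \<and> plateau N}"] by auto
  then have "plateau (\<Union>\<F>)" by (intro un) auto
  then obtain \<kappa> :: "'a \<Rightarrow> real" and K where "smooth_fun_on (points M) \<kappa>" "compactin (top_of M) K" "K \<subseteq> U"
    "\<forall>p\<in>\<Union>\<F>. \<kappa> p = 1" "\<forall>p. p \<notin> K \<longrightarrow> \<kappa> p = 0"
    unfolding plateau_def by (elim exE conjE)
  then show thesis using \<F>(3) by (intro that[of \<kappa> K]) auto
qed

lemma vector_field_on_tvec_of_coord: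
  assumes "c \<in> atlas M"
  shows "vector_field_on (cdom c) (\<lambda>p. tvec_of_coord M p c u)"
proof (rule vector_field_onI_local)
  show "tvec_of_coord M p c u \<in> tangent_space M p" if "p \<in> cdom c" for p
    using assms that by (intro tvec_of_coord_in_tangent_space) (simp add: charts_at_iff)
  have "smooth_on (vfield_rep (\<lambda>p. tvec_of_coord M p c u) c) (coord c ` (cdom c \<inter> (cdom c \<inter> cdom c)))"
    by (rule smooth_on_cong[OF smooth_on_const[of u]])
      (use assms in \<open>auto simp: vfield_rep_def tvec_of_coord_self charts_at_iff\<close>)
  then show "\<exists>N d. openin (top_of M) N \<and> p \<in> N \<and> d \<in> charts_at M p \<and>
      smooth_on (vfield_rep (\<lambda>p. tvec_of_coord M p c u) d) (coord d ` (cdom d \<inter> (cdom c \<inter> N)))"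
    if "p \<in> cdom c" for p
    using that assms openin_cdom[OF assms] unfolding charts_at_iff by blast
qed

text \<open>Vectors can be prescribed by fields of arbitrarily small support. This supplies the
  support points and, later, surjectivity of the derivative of \<open>\<phi>\<close>.\<close>

lemma bump_field:
  assumes U: "openin (top_of M) U" "p \<in> U" and c: "c \<in> charts_at M p"
  obtains x where "x \<in> compact_vector_fields M" "supp M x \<subseteq> U" "x p c = u"
proof -
  have c': "c \<in> atlas M" "p \<in> cdom c" using c by (auto simp: charts_at_iff)
  obtain \<beta> :: "'a \<Rightarrow> real" and K N where \<beta>: "smooth_fun_on (points M) \<beta>" "compactin (top_of M) K"
      "K \<subseteq> U \<inter> cdom c" "openin (top_of M) N" "p \<in> N" "N \<subseteq> K" "\<And>p. p \<in> N \<Longrightarrow> \<beta> p = 1" "\<And>p. p \<notin> K \<Longrightarrow> \<beta> p = 0"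
    by (rule bump_function[OF openin_Int[OF U(1) openin_cdom[OF c'(1)]] IntI[OF U(2) c'(2)]]) (rule that)
  define x where "x = (\<lambda>p d. if p \<in> cdom c then \<beta> p *\<^sub>R tvec_of_coord M p c u d else 0)"
  have K: "closedin (top_of M) K" using compactin_imp_closedin[OF Hausdorff \<beta>(2)] .
  have "x \<in> vector_fields M" unfolding x_def
    using \<beta> by (intro vector_field_extend_by_zero[OF _ openin_cdom K _ _ vector_field_on_tvec_of_coord] c') auto
  moreover have zero: "x p = zero_tvec" if "p \<notin> K" for p
    using that \<beta>(8) by (auto simp: x_def zero_tvec_def)
  ultimately have "x \<in> compact_vector_fields M"
    using compact_vector_fieldsI[OF _ \<beta>(2)] by blast
  moreover have "supp M x \<subseteq> U" using supp_subset[OF K] zero \<beta>(3) by blast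
  moreover have "x p c = u" using \<beta>(5,7) c c' by (simp add: x_def tvec_of_coord_self)
  ultimately show thesis by (rule that)
qed


section \<open>Derivations\<close>

definition tderiv :: "('a \<Rightarrow> real) \<Rightarrow> 'a \<Rightarrow> ('a, 'e) tvec \<Rightarrow> real" where
  "tderiv g p v = (let c = SOME c. c \<in> charts_at M p in
    frechet_derivative (\<lambda>y. g (param c y)) (at (coord c p) within coord c ` cdom c) (v c))"

lemma smooth_on_param_cdom:
  "smooth_fun_on (points M) g \<Longrightarrow> c \<in> atlas M \<Longrightarrow> smooth_on (\<lambda>y. g (param c y)) (coord c ` cdom c)"
  using smooth_fun_onD[of "points M" g c] by simp

text \<open>By the chain rule for the chart change, whose derivative carries \<open>v c\<close> to
  \<open>v d\<close>, the chart selected in the definition is immaterial.\<close>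

lemma tderiv_eq:
  assumes g: "smooth_fun_on (points M) g" and v: "v \<in> tangent_space M p" and c: "c \<in> charts_at M p"
  shows "tderiv g p v = frechet_derivative (\<lambda>y. g (param c y)) (at (coord c p) within coord c ` cdom c) (v c)"
proof -
  define d where "d = (SOME c. c \<in> charts_at M p)"
  have d: "d \<in> charts_at M p" unfolding d_def using c by (rule someI)
  have at: "c \<in> atlas M" "d \<in> atlas M" "p \<in> cdom c" "p \<in> cdom d" using c d by (auto simp: charts_at_iff)
  let ?S = "coord c ` (cdom c \<inter> cdom d)"
  have ho: "half_open ?S" using half_open_coord_image[OF at(1) openin_cdom[OF at(2)]] .
  have pS: "coord c p \<in> ?S" using at by blast
  have "frechet_derivative (\<lambda>y. g (param c y)) (at (coord c p) within coord c ` cdom c)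
      = frechet_derivative (\<lambda>y. g (param d (coord d (param c y)))) (at (coord c p) within ?S)"
    by (rule frechet_derivative_within_subset[OF ho _ pS smooth_on_param_cdom[OF g at(1)]])
      (use at in auto)
  moreover have "frechet_derivative (\<lambda>y. g (param d (coord d (param c y)))) (at (coord c p) within ?S) (v c)
      = frechet_derivative (\<lambda>y. g (param d y)) (at (coord d (param c (coord c p))) within coord d ` cdom d)
        (frechet_derivative (\<lambda>y. coord d (param c y)) (at (coord c p) within ?S) (v c))"
    by (rule frechet_derivative_within_compose[OF ho pS smooth_on_param_cdom[OF g at(2)]
          smooth_on_transition[OF at(1,2)]]) (use at in auto)
  moreover have "frechet_derivative (\<lambda>y. coord d (param c y)) (at (coord c p) within ?S) (v c) = v d"
    using tangent_space_change[OF v c d] by (simp add: coord_change_def o_def)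
  ultimately show ?thesis using at by (simp add: tderiv_def d_def[symmetric])
qed

lemma tderiv_zero:
  assumes "smooth_fun_on (points M) g" "p \<in> points M"
  shows "tderiv g p zero_tvec = 0"
proof -
  obtain c where c: "c \<in> atlas M" "p \<in> cdom c" using chart_atE[OF assms(2)] .
  then show ?thesis
    using tderiv_eq[OF assms(1) zero_in_tangent_space, of c p]
      linear_0[OF linear_frechet_derivative_within[OF smooth_on_param_cdom[OF assms(1) c(1)], of "coord c p"]]
    by (simp add: charts_at_iff zero_tvec_def)
qed

lemma smooth_fun_on_tderiv:
  assumes g: "smooth_fun_on (points M) g" and x: "x \<in> vector_fields M"
  shows "smooth_fun_on (points M) (\<lambda>p. tderiv g p (x p))"
  unfolding smooth_fun_on_def
proof
  fix c assume c: "c \<in> atlas M"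
  have "smooth_on (\<lambda>y. frechet_derivative (\<lambda>y. g (param c y)) (at y within coord c ` cdom c) (vfield_rep x c y))
      (coord c ` cdom c)"
    by (rule smooth_on_frechet_derivative[OF half_open_coord_cdom[OF c] smooth_on_param_cdom[OF g c]
          vector_fieldsD(2)[OF x c] order_refl])
  then show "smooth_on (\<lambda>y. tderiv g (param c y) (x (param c y))) (coord c ` (cdom c \<inter> points M))"
    unfolding cdom_Int_points[OF c]
  proof (rule smooth_on_cong)
    fix y assume "y \<in> coord c ` cdom c"
    then obtain p where p: "p \<in> cdom c" "y = coord c p" by blast
    then have "tderiv g p (x p) = frechet_derivative (\<lambda>y. g (param c y)) (at (coord c p) within coord c ` cdom c) (x p c)"
      using c cdom_subset[OF c] by (intro tderiv_eq[OF g vector_fieldsD(1)[OF x]]) (auto simp: charts_at_iff)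
    then show "frechet_derivative (\<lambda>y. g (param c y)) (at y within coord c ` cdom c) (vfield_rep x c y) =
        tderiv g (param c y) (x (param c y))"
      using p c by (simp add: vfield_rep_def)
  qed
qed

text \<open>Bracketing \<open>x\<close> with a multiple of itself leaves a multiple of \<open>x\<close>, which visibly is a vector field;
  this avoids showing that brackets of general vector fields are vector fields.\<close>

lemma lie_bracket_self_scaleR:
  assumes x: "x \<in> vector_fields M" and g: "smooth_fun_on (points M) g"
  shows "lie_bracket M x (\<lambda>p c. g p *\<^sub>R x p c) = (\<lambda>p c. tderiv g p (x p) *\<^sub>R x p c)"
proof (intro ext)
  fix p c
  show "lie_bracket M x (\<lambda>p c. g p *\<^sub>R x p c) p c = tderiv g p (x p) *\<^sub>R x p c"
  proof (cases "c \<in> charts_at M p")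
    case False
    have "x p c = 0"
    proof (cases "p \<in> points M")
      case True
      then show ?thesis using tangent_space_outside[OF vector_fieldsD(1)[OF x] False] by blast
    next
      case False
      then show ?thesis using vector_fieldsD(3)[OF x] by (simp add: zero_tvec_def)
    qed
    then show ?thesis using False by (simp add: lie_bracket_def)
  next
    case True
    then have c: "c \<in> atlas M" "p \<in> cdom c" by (auto simp: charts_at_iff)
    let ?S = "coord c ` cdom c" and ?y = "coord c p"
    have y: "?y \<in> ?S" using c by blast
    define G where "G = (\<lambda>y. g (param c y))"
    define X where "X = vfield_rep x c"
    define G' where "G' = frechet_derivative G (at ?y within ?S)"
    define X' where "X' = frechet_derivative X (at ?y within ?S)"
    have dG: "(G has_derivative G') (at ?y within ?S)"
      unfolding G_def G'_def by (rule smooth_on_has_derivative[OF smooth_on_param_cdom[OF g c(1)] y])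
    have dX: "(X has_derivative X') (at ?y within ?S)"
      unfolding X_def X'_def by (rule smooth_on_has_derivative[OF vector_fieldsD(2)[OF x c(1)] y])
    have "vfield_rep (\<lambda>p c. g p *\<^sub>R x p c) c = (\<lambda>y. G y *\<^sub>R X y)"
      by (simp add: vfield_rep_def G_def X_def)
    moreover have "frechet_derivative (\<lambda>y. G y *\<^sub>R X y) (at ?y within ?S) = (\<lambda>h. G ?y *\<^sub>R X' h + G' h *\<^sub>R X ?y)"
      by (rule frechet_derivative_within_eqI[OF half_open_coord_cdom[OF c(1)] y has_derivative_scaleR[OF dG dX]])
    moreover have "X ?y = x p c" "G ?y = g p" using c by (simp_all add: X_def G_def vfield_rep_def)
    \<comment> \<open>By linearity both terms of the bracket that contain the derivative of
      \<open>x\<close> carry the factor \<open>g p\<close> and cancel; only the derivative of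
      \<open>g\<close> is left.\<close>
    moreover have "X' (g p *\<^sub>R x p c) = g p *\<^sub>R X' (x p c)"
      using has_derivative_linear[OF dX] by (rule linear_scale)
    moreover have "tderiv g p (x p) = G' (x p c)"
      using tderiv_eq[OF g vector_fieldsD(1)[OF x] True] c cdom_subset[OF c(1)] by (auto simp: G'_def G_def)
    ultimately show ?thesis using True by (simp add: lie_bracket_def X'_def[symmetric] X_def[symmetric])
  qed
qed

end

section \<open>Functionals that take a value of their argument\<close>

lemma linear_inj_imp_bij:
  fixes f :: "'a::euclidean_space \<Rightarrow> 'b::euclidean_space"
  assumes "linear f" "inj f" "DIM('a) = DIM('b)"
  shows "bij f"
proof -
  have "dim (range f) = dim (UNIV :: 'a set)"
    using assms(1,2) by (intro dim_image_eq) auto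
  then have "span (range f) = UNIV" using assms(3) by (simp add: dim_eq_full[symmetric])
  moreover have "span (range f) = range f"
    using linear_subspace_image[OF assms(1) subspace_UNIV] by (simp add: span_eq_iff)
  ultimately show ?thesis using assms(2) by (simp add: bij_def)
qed

lemma linear_surj_imp_bij:
  fixes f :: "'a::euclidean_space \<Rightarrow> 'b::euclidean_space"
  assumes "linear f" "surj f" "DIM('a) = DIM('b)"
  shows "bij f"
proof -
  obtain g where g: "linear g" "f \<circ> g = id"
    using linear_surjective_right_inverse[OF assms(1,2)] by blast
  then have fg: "f (g y) = y" for y by (metis comp_apply id_apply)
  then have "inj g" by (metis injI)
  then have "bij g" using linear_inj_imp_bij[OF g(1)] assms(3) by simp
  have "inj f"
  proof (rule injI)
    fix x y assume "f x = f y"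
    obtain a b where "x = g a" "y = g b" using \<open>bij g\<close> by (metis bij_pointE)
    then show "x = y" using \<open>f x = f y\<close> fg by simp
  qed
  then show ?thesis using assms(2) by (simp add: bij_def)
qed

text \<open>Testing two functions \<open>g\<close>, \<open>h\<close> against two basis vectors forces \<open>T\<close> to be a scalar \<open>\<tau>\<close> with
  \<open>\<tau> g = g p\<close>, \<open>\<tau> h = h p\<close> for a common \<open>p\<close>.  Taking for \<open>h\<close> the square \<open>(g - \<tau> g)\<^sup>2\<close>, sums of such
  squares and compactness yield one \<open>p\<close> for all functions.\<close>

lemma common_evaluation_point:
  fixes T :: "('a \<Rightarrow> real) \<Rightarrow> 'e::euclidean_space \<Rightarrow> 'e"
  assumes dim: "DIM('e) \<ge> 2" and S: "compactin X S"
    and cont: "\<And>g A. g \<in> \<A> \<Longrightarrow> open A \<Longrightarrow> openin X {p \<in> topspace X. g p \<in> A}"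
    and const: "\<And>c. (\<lambda>p. c) \<in> \<A>"
    and add: "\<And>g h. g \<in> \<A> \<Longrightarrow> h \<in> \<A> \<Longrightarrow> (\<lambda>p. g p + h p) \<in> \<A>"
    and mult: "\<And>g h. g \<in> \<A> \<Longrightarrow> h \<in> \<A> \<Longrightarrow> (\<lambda>p. g p * h p) \<in> \<A>"
    and T_add: "\<And>g h b. g \<in> \<A> \<Longrightarrow> h \<in> \<A> \<Longrightarrow> T (\<lambda>p. g p + h p) b = T g b + T h b"
    and pair: "\<And>g h b d. g \<in> \<A> \<Longrightarrow> h \<in> \<A> \<Longrightarrow> b \<in> Basis \<Longrightarrow> d \<in> Basis \<Longrightarrow>
      \<exists>p\<in>S. T g b + T h d = g p *\<^sub>R b + h p *\<^sub>R d"
  shows "\<exists>p\<in>S. \<forall>g\<in>\<A>. \<forall>b\<in>Basis. T g b = g p *\<^sub>R b"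
proof -
  \<comment> \<open>Dimension at least two enters here: inner products with \<open>b0\<close> and
    \<open>b1\<close> read off the values of two functions at one and the same point.\<close>
  obtain b0 b1 :: 'e where b: "b0 \<in> Basis" "b1 \<in> Basis" "b0 \<noteq> b1"
    using dim card_2_iff'[of Basis] ex_card[of 2 "Basis :: 'e set"] by (metis card_2_iff' subsetD)
  define \<tau> where "\<tau> = (\<lambda>g. T g b0 \<bullet> b0)"
  have multiple: "\<exists>t. T g b = t *\<^sub>R b" if g: "g \<in> \<A>" and bB: "b \<in> Basis" for g b
  proof -
    obtain p where "T g b + T g b = g p *\<^sub>R b + g p *\<^sub>R b" using pair[OF g g bB bB] by blast
    then have "2 *\<^sub>R T g b = 2 *\<^sub>R (g p *\<^sub>R b)" by (simp only: scaleR_2)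
    then have "T g b = g p *\<^sub>R b" by (subst (asm) scaleR_cancel_left) simp
    then show ?thesis by blast
  qed
  \<comment> \<open>All basis vectors are scaled by the factor of \<open>b0\<close>: testing
    \<open>g\<close> against both \<open>b\<close> and \<open>b0\<close> yields a single
    \<open>p\<close> at which both factors equal \<open>g p\<close>.\<close>
  have T: "T g b = \<tau> g *\<^sub>R b" if g: "g \<in> \<A>" and bB: "b \<in> Basis" for g b
  proof (cases "b = b0")
    case True
    then show ?thesis using multiple[OF g bB] bB by (auto simp: \<tau>_def)
  next
    case False
    obtain t where t: "T g b = t *\<^sub>R b" using multiple[OF g bB] by blast
    obtain t0 where t0: "T g b0 = t0 *\<^sub>R b0" using multiple[OF g b(1)] by blast
    obtain p where p: "T g b + T g b0 = g p *\<^sub>R b + g p *\<^sub>R b0" using pair[OF g g bB b(1)] by blast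
    have "(T g b + T g b0) \<bullet> b = g p" "(T g b + T g b0) \<bullet> b0 = g p"
      unfolding p using False bB b(1) by (simp_all add: inner_add_left inner_Basis)
    then have "t = g p" "t0 = g p"
      using False bB b(1) by (simp_all add: t t0 inner_add_left inner_Basis)
    then show ?thesis using t t0 b(1) by (simp add: \<tau>_def)
  qed
  have two: "\<exists>p\<in>S. \<tau> g = g p \<and> \<tau> h = h p" if gh: "g \<in> \<A>" "h \<in> \<A>" for g h
  proof -
    obtain p where p: "p \<in> S" "T g b0 + T h b1 = g p *\<^sub>R b0 + h p *\<^sub>R b1"
      using pair[OF gh b(1,2)] by blast
    then have "\<tau> g *\<^sub>R b0 + \<tau> h *\<^sub>R b1 = g p *\<^sub>R b0 + h p *\<^sub>R b1" using T gh b by simp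
    then have "(\<tau> g *\<^sub>R b0 + \<tau> h *\<^sub>R b1) \<bullet> b0 = (g p *\<^sub>R b0 + h p *\<^sub>R b1) \<bullet> b0"
      "(\<tau> g *\<^sub>R b0 + \<tau> h *\<^sub>R b1) \<bullet> b1 = (g p *\<^sub>R b0 + h p *\<^sub>R b1) \<bullet> b1" by simp_all
    then show ?thesis using b p(1) by (auto simp: inner_add_left inner_Basis)
  qed
  have \<tau>_add: "\<tau> (\<lambda>p. g p + h p) = \<tau> g + \<tau> h" if "g \<in> \<A>" "h \<in> \<A>" for g h
    using T_add[OF that] by (simp add: \<tau>_def inner_add_left)
  have "\<exists>p\<in>S. \<forall>g\<in>\<A>. \<tau> g = g p"
  proof (rule ccontr)
    assume neg: "\<not> ?thesis"
    define sq where "sq = (\<lambda>g p. (g p + - \<tau> g) * (g p + - \<tau> g))"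
    have sq: "sq g \<in> \<A>" "\<tau> (sq g) = 0" "sq g p \<ge> 0" if "g \<in> \<A>" for g p
    proof -
      show A: "sq g \<in> \<A>" unfolding sq_def by (intro mult add const that)
      \<comment> \<open>\<open>two\<close> for \<open>g\<close> and \<open>sq g\<close> gives a
        point where \<open>g\<close> takes the value \<open>\<tau> g\<close>. There
        \<open>sq g\<close> is 0, and it also equals \<open>\<tau> (sq g)\<close>.\<close>
      show "\<tau> (sq g) = 0" using two[OF that A] by (auto simp: sq_def)
      show "sq g p \<ge> 0" by (simp add: sq_def)
    qed
    define Pos where "Pos = (\<lambda>g. {p \<in> topspace X. sq g p \<in> {0<..}})"
    have "S \<subseteq> \<Union> (Pos ` \<A>)"
    proof
      fix p assume p: "p \<in> S"
      then obtain g where g: "g \<in> \<A>" "\<tau> g \<noteq> g p" using neg by blast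
      then have "sq g p > 0" by (simp add: sq_def zero_less_mult_iff) linarith
      moreover have "p \<in> topspace X" using p S compactin_subset_topspace by blast
      ultimately show "p \<in> \<Union> (Pos ` \<A>)" using g(1) by (auto simp: Pos_def)
    qed
    moreover have "openin X U" if "U \<in> Pos ` \<A>" for U
      using that cont[OF sq(1) open_greaterThan] unfolding Pos_def by blast
    ultimately obtain \<F> where "finite \<F>" "\<F> \<subseteq> Pos ` \<A>" "S \<subseteq> \<Union>\<F>"
      using compactinD[OF S, of "Pos ` \<A>"] by blast
    then obtain G where G: "finite G" "G \<subseteq> \<A>" "S \<subseteq> \<Union> (Pos ` G)"
      by (metis finite_subset_image)
    \<comment> \<open>The sum must take its functional value 0 somewhere on \<open>S\<close>. All
      its squares vanish at that point, which therefore escapes the finite cover by sets of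
      positivity.\<close>
    have "(\<lambda>p. \<Sum>g\<in>G. sq g p) \<in> \<A> \<and> \<tau> (\<lambda>p. \<Sum>g\<in>G. sq g p) = 0"
      using G(1,2)
    proof (induction G rule: finite_induct)
      case empty
      then show ?case using two[OF const const, of 0 0] const[of 0] by auto
    next
      case (insert g G)
      then show ?case using add[OF sq(1)] \<tau>_add[OF sq(1)] sq(2) by simp
    qed
    then obtain p where p: "p \<in> S" "(\<Sum>g\<in>G. sq g p) = 0"
      using two[of "\<lambda>p. \<Sum>g\<in>G. sq g p" "\<lambda>p. \<Sum>g\<in>G. sq g p"] by auto
    then have "sq g p = 0" if "g \<in> G" for g
      using sum_nonneg_eq_0_iff[OF G(1), of "\<lambda>g. sq g p"] sq(3) G(2) that by blast
    then show False using p(1) G(3) by (force simp: Pos_def)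
  qed
  then show ?thesis using T by auto
qed

section \<open>Reduction to evaluation at a point\<close>

locale lie_hom = V: smooth_mfd V + W: smooth_mfd W
  for V :: "('a, 'e::euclidean_space) manifold" and W :: "('b, 'f::euclidean_space) manifold" +
  fixes f :: "('a, 'e) vfield \<Rightarrow> ('b, 'f) vfield"
  assumes mdim_eq: "mdim V = mdim W" and lie_homomorphism: "lie_homomorphism V W f"
begin

lemma DIM_eq: "DIM('e) = DIM('f)"
  using mdim_eq by (simp add: mdim_def)

lemma f_in: "x \<in> compact_vector_fields V \<Longrightarrow> f x \<in> vector_fields W"
  using lie_homomorphism by (simp add: lie_homomorphism_def)

lemma f_add:
  "x \<in> compact_vector_fields V \<Longrightarrow> y \<in> compact_vector_fields V \<Longrightarrow>
    f (\<lambda>p c. x p c + y p c) = (\<lambda>q d. f x q d + f y q d)"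
  using lie_homomorphism by (simp add: lie_homomorphism_def)

lemma f_scaleR:
  "x \<in> compact_vector_fields V \<Longrightarrow> f (\<lambda>p c. r *\<^sub>R x p c) = (\<lambda>q d. r *\<^sub>R f x q d)"
  using lie_homomorphism by (simp add: lie_homomorphism_def)

lemma f_lie_bracket:
  "x \<in> compact_vector_fields V \<Longrightarrow> y \<in> compact_vector_fields V \<Longrightarrow>
    f (lie_bracket V x y) = lie_bracket W (f x) (f y)"
  using lie_homomorphism by (simp add: lie_homomorphism_def)

lemma f_in_tangent_space:
  "x \<in> compact_vector_fields V \<Longrightarrow> w \<in> points W \<Longrightarrow> f x w \<in> tangent_space W w"
  using W.vector_fieldsD(1)[OF f_in] .

lemma f_eq_zero_iff:
  assumes "x \<in> compact_vector_fields V" "w \<in> points W" "c \<in> charts_at W w"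
  shows "f x w = zero_tvec \<longleftrightarrow> f x w c = 0"
  using W.tangent_space_eq_zero_iff[OF f_in_tangent_space[OF assms(1,2)] assms(3)] .

text \<open>With respect to a frame, the value of \<open>f x\<close> at \<open>w\<close> is the image of a coordinate vector \<open>\<Lambda> x\<close>.
  Subtracting the constant combination \<open>\<Lambda> x\<close> of the frame from \<open>x\<close> gives a field in the kernel, which must
  have a zero on the support: \<open>\<Lambda> x\<close> is a value of the coordinates of \<open>x\<close>.\<close>

lemma evaluation_point:
  assumes w: "w \<in> points W"
    and ne: "S \<noteq> {}" and S: "compactin (top_of V) S"
    and U: "openin (top_of V) U" "S \<subseteq> U" and triv: "tangent_bundle_trivial_on V U"
    and nonvan: "\<And>x. x \<in> compact_vector_fields V \<Longrightarrow> (\<And>p. p \<in> S \<Longrightarrow> x p \<noteq> zero_tvec) \<Longrightarrow> f x w \<noteq> zero_tvec"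
    and one: "mdim V = 1 \<Longrightarrow> \<exists>p. S = {p}"
  shows "\<exists>p\<in>points V. \<forall>x\<in>compact_vector_fields V. f x w = zero_tvec \<longleftrightarrow> x p = zero_tvec"
proof -
  have SV: "S \<subseteq> points V" using S by (rule compactin_subset_topspace)
  obtain c0 where c0: "c0 \<in> charts_at W w"
    using W.chart_atE[OF w] unfolding W.charts_at_iff by blast
  obtain \<Phi> :: "'a \<Rightarrow> ('a, 'e) tvec \<Rightarrow> 'e" where
    lin: "\<forall>p\<in>U. bij_betw (\<Phi> p) (tangent_space V p) UNIV \<and>
           (\<forall>v\<in>tangent_space V p. \<forall>w\<in>tangent_space V p.
              \<Phi> p (\<lambda>c. v c + w c) = \<Phi> p v + \<Phi> p w) \<and>
           (\<forall>r. \<forall>v\<in>tangent_space V p. \<Phi> p (\<lambda>c. r *\<^sub>R v c) = r *\<^sub>R \<Phi> p v)" and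
    smooth: "\<forall>c\<in>atlas V.
           smooth_on (\<lambda>(y, u). \<Phi> (param c y) (tvec_of_coord V (param c y) c u))
             (coord c ` (cdom c \<inter> U) \<times> UNIV) \<and>
           smooth_on (\<lambda>(y, z). the_inv_into (tangent_space V (param c y)) (\<Phi> (param c y)) z c)
             (coord c ` (cdom c \<inter> U) \<times> UNIV)"
    using triv unfolding tangent_bundle_trivial_on_def by (elim exE conjE)
  have bij: "bij_betw (\<Phi> p) (tangent_space V p) UNIV" if "p \<in> U" for p
    using lin that by blast
  have \<Phi>_add: "\<Phi> p (\<lambda>c. v c + v' c) = \<Phi> p v + \<Phi> p v'"
    if "p \<in> U" "v \<in> tangent_space V p" "v' \<in> tangent_space V p" for p v v'
    using lin that by blast
  have \<Phi>_scaleR: "\<Phi> p (\<lambda>c. r *\<^sub>R v c) = r *\<^sub>R \<Phi> p v" if "p \<in> U" "v \<in> tangent_space V p" for p r v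
    using lin that by blast
  note smooth_\<Phi> = bspec[OF smooth, THEN conjunct1] and smooth_inv = bspec[OF smooth, THEN conjunct2]
  define inv\<Phi> where "inv\<Phi> = (\<lambda>p. the_inv_into (tangent_space V p) (\<Phi> p))"
  have inv_T: "inv\<Phi> p b \<in> tangent_space V p" if "p \<in> U" for p b
    unfolding inv\<Phi>_def by (rule bij_betw_apply[OF bij_betw_the_inv_into[OF bij[OF that]] UNIV_I])
  have \<Phi>_inv: "\<Phi> p (inv\<Phi> p b) = b" if "p \<in> U" for p b
    unfolding inv\<Phi>_def by (rule f_the_inv_into_f_bij_betw[OF bij[OF that]]) simp
  have inv_eqI: "inv\<Phi> p b = v" if "p \<in> U" "v \<in> tangent_space V p" "\<Phi> p v = b" for p b v
    unfolding inv\<Phi>_def using bij[OF that(1)] that(2,3) by (intro the_inv_into_f_eq) (auto simp: bij_betw_def)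
  have \<Phi>_zero: "\<Phi> p zero_tvec = 0" if "p \<in> U" for p
    using \<Phi>_scaleR[OF that V.zero_in_tangent_space, of 0] by (simp add: zero_tvec_def)
  obtain \<kappa> :: "'a \<Rightarrow> real" and K where \<kappa>: "V.smooth_fun_on (points V) \<kappa>" "compactin (top_of V) K" "K \<subseteq> U"
    "\<And>p. p \<in> S \<Longrightarrow> \<kappa> p = 1" "\<And>p. p \<notin> K \<Longrightarrow> \<kappa> p = 0"
    by (rule V.plateau_function[OF S U]) (rule that)
  have K: "closedin (top_of V) K" using compactin_imp_closedin[OF V.Hausdorff \<kappa>(2)] .
  \<comment> \<open>The trivialization lives over \<open>U\<close> only. The factor
    \<open>\<kappa>\<close> makes its constant sections global fields of compact support and, being
    1 on \<open>S\<close>, leaves zeros and coordinates there untouched.\<close>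
  define frame where "frame = (\<lambda>b p c. if p \<in> U then \<kappa> p *\<^sub>R inv\<Phi> p b c else 0)"
  have frame: "frame b \<in> compact_vector_fields V" for b
  proof (rule V.compact_vector_fieldsI[OF _ \<kappa>(2)])
    have "V.vector_field_on U (\<lambda>p. inv\<Phi> p b)"
      unfolding V.vector_field_on_def
    proof (intro conjI ballI inv_T)
      fix c assume c: "c \<in> atlas V"
      show "smooth_on (vfield_rep (\<lambda>p. inv\<Phi> p b) c) (coord c ` (cdom c \<inter> U))"
        using smooth_on_compose[OF smooth_inv[OF c] smooth_on_Pair[OF smooth_on_id smooth_on_const[of b]],
            of "coord c ` (cdom c \<inter> U)"]
        by (simp add: vfield_rep_def inv\<Phi>_def)
    qed
    then show "frame b \<in> vector_fields V" unfolding frame_def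
      using V.vector_field_extend_by_zero[OF \<kappa>(1) U(1) K \<kappa>(3,5)] by blast
    show "frame b p = zero_tvec" if "p \<notin> K" for p
      using \<kappa>(5)[OF that] by (auto simp: frame_def zero_tvec_def fun_eq_iff)
  qed
  have frame_S: "frame b p = inv\<Phi> p b" if "p \<in> S" for b p
    using that U(2) \<kappa>(4) by (auto simp: frame_def)
  have frame_add: "frame (b + b') = (\<lambda>p c. frame b p c + frame b' p c)" for b b'
  proof -
    have "inv\<Phi> p (b + b') = (\<lambda>c. inv\<Phi> p b c + inv\<Phi> p b' c)" if "p \<in> U" for p
      using that by (intro inv_eqI V.tangent_space_add inv_T) (simp_all add: \<Phi>_add inv_T \<Phi>_inv)
    then show ?thesis by (auto simp: frame_def fun_eq_iff scaleR_add_right)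
  qed
  have frame_scaleR: "frame (r *\<^sub>R b) = (\<lambda>p c. r *\<^sub>R frame b p c)" for r b
  proof -
    have "inv\<Phi> p (r *\<^sub>R b) = (\<lambda>c. r *\<^sub>R inv\<Phi> p b c)" if "p \<in> U" for p
      using that by (intro inv_eqI V.tangent_space_scaleR inv_T) (simp_all add: \<Phi>_scaleR inv_T \<Phi>_inv)
    then show ?thesis by (auto simp: frame_def fun_eq_iff)
  qed
  define L where "L = (\<lambda>b. f (frame b) w c0)"
  have linL: "linear L"
    by (rule linearI) (simp_all add: L_def frame_add frame_scaleR f_add[OF frame frame] f_scaleR[OF frame])
  \<comment> \<open>For nonzero \<open>b\<close> the field \<open>frame b\<close> has no zero on
    \<open>S\<close>, as \<open>\<Phi> p\<close> takes it to \<open>b\<close> and the zero vector to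
    0. The nonvanishing condition thus makes \<open>L\<close> injective, and equal dimensions make
    it bijective.\<close>
  have "b = 0" if "L b = 0" for b
  proof -
    have "f (frame b) w = zero_tvec" using f_eq_zero_iff[OF frame w c0] that by (simp add: L_def)
    then obtain p where p: "p \<in> S" "frame b p = zero_tvec" using nonvan[OF frame] by blast
    then show "b = 0" using frame_S[OF p(1)] \<Phi>_inv[of p b] \<Phi>_zero[of p] U(2) by auto
  qed
  then have "inj L" using linear_injective_0[OF linL] by blast
  then have bijL: "bij L" using linear_inj_imp_bij[OF linL _ DIM_eq] by blast
  define \<Lambda> where "\<Lambda> = (\<lambda>x. inv L (f x w c0))"
  have L\<Lambda>: "L (\<Lambda> x) = f x w c0" for x unfolding \<Lambda>_def using bijL by (simp add: bij_is_surj surj_f_inv_f)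
  have \<Lambda>_eqI: "\<Lambda> x = b" if "f x w c0 = L b" for x b
    unfolding \<Lambda>_def that using bijL by (simp add: bij_is_inj inv_f_f)
  have \<Lambda>_frame: "\<Lambda> (frame b) = b" for b by (rule \<Lambda>_eqI) (simp add: L_def)
  have \<Lambda>_add: "\<Lambda> (\<lambda>p c. x p c + y p c) = \<Lambda> x + \<Lambda> y"
    if "x \<in> compact_vector_fields V" "y \<in> compact_vector_fields V" for x y
    by (rule \<Lambda>_eqI) (simp add: linear_add[OF linL] L\<Lambda> f_add[OF that])
  have \<Lambda>_scaleR: "\<Lambda> (\<lambda>p c. r *\<^sub>R x p c) = r *\<^sub>R \<Lambda> x" if "x \<in> compact_vector_fields V" for r x
    by (rule \<Lambda>_eqI) (simp add: linear_scale[OF linL] L\<Lambda> f_scaleR[OF that])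
  have T: "x p \<in> tangent_space V p" if "x \<in> compact_vector_fields V" "p \<in> S" for x p
    using V.vector_fieldsD(1)[OF V.compact_vector_fieldsD] that SV by blast
  have scale: "(\<lambda>p c. r *\<^sub>R x p c) \<in> compact_vector_fields V" if "x \<in> compact_vector_fields V" for r x
    using V.compact_vector_fields_scaleR[OF that V.smooth_fun_on_const] .
  have attained: "\<exists>p\<in>S. \<Phi> p (x p) = \<Lambda> x" if x: "x \<in> compact_vector_fields V" for x
  proof -
    let ?y = "\<lambda>p c. x p c + (-1) *\<^sub>R frame (\<Lambda> x) p c"
    have y: "?y \<in> compact_vector_fields V" by (rule V.compact_vector_fields_add[OF x scale[OF frame]])
    have "f ?y w c0 = 0" using L\<Lambda>[of x] by (simp only: f_add[OF x scale[OF frame]] f_scaleR[OF frame]) (simp add: L_def)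
    then have "f ?y w = zero_tvec" using f_eq_zero_iff[OF y w c0] by blast
    then obtain p where p: "p \<in> S" "?y p = zero_tvec" using nonvan[OF y] by blast
    then have "x p = frame (\<Lambda> x) p" by (auto simp: zero_tvec_def fun_eq_iff)
    then have "\<Phi> p (x p) = \<Lambda> x" using frame_S[OF p(1)] \<Phi>_inv[of p] U(2) p(1) by auto
    then show ?thesis using p(1) by blast
  qed
  have "\<exists>p\<in>S. \<forall>x\<in>compact_vector_fields V. \<Lambda> x = \<Phi> p (x p)"
  proof (cases "DIM('e) \<ge> 2")
    case False
    then have "DIM('e) = 1" using DIM_positive[where 'a='e] by linarith
    then obtain p where "S = {p}" using one by (auto simp: mdim_def)
    then show ?thesis using attained by auto
  next
    case True
    let ?A = "Collect (V.smooth_fun_on (points V)) :: ('a \<Rightarrow> real) set"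
    \<comment> \<open>Scaling the constant frame fields turns \<open>\<Lambda>\<close> into an
      operation on functions; \<open>attained\<close> for a sum of two scaled fields is exactly the
      condition tested in \<open>common_evaluation_point\<close>.\<close>
    define T' where "T' = (\<lambda>g b. \<Lambda> (\<lambda>p c. g p *\<^sub>R frame b p c))"
    have gf: "(\<lambda>p c. g p *\<^sub>R frame b p c) \<in> compact_vector_fields V" if "g \<in> ?A" for g b
      using V.compact_vector_fields_scaleR[OF frame] that by blast
    have "\<exists>p\<in>S. \<forall>g\<in>?A. \<forall>b\<in>Basis. T' g b = g p *\<^sub>R b"
    proof (rule common_evaluation_point[OF True S])
      show "openin (top_of V) {p \<in> points V. g p \<in> A}" if "g \<in> ?A" "open A" for g A
        using V.smooth_fun_imp_openin that by blast
      fix g h assume g: "g \<in> ?A" and h: "h \<in> ?A"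
      show "T' (\<lambda>p. g p + h p) b = T' g b + T' h b" for b
        unfolding T'_def \<Lambda>_add[OF gf[OF g] gf[OF h], symmetric] by (simp add: scaleR_add_left)
      fix b d :: 'e
      obtain p where p: "p \<in> S" "\<Phi> p (\<lambda>c. g p *\<^sub>R frame b p c + h p *\<^sub>R frame d p c) = T' g b + T' h d"
        using attained[OF V.compact_vector_fields_add[OF gf[OF g, of b] gf[OF h, of d]]]
        unfolding T'_def \<Lambda>_add[OF gf[OF g] gf[OF h]] by blast
      have "p \<in> U" using p(1) U(2) by blast
      then have "\<Phi> p (\<lambda>c. g p *\<^sub>R frame b p c + h p *\<^sub>R frame d p c) = g p *\<^sub>R b + h p *\<^sub>R d"
        by (simp add: frame_S[OF p(1)] \<Phi>_add \<Phi>_scaleR \<Phi>_inv inv_T V.tangent_space_scaleR)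
      then show "\<exists>p\<in>S. T' g b + T' h d = g p *\<^sub>R b + h p *\<^sub>R d" using p by auto
    qed (auto simp: V.smooth_fun_on_const V.smooth_fun_on_add V.smooth_fun_on_mult)
    then obtain p where p: "p \<in> S" "\<And>g b. g \<in> ?A \<Longrightarrow> b \<in> Basis \<Longrightarrow> T' g b = g p *\<^sub>R b" by blast
    have "\<Lambda> x = \<Phi> p (x p)" if x: "x \<in> compact_vector_fields V" for x
    proof -
      \<comment> \<open>The coordinates of \<open>x\<close>, cut off by \<open>\<kappa>\<close>. As
        \<open>frame\<close> carries a second factor \<open>\<kappa>\<close>, the combination with
        these coefficients is \<kappa>^2 times \<open>x\<close> on \<open>U\<close>: it agrees with
        \<open>x\<close> on \<open>S\<close>, but not in general elsewhere.\<close>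
      define A where "A = (\<lambda>b p. if p \<in> U then \<kappa> p *\<^sub>R (\<Phi> p (x p) \<bullet> b) else 0)"
      have A: "A b \<in> ?A" for b
      proof -
        have "V.smooth_fun_on U (\<lambda>p. \<Phi> p (x p) \<bullet> b)"
          unfolding V.smooth_fun_on_def
        proof
          fix c assume c: "c \<in> atlas V"
          have sx: "smooth_on (vfield_rep x c) (coord c ` (cdom c \<inter> U))"
            by (rule smooth_on_subset[OF V.vector_fieldsD(2)[OF V.compact_vector_fieldsD[OF x] c]]) blast
          have "smooth_on (\<lambda>y. \<Phi> (param c y) (tvec_of_coord V (param c y) c (vfield_rep x c y)) \<bullet> b)
              (coord c ` (cdom c \<inter> U))"
            using smooth_on_compose[OF smooth_\<Phi>[OF c] smooth_on_Pair[OF smooth_on_id sx]]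
            by (intro smooth_on_inner smooth_on_const) simp
          then show "smooth_on (\<lambda>y. \<Phi> (param c y) (x (param c y)) \<bullet> b) (coord c ` (cdom c \<inter> U))"
          proof (rule smooth_on_cong)
            fix y assume "y \<in> coord c ` (cdom c \<inter> U)"
            then obtain q where q: "q \<in> cdom c" "y = coord c q" by blast
            then show "\<Phi> (param c y) (tvec_of_coord V (param c y) c (vfield_rep x c y)) \<bullet> b =
                \<Phi> (param c y) (x (param c y)) \<bullet> b"
              using V.tvec_of_coord_eq[OF V.vector_fieldsD(1)[OF V.compact_vector_fieldsD[OF x]], of q c]
                c V.cdom_subset[OF c] by (auto simp: vfield_rep_def V.charts_at_iff)
          qed
        qed
        then show ?thesis unfolding A_def
          using V.smooth_fun_extend_by_zero[OF \<kappa>(1) U(1) K \<kappa>(3,5)] by blast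
      qed
      have "(\<lambda>p c. \<Sum>b\<in>B. A b p *\<^sub>R frame b p c) \<in> compact_vector_fields V \<and>
          \<Lambda> (\<lambda>p c. \<Sum>b\<in>B. A b p *\<^sub>R frame b p c) = (\<Sum>b\<in>B. A b p *\<^sub>R b) \<and>
          (\<forall>q\<in>S. \<Phi> q (\<lambda>c. \<Sum>b\<in>B. A b q *\<^sub>R frame b q c) = (\<Sum>b\<in>B. A b q *\<^sub>R b))"
        if "finite B" "B \<subseteq> Basis" for B
        using that
      proof (induction B rule: finite_induct)
        case empty
        \<comment> \<open>The zero field is written as \<open>0\<close> times \<open>x\<close>, so
          that closure under scaling covers it.\<close>
        have z: "(\<lambda>p c. 0 *\<^sub>R x p c) \<in> compact_vector_fields V" using scale[OF x] .
        have "\<Lambda> (\<lambda>p c. 0 *\<^sub>R x p c) = 0" using \<Lambda>_scaleR[OF x, of 0] by simp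
        then show ?case using z \<Phi>_zero U(2) by (auto simp: zero_tvec_def)
      next
        case (insert b B)
        let ?x = "\<lambda>p c. \<Sum>b\<in>B. A b p *\<^sub>R frame b p c"
        have x': "?x \<in> compact_vector_fields V" and IH: "\<Lambda> ?x = (\<Sum>b\<in>B. A b p *\<^sub>R b)"
          "\<And>q. q \<in> S \<Longrightarrow> \<Phi> q (?x q) = (\<Sum>b\<in>B. A b q *\<^sub>R b)"
          using insert by auto
        have "\<Lambda> (\<lambda>p c. A b p *\<^sub>R frame b p c + ?x p c) = A b p *\<^sub>R b + (\<Sum>b\<in>B. A b p *\<^sub>R b)"
          using \<Lambda>_add[OF gf[OF A] x'] p(2)[OF A, of b] IH(1) insert.prems by (simp add: T'_def)
        moreover have "\<Phi> q (\<lambda>c. A b q *\<^sub>R frame b q c + ?x q c) = A b q *\<^sub>R b + (\<Sum>b\<in>B. A b q *\<^sub>R b)"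
          if q: "q \<in> S" for q
        proof -
          have "q \<in> U" using q U(2) by blast
          then show ?thesis
            using \<Phi>_add[OF \<open>q \<in> U\<close> T[OF gf[OF A] q] T[OF x' q]] IH(2)[OF q] \<Phi>_scaleR[OF \<open>q \<in> U\<close> T[OF frame q]]
            by (simp add: frame_S[OF q] \<Phi>_inv)
        qed
        ultimately show ?case
          using V.compact_vector_fields_add[OF gf[OF A] x'] insert.hyps by simp
      qed
      from this[OF finite_Basis order_refl]
      obtain z where z: "z \<in> compact_vector_fields V" "\<Lambda> z = (\<Sum>b\<in>Basis. A b p *\<^sub>R b)"
        "\<And>q. q \<in> S \<Longrightarrow> \<Phi> q (z q) = (\<Sum>b\<in>Basis. A b q *\<^sub>R b)" by blast
      have A_S: "(\<Sum>b\<in>Basis. A b q *\<^sub>R b) = \<Phi> q (x q)" if "q \<in> S" for q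
        using that U(2) \<kappa>(4) by (auto simp: A_def euclidean_representation)
      \<comment> \<open>\<open>x\<close> and \<open>z\<close> agree on \<open>S\<close>, so the
        coordinates of their difference take only the value 0 there, and \<open>attained\<close>
        forces \<open>\<Lambda> x = \<Lambda> z\<close>. This is how the discrepancy away from
        \<open>S\<close> is disposed of.\<close>
      obtain q where q: "q \<in> S" "\<Phi> q (\<lambda>c. x q c + (-1) *\<^sub>R z q c) = \<Lambda> (\<lambda>p c. x p c + (-1) *\<^sub>R z p c)"
        using attained[OF V.compact_vector_fields_add[OF x scale[OF z(1), of "-1"]]] by auto
      have "q \<in> U" using q(1) U(2) by blast
      have "\<Lambda> x + (-1) *\<^sub>R \<Lambda> z = \<Phi> q (x q) + (-1) *\<^sub>R \<Phi> q (z q)"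
        using q(2) \<Lambda>_add[OF x scale[OF z(1), of "-1"]] \<Lambda>_scaleR[OF z(1), of "-1"]
          \<Phi>_add[OF \<open>q \<in> U\<close> T[OF x q(1)] V.tangent_space_scaleR[OF T[OF z(1) q(1)], of "-1"]]
          \<Phi>_scaleR[OF \<open>q \<in> U\<close> T[OF z(1) q(1)], of "-1"] by simp
      also have "\<dots> = 0" using z(3)[OF q(1)] A_S[OF q(1)] by simp
      finally show ?thesis using z(2) A_S[OF p(1)] by simp
    qed
    then show ?thesis using p(1) by blast
  qed
  then obtain p where p: "p \<in> S" "\<And>x. x \<in> compact_vector_fields V \<Longrightarrow> \<Lambda> x = \<Phi> p (x p)" by blast
  have "f x w = zero_tvec \<longleftrightarrow> x p = zero_tvec" if x: "x \<in> compact_vector_fields V" for x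
  proof -
    have "p \<in> U" using p(1) U(2) by blast
    have "f x w = zero_tvec \<longleftrightarrow> L (\<Lambda> x) = 0" using f_eq_zero_iff[OF x w c0] by (simp add: L\<Lambda>)
    also have "\<dots> \<longleftrightarrow> \<Lambda> x = 0" using linear_0[OF linL] \<open>inj L\<close> by (metis injD)
    also have "\<dots> \<longleftrightarrow> \<Phi> p (x p) = \<Phi> p zero_tvec" using p(2)[OF x] \<Phi>_zero[OF \<open>p \<in> U\<close>] by simp
    also have "\<dots> \<longleftrightarrow> x p = zero_tvec"
      using bij[OF \<open>p \<in> U\<close>] T[OF x p(1)] V.zero_in_tangent_space by (auto simp: bij_betw_def inj_on_def)
    finally show ?thesis .
  qed
  then show ?thesis using p(1) SV by blast
qed

end

section \<open>Vector fields related by a map\<close>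

lemma (in smooth_mfd) nonvanishing_field:
  assumes "p \<in> points M"
  obtains x where "x \<in> compact_vector_fields M" "x p \<noteq> zero_tvec"
proof -
  obtain c where c: "c \<in> charts_at M p"
    using chart_atE[OF assms] unfolding charts_at_iff by blast
  obtain b :: 'e where b: "b \<in> Basis" using nonempty_Basis by blast
  obtain x where "x \<in> compact_vector_fields M" "supp M x \<subseteq> points M" "x p c = b"
    by (rule bump_field[OF openin_topspace assms c]) (rule that)
  then have "x p \<noteq> zero_tvec" using nonzero_Basis[OF b] by (metis zero_tvec_def)
  then show thesis using that \<open>x \<in> compact_vector_fields M\<close> by blast
qed

text \<open>Both implications meet here: what is kept of (i) or (ii) is that evaluation at
  \<open>w\<close> after \<open>f\<close> has the same kernel as evaluation at
  \<open>\<phi> w\<close>. \<open>\<phi>\<close> is a bare function; its continuity, its smoothness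
  and the formula are consequences.\<close>

locale lie_hom_at_points = lie_hom V W f
  for V :: "('a, 'e::euclidean_space) manifold" and W :: "('b, 'f::euclidean_space) manifold" and f +
  fixes \<phi> :: "'b \<Rightarrow> 'a"
  assumes phi: "w \<in> points W \<Longrightarrow> \<phi> w \<in> points V"
    and f_zero_iff: "w \<in> points W \<Longrightarrow> x \<in> compact_vector_fields V \<Longrightarrow>
      f x w = zero_tvec \<longleftrightarrow> x (\<phi> w) = zero_tvec"
begin

text \<open>For fixed \<open>w\<close> the field g x - g(\<phi> w) x vanishes at
  \<open>\<phi> w\<close>, so its image vanishes at \<open>w\<close>; the second factor is a
  constant, which \<open>f\<close> respects.\<close>

lemma f_mult:
  assumes x: "x \<in> compact_vector_fields V" and g: "V.smooth_fun_on (points V) g"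
  shows "f (\<lambda>p c. g p *\<^sub>R x p c) = (\<lambda>w d. g (\<phi> w) *\<^sub>R f x w d)"
proof (intro ext)
  fix w d
  have gx: "(\<lambda>p c. g p *\<^sub>R x p c) \<in> compact_vector_fields V" by (rule V.compact_vector_fields_scaleR[OF x g])
  show "f (\<lambda>p c. g p *\<^sub>R x p c) w d = g (\<phi> w) *\<^sub>R f x w d"
  proof (cases "w \<in> points W")
    case False
    then show ?thesis
      using W.vector_fieldsD(3)[OF f_in[OF x]] W.vector_fieldsD(3)[OF f_in[OF gx]] by (simp add: zero_tvec_def)
  next
    case True
    let ?r = "- g (\<phi> w)"
    have rx: "(\<lambda>p c. ?r *\<^sub>R x p c) \<in> compact_vector_fields V"
      by (rule V.compact_vector_fields_scaleR[OF x V.smooth_fun_on_const])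
    have "f (\<lambda>p c. g p *\<^sub>R x p c + ?r *\<^sub>R x p c) w = zero_tvec"
      using f_zero_iff[OF True V.compact_vector_fields_add[OF gx rx]] by (simp add: zero_tvec_def)
    then have "f (\<lambda>p c. g p *\<^sub>R x p c) w d + ?r *\<^sub>R f x w d = zero_tvec d"
      unfolding f_add[OF gx rx] f_scaleR[OF x] by (rule fun_cong)
    then show ?thesis by (simp add: zero_tvec_def)
  qed
qed

text \<open>If \<open>x\<close> is nonzero at \<open>\<phi> w\<close>, then \<open>f x\<close> is
  nonzero near \<open>w\<close>, and the image of g x is g \<circ> \<phi> times it. With coordinate
  representations \<open>G\<close> and \<open>F\<close> of the two images, the factor is recovered
  as the inner product of \<open>G\<close> and \<open>F\<close> divided by that of \<open>F\<close>
  with itself.\<close>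

lemma smooth_fun_on_comp:
  fixes g :: "'a \<Rightarrow> real"
  assumes g: "V.smooth_fun_on (points V) g"
  shows "W.smooth_fun_on (points W) (\<lambda>w. g (\<phi> w))"
proof (rule W.smooth_fun_onI_local)
  fix w assume w: "w \<in> points W"
  obtain c where c: "c \<in> atlas W" "w \<in> cdom c" using W.chart_atE[OF w] .
  obtain x where x: "x \<in> compact_vector_fields V" "x (\<phi> w) \<noteq> zero_tvec"
    by (rule V.nonvanishing_field[OF phi[OF w]]) (rule that)
  define F where "F = vfield_rep (f x) c"
  define G where "G = vfield_rep (f (\<lambda>p c. g p *\<^sub>R x p c)) c"
  have F: "smooth_on F (coord c ` cdom c)"
    unfolding F_def by (rule W.vector_fieldsD(2)[OF f_in[OF x(1)] c(1)])
  have G: "smooth_on G (coord c ` cdom c)"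
    unfolding G_def by (rule W.vector_fieldsD(2)[OF f_in[OF V.compact_vector_fields_scaleR[OF x(1) g]] c(1)])
  define N where "N = {q \<in> cdom c. F (coord c q) \<in> -{0}}"
  have N: "openin (top_of W) N"
    unfolding N_def by (rule W.openin_chart_vimage[OF c(1) smooth_on_imp_continuous_on[OF F]]) auto
  have "f x w c \<noteq> 0"
    using f_zero_iff[OF w x(1)] f_eq_zero_iff[OF x(1) w, of c] x(2) c by (simp add: W.charts_at_iff)
  then have wN: "w \<in> N" using c by (simp add: N_def F_def vfield_rep_def)
  have sub: "coord c ` (cdom c \<inter> (points W \<inter> N)) \<subseteq> coord c ` cdom c" by blast
  have nz: "F y \<bullet> F y \<noteq> 0" if "y \<in> coord c ` (cdom c \<inter> (points W \<inter> N))" for y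
    using that by (auto simp: N_def)
  have "smooth_on (\<lambda>y. (G y \<bullet> F y) * inverse (F y \<bullet> F y)) (coord c ` (cdom c \<inter> (points W \<inter> N)))"
    by (intro smooth_on_mult smooth_on_inner smooth_on_inverse smooth_on_subset[OF F sub] smooth_on_subset[OF G sub] nz)
  then have "smooth_on (\<lambda>y. g (\<phi> (param c y))) (coord c ` (cdom c \<inter> (points W \<inter> N)))"
  proof (rule smooth_on_cong)
    fix y assume y: "y \<in> coord c ` (cdom c \<inter> (points W \<inter> N))"
    have "G y = g (\<phi> (param c y)) *\<^sub>R F y" by (simp add: G_def F_def vfield_rep_def f_mult[OF x(1) g])
    then show "(G y \<bullet> F y) * inverse (F y \<bullet> F y) = g (\<phi> (param c y))" using nz[OF y] by simp
  qed
  then show "\<exists>N c. openin (top_of W) N \<and> w \<in> N \<and> c \<in> charts_at W w \<and>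
      smooth_on (\<lambda>y. g (\<phi> (param c y))) (coord c ` (cdom c \<inter> (points W \<inter> N)))"
    using N wN c unfolding W.charts_at_iff by blast
qed

text \<open>Continuity of \<open>\<phi>\<close> follows from smoothness of its compositions with
  functions: a bump function carried by \<open>U\<close> is positive on a neighbourhood of
  \<open>w\<close> after composition, and points of that neighbourhood map into
  \<open>U\<close>.\<close>

lemma openin_phi_vimage:
  assumes U: "openin (top_of V) U"
  shows "openin (top_of W) {w \<in> points W. \<phi> w \<in> U}"
proof (subst openin_subopen, intro ballI)
  fix w assume "w \<in> {w \<in> points W. \<phi> w \<in> U}"
  then have w: "w \<in> points W" "\<phi> w \<in> U" by auto
  obtain \<beta> :: "'a \<Rightarrow> real" and K N where \<beta>: "V.smooth_fun_on (points V) \<beta>" "compactin (top_of V) K" "K \<subseteq> U"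
    "openin (top_of V) N" "\<phi> w \<in> N" "N \<subseteq> K" "\<And>p. p \<in> N \<Longrightarrow> \<beta> p = 1" "\<And>p. p \<notin> K \<Longrightarrow> \<beta> p = 0"
    by (rule V.bump_function[OF U w(2)]) (rule that)
  let ?T = "{w \<in> points W. \<beta> (\<phi> w) \<in> {0<..}}"
  have "openin (top_of W) ?T"
    by (rule W.smooth_fun_imp_openin[OF smooth_fun_on_comp[OF \<beta>(1)] open_greaterThan])
  moreover have "w \<in> ?T" using w(1) \<beta>(5,7) by simp
  moreover have "?T \<subseteq> {w \<in> points W. \<phi> w \<in> U}" using \<beta>(3,8) by force
  ultimately show "\<exists>T. openin (top_of W) T \<and> w \<in> T \<and> T \<subseteq> {w \<in> points W. \<phi> w \<in> U}" by blast
qed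

text \<open>By \<open>f_mult\<close>, the image of the bracket of x and g x is computed in two ways
  as a multiple of \<open>f x\<close>. Where \<open>f x w\<close> is nonzero it cancels and the two
  derivatives agree; where it is zero, so is \<open>x (\<phi> w)\<close>, and both sides are 0. This
  is the one use of the bracket.\<close>

lemma tderiv_comp:
  assumes g: "V.smooth_fun_on (points V) g" and x: "x \<in> compact_vector_fields V" and w: "w \<in> points W"
  shows "W.tderiv (\<lambda>w. g (\<phi> w)) w (f x w) = V.tderiv g (\<phi> w) (x (\<phi> w))"
proof (cases "x (\<phi> w) = zero_tvec")
  case True
  then show ?thesis
    using f_zero_iff[OF w x] W.tderiv_zero[OF smooth_fun_on_comp[OF g] w] V.tderiv_zero[OF g phi[OF w]] by simp
next
  case False
  have gx: "(\<lambda>p c. g p *\<^sub>R x p c) \<in> compact_vector_fields V" by (rule V.compact_vector_fields_scaleR[OF x g])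
  have "f (lie_bracket V x (\<lambda>p c. g p *\<^sub>R x p c)) = lie_bracket W (f x) (\<lambda>w d. g (\<phi> w) *\<^sub>R f x w d)"
    by (simp add: f_lie_bracket[OF x gx] f_mult[OF x g])
  then have "(\<lambda>w d. V.tderiv g (\<phi> w) (x (\<phi> w)) *\<^sub>R f x w d) =
      (\<lambda>w d. W.tderiv (\<lambda>w. g (\<phi> w)) w (f x w) *\<^sub>R f x w d)"
    by (simp only: V.lie_bracket_self_scaleR[OF V.compact_vector_fieldsD[OF x] g]
        W.lie_bracket_self_scaleR[OF f_in[OF x] smooth_fun_on_comp[OF g]]
        f_mult[OF x V.smooth_fun_on_tderiv[OF g V.compact_vector_fieldsD[OF x]]])
  then have "V.tderiv g (\<phi> w) (x (\<phi> w)) *\<^sub>R f x w d = W.tderiv (\<lambda>w. g (\<phi> w)) w (f x w) *\<^sub>R f x w d" for d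
    by (rule fun_cong[OF fun_cong])
  moreover obtain d where "f x w d \<noteq> 0"
    using False f_zero_iff[OF w x] by (auto simp: zero_tvec_def fun_eq_iff)
  ultimately show ?thesis by (metis scaleR_cancel_right)
qed

text \<open>What is known concerns compositions of \<open>\<phi>\<close> with functions on all of
  \<open>V\<close>, so the coordinates of \<open>d\<close> are cut off and extended by 0. On
  \<open>N\<close>, whose image lies where the cutoff is 1, they give the components of the local
  representation.\<close>

lemma local_rep_near:
  assumes w: "w \<in> points W" and c: "c \<in> charts_at W w" and d: "d \<in> charts_at V (\<phi> w)"
  obtains N where "openin (top_of W) N" "w \<in> N" "N \<subseteq> {q \<in> points W. \<phi> q \<in> cdom d}"
    "smooth_on (local_rep c d \<phi>) (coord c ` (cdom c \<inter> N))"
    "\<And>x. x \<in> compact_vector_fields V \<Longrightarrow>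
      frechet_derivative (local_rep c d \<phi>) (at (coord c w) within coord c ` (cdom c \<inter> N)) (f x w c) = x (\<phi> w) d"
proof -
  have at: "c \<in> atlas W" "w \<in> cdom c" "d \<in> atlas V" "\<phi> w \<in> cdom d"
    using c d by (auto simp: V.charts_at_iff W.charts_at_iff)
  obtain \<beta> :: "'a \<Rightarrow> real" and K Q where \<beta>: "V.smooth_fun_on (points V) \<beta>" "compactin (top_of V) K" "K \<subseteq> cdom d"
    "openin (top_of V) Q" "\<phi> w \<in> Q" "Q \<subseteq> K" "\<And>p. p \<in> Q \<Longrightarrow> \<beta> p = 1" "\<And>p. p \<notin> K \<Longrightarrow> \<beta> p = 0"
    by (rule V.bump_function[OF V.openin_cdom[OF at(3)] at(4)]) (rule that)
  have K: "closedin (top_of V) K" using compactin_imp_closedin[OF V.Hausdorff \<beta>(2)] .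
  have Od: "Q \<subseteq> cdom d" using \<beta>(3,6) by blast
  define N where "N = {q \<in> points W. \<phi> q \<in> Q}"
  have N: "openin (top_of W) N" unfolding N_def by (rule openin_phi_vimage[OF \<beta>(4)])
  have wN: "w \<in> N" using w \<beta>(5) by (simp add: N_def)
  define S where "S = coord c ` (cdom c \<inter> N)"
  have S: "half_open S" unfolding S_def by (rule W.half_open_coord_image[OF at(1) N])
  have wS: "coord c w \<in> S" using at(2) wN by (auto simp: S_def)
  define R where "R = local_rep c d \<phi>"
  define g where "g = (\<lambda>u p. if p \<in> cdom d then \<beta> p *\<^sub>R (coord d p \<bullet> u) else 0)"
  have g: "V.smooth_fun_on (points V) (g u)" for u
  proof -
    have "V.smooth_fun_on (cdom d) (\<lambda>p. coord d p \<bullet> u)"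
    proof (rule V.smooth_fun_onI_local)
      fix p assume "p \<in> cdom d"
      moreover have "smooth_on (\<lambda>y. coord d (param d y) \<bullet> u) (coord d ` (cdom d \<inter> (cdom d \<inter> cdom d)))"
        by (rule smooth_on_cong[OF smooth_on_inner[OF smooth_on_id smooth_on_const[of u]]]) (use at(3) in auto)
      ultimately show "\<exists>N c. openin (top_of V) N \<and> p \<in> N \<and> c \<in> charts_at V p \<and>
          smooth_on (\<lambda>y. coord d (param c y) \<bullet> u) (coord c ` (cdom c \<inter> (cdom d \<inter> N)))"
        using V.openin_cdom[OF at(3)] at(3) unfolding V.charts_at_iff by blast
    qed
    from V.smooth_fun_extend_by_zero[OF \<beta>(1) V.openin_cdom[OF at(3)] K \<beta>(3,8) this]
    show ?thesis unfolding g_def by blast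
  qed
  have g_O: "g u p = coord d p \<bullet> u" if "p \<in> Q" for u p
    using that Od \<beta>(7) by (auto simp: g_def)
  have R_g: "g u (\<phi> (param c y)) = R y \<bullet> u" if "y \<in> S" for u y
    using that at(1) g_O by (auto simp: S_def N_def R_def local_rep_def)
  have g\<phi>: "smooth_on (\<lambda>y. g u (\<phi> (param c y))) (coord c ` cdom c)" for u
    by (rule W.smooth_on_param_cdom[OF smooth_fun_on_comp[OF g] at(1)])
  have SS: "S \<subseteq> coord c ` cdom c" by (auto simp: S_def)
  have smooth_R: "smooth_on R S"
    by (rule smooth_on_componentwise) (rule smooth_on_cong[OF smooth_on_subset[OF g\<phi> SS] R_g])
  have deriv: "frechet_derivative R (at (coord c w) within S) (f x w c) = x (\<phi> w) d"
    if x: "x \<in> compact_vector_fields V" for x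
  proof (rule euclidean_eqI)
    fix u :: 'e assume "u \<in> Basis"
    let ?D = "frechet_derivative R (at (coord c w) within S)"
    have "((\<lambda>y. R y \<bullet> u) has_derivative (\<lambda>v. ?D v \<bullet> u)) (at (coord c w) within S)"
      by (rule bounded_linear.has_derivative[OF bounded_linear_inner_left smooth_on_has_derivative[OF smooth_R wS]])
    then have "?D (f x w c) \<bullet> u = frechet_derivative (\<lambda>y. R y \<bullet> u) (at (coord c w) within S) (f x w c)"
      by (simp add: frechet_derivative_within_eqI[OF S wS])
    also have "frechet_derivative (\<lambda>y. R y \<bullet> u) (at (coord c w) within S) =
        frechet_derivative (\<lambda>y. g u (\<phi> (param c y))) (at (coord c w) within coord c ` cdom c)"
      by (rule frechet_derivative_within_subset[OF S SS wS g\<phi> R_g, symmetric])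
    also have "\<dots> (f x w c) = W.tderiv (\<lambda>w. g u (\<phi> w)) w (f x w)"
      by (rule W.tderiv_eq[OF smooth_fun_on_comp[OF g] f_in_tangent_space[OF x w] c, symmetric])
    also have "\<dots> = V.tderiv (g u) (\<phi> w) (x (\<phi> w))" by (rule tderiv_comp[OF g x w])
    also have "\<dots> = frechet_derivative (\<lambda>y. g u (param d y)) (at (coord d (\<phi> w)) within coord d ` cdom d) (x (\<phi> w) d)"
      by (rule V.tderiv_eq[OF g V.vector_fieldsD(1)[OF V.compact_vector_fieldsD[OF x] phi[OF w]] d])
    also have "frechet_derivative (\<lambda>y. g u (param d y)) (at (coord d (\<phi> w)) within coord d ` cdom d) =
        frechet_derivative (\<lambda>y. y \<bullet> u) (at (coord d (\<phi> w)) within coord d ` (cdom d \<inter> Q))"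
      by (rule frechet_derivative_within_subset[OF V.half_open_coord_image[OF at(3) \<beta>(4)] _ _ V.smooth_on_param_cdom[OF g at(3)]])
        (use at(3,4) \<beta>(5) g_O in auto)
    also have "\<dots> = (\<lambda>v. v \<bullet> u)"
      by (rule frechet_derivative_within_eqI[OF V.half_open_coord_image[OF at(3) \<beta>(4)]])
        (use at(4) \<beta>(5) in \<open>auto intro: bounded_linear_imp_has_derivative bounded_linear_inner_left\<close>)
    finally show "?D (f x w c) \<bullet> u = x (\<phi> w) d \<bullet> u" .
  qed
  show thesis
    using that[OF N wN _ smooth_R[unfolded R_def S_def] deriv[unfolded R_def S_def]] Od by (auto simp: N_def)
qed

lemma local_rep_smooth:
  assumes c: "c \<in> atlas W" and d: "d \<in> atlas V"
  shows "smooth_on (local_rep c d \<phi>) (coord c ` (cdom c \<inter> {q \<in> points W. \<phi> q \<in> cdom d}))"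
proof (rule W.smooth_on_chart_local[OF c])
  fix w assume w: "w \<in> cdom c" "w \<in> {q \<in> points W. \<phi> q \<in> cdom d}"
  then have w': "w \<in> points W" "c \<in> charts_at W w" "d \<in> charts_at V (\<phi> w)"
    using c d by (auto simp: V.charts_at_iff W.charts_at_iff)
  obtain N where N: "openin (top_of W) N" "w \<in> N" "N \<subseteq> {q \<in> points W. \<phi> q \<in> cdom d}"
    "smooth_on (local_rep c d \<phi>) (coord c ` (cdom c \<inter> N))"
    by (rule local_rep_near[OF w']) (rule that)
  have "smooth_on (local_rep c d \<phi>) (coord c ` (cdom c \<inter> ({q \<in> points W. \<phi> q \<in> cdom d} \<inter> N)))"
    by (rule smooth_on_subset[OF N(4)]) blast
  then show "\<exists>N. openin (top_of W) N \<and> w \<in> N \<and>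
      smooth_on (local_rep c d \<phi>) (coord c ` (cdom c \<inter> ({q \<in> points W. \<phi> q \<in> cdom d} \<inter> N)))"
    using N(1,2) by blast
qed

text \<open>The full preimage of \<open>cdom d\<close> is the domain prescribed by
  \<open>differential\<close>; passing to it from a small neighbourhood leaves the derivative
  unchanged.\<close>

lemma local_rep_derivative:
  assumes w: "w \<in> points W" and c: "c \<in> charts_at W w" and d: "d \<in> charts_at V (\<phi> w)"
    and x: "x \<in> compact_vector_fields V"
  shows "frechet_derivative (local_rep c d \<phi>)
    (at (coord c w) within coord c ` (cdom c \<inter> {q \<in> points W. \<phi> q \<in> cdom d})) (f x w c) = x (\<phi> w) d"
proof -
  have at: "c \<in> atlas W" "w \<in> cdom c" "d \<in> atlas V" using c d by (auto simp: V.charts_at_iff W.charts_at_iff)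
  obtain N where N: "openin (top_of W) N" "w \<in> N" "N \<subseteq> {q \<in> points W. \<phi> q \<in> cdom d}"
    "\<And>x. x \<in> compact_vector_fields V \<Longrightarrow>
      frechet_derivative (local_rep c d \<phi>) (at (coord c w) within coord c ` (cdom c \<inter> N)) (f x w c) = x (\<phi> w) d"
    by (rule local_rep_near[OF w c d]) (rule that)
  have "frechet_derivative (local_rep c d \<phi>)
      (at (coord c w) within coord c ` (cdom c \<inter> {q \<in> points W. \<phi> q \<in> cdom d})) =
    frechet_derivative (local_rep c d \<phi>) (at (coord c w) within coord c ` (cdom c \<inter> N))"
    by (rule frechet_derivative_within_subset[OF W.half_open_coord_image[OF at(1) N(1)] _ _ local_rep_smooth[OF at(1,3)]])
      (use N at(2) in auto)
  then show ?thesis using N(4)[OF x] by simp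
qed

text \<open>Every vector at \<open>\<phi> w\<close> is the value of a bump field, and the derivative
  formula exhibits it as an image; equal dimensions turn surjectivity into bijectivity.\<close>

lemma local_rep_derivative_bij:
  assumes w: "w \<in> points W" and c: "c \<in> charts_at W w" and d: "d \<in> charts_at V (\<phi> w)"
  shows "bij (frechet_derivative (local_rep c d \<phi>)
    (at (coord c w) within coord c ` (cdom c \<inter> {q \<in> points W. \<phi> q \<in> cdom d})))" (is "bij ?D")
proof (rule linear_surj_imp_bij)
  have at: "c \<in> atlas W" "w \<in> cdom c" "d \<in> atlas V" "\<phi> w \<in> cdom d"
    using c d by (auto simp: V.charts_at_iff W.charts_at_iff)
  show "linear ?D"
    by (rule linear_frechet_derivative_within[OF local_rep_smooth[OF at(1,3)]]) (use at w in auto)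
  have "\<exists>v. ?D v = u" for u
  proof -
    obtain x where "x \<in> compact_vector_fields V" "supp V x \<subseteq> points V" "x (\<phi> w) d = u"
      by (rule V.bump_field[OF openin_topspace phi[OF w] d]) (rule that)
    then have "?D (f x w c) = u" using local_rep_derivative[OF w c d, of x] by simp
    then show ?thesis by (rule exI)
  qed
  then show "surj ?D" unfolding surj_def by metis
  show "DIM('f) = DIM('e)" using DIM_eq by simp
qed

section \<open>The map is a local diffeomorphism and its differential inverts the
  homomorphism\<close>

lemma smooth_map_phi: "smooth_map_on W (points W) V \<phi>"
  unfolding smooth_map_on_def
proof (intro conjI ballI)
  show "continuous_map (subtopology (top_of W) (points W)) (top_of V) \<phi>"
    unfolding continuous_map_def using phi openin_phi_vimage by (auto simp: Pi_iff)
  fix c d assume cd: "c \<in> atlas W" "d \<in> atlas V"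
  have "cdom c \<inter> {q \<in> points W. \<phi> q \<in> cdom d} = {p \<in> cdom c \<inter> points W. \<phi> p \<in> cdom d}" by blast
  then show "smooth_on (local_rep c d \<phi>) (coord c ` {p \<in> cdom c \<inter> points W. \<phi> p \<in> cdom d})"
    using local_rep_smooth[OF cd] by simp
qed

text \<open>At a boundary point the local representation lives on a half-open set only. A smooth
  extension has the same derivative there and can be inverted between open sets; the inverse of the
  extension then witnesses smoothness on the image of \<open>U\<close>, which need not be
  open.\<close>

lemma local_inverse:
  assumes w: "w \<in> points W"
  shows "\<exists>U. openin (top_of W) U \<and> w \<in> U \<and> inj_on \<phi> U \<and> smooth_map_on V (\<phi> ` U) W (the_inv_into U \<phi>)"
proof -
  obtain c where c: "c \<in> charts_at W w" using W.chart_atE[OF w] unfolding W.charts_at_iff by blast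
  obtain d where d: "d \<in> charts_at V (\<phi> w)" using V.chart_atE[OF phi[OF w]] unfolding V.charts_at_iff by blast
  have at: "c \<in> atlas W" "w \<in> cdom c" "d \<in> atlas V" "\<phi> w \<in> cdom d"
    using c d by (auto simp: V.charts_at_iff W.charts_at_iff)
  define P where "P = {q \<in> points W. \<phi> q \<in> cdom d}"
  have P: "openin (top_of W) P" unfolding P_def by (rule openin_phi_vimage[OF V.openin_cdom[OF at(3)]])
  define S where "S = coord c ` (cdom c \<inter> P)"
  have S: "half_open S" unfolding S_def by (rule W.half_open_coord_image[OF at(1) P])
  have wS: "coord c w \<in> S" using at w by (auto simp: S_def P_def)
  define R where "R = local_rep c d \<phi>"
  have R_coord: "R (coord c q) = coord d (\<phi> q)" if "q \<in> cdom c" for q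
    using that at(1) by (simp add: R_def local_rep_def)
  have smooth_R: "smooth_on R S" unfolding R_def S_def P_def by (rule local_rep_smooth[OF at(1,3)])
  obtain A G where A: "open A" "coord c w \<in> A" and G: "\<And>k. C_k_on k G A"
    and GR: "\<And>y. y \<in> S \<Longrightarrow> y \<in> A \<Longrightarrow> G y = R y"
    by (rule smooth_onE[OF smooth_R wS]) (rule that)
  have "frechet_derivative R (at (coord c w) within S) = frechet_derivative G (at (coord c w))"
    by (rule frechet_derivative_within_eqI[OF S wS has_derivative_within_extension[OF A wS G GR]])
  then have "bij (frechet_derivative G (at (coord c w)))"
    using local_rep_derivative_bij[OF w c d] by (simp add: R_def S_def P_def)
  then obtain A' B H where A': "open A'" "A' \<subseteq> A" "coord c w \<in> A'" and B: "open B"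
    and hom: "homeomorphism A' B G H" and H: "\<And>k. C_k_on k H B"
    by (rule smooth_inverse_function[OF A G]) (rule that)
  define U where "U = {q \<in> cdom c. coord c q \<in> A'} \<inter> P"
  have U: "openin (top_of W) U"
    unfolding U_def using W.openin_coord_vimage[OF at(1) A'(1)] P by blast
  have wU: "w \<in> U" using at A'(3) w by (simp add: U_def P_def)
  have Ucd: "q \<in> cdom c" "\<phi> q \<in> cdom d" "coord d (\<phi> q) \<in> B" "H (coord d (\<phi> q)) = coord c q" if "q \<in> U" for q
  proof -
    show q: "q \<in> cdom c" "\<phi> q \<in> cdom d" using that by (auto simp: U_def P_def)
    have "coord c q \<in> S" "coord c q \<in> A'" using that by (auto simp: U_def S_def)
    then have eq: "G (coord c q) = coord d (\<phi> q)" using GR A'(2) R_coord[OF q(1)] by auto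
    have "G (coord c q) \<in> B" "H (G (coord c q)) = coord c q"
      using hom \<open>coord c q \<in> A'\<close> unfolding homeomorphism_def by blast+
    then show "coord d (\<phi> q) \<in> B" "H (coord d (\<phi> q)) = coord c q" unfolding eq by blast+
  qed
  have inj: "inj_on \<phi> U"
  proof (rule inj_onI)
    fix q q' assume q: "q \<in> U" "q' \<in> U" "\<phi> q = \<phi> q'"
    then have "coord c q = coord c q'" using Ucd(4)[OF q(1)] Ucd(4)[OF q(2)] by simp
    then show "q = q'" using W.inj_on_coord[OF at(1)] Ucd(1) q by (metis inj_onD)
  qed
  have inv: "the_inv_into U \<phi> (\<phi> q) = q" if "q \<in> U" for q
    using inj that by (rule the_inv_into_f_f)
  have UV: "\<phi> ` U \<subseteq> points V" using phi by (auto simp: U_def P_def)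
  have "smooth_map_on V (\<phi> ` U) W (the_inv_into U \<phi>)"
    unfolding smooth_map_on_def
  proof (intro conjI ballI)
    show "continuous_map (subtopology (top_of V) (\<phi> ` U)) (top_of W) (the_inv_into U \<phi>)"
      unfolding continuous_map_def
    proof (intro conjI allI impI)
      show "the_inv_into U \<phi> \<in> topspace (subtopology (top_of V) (\<phi> ` U)) \<rightarrow> points W"
        using inv openin_subset[OF U] by auto
      fix T assume T: "openin (top_of W) T"
      obtain D where D: "open D" "coord c ` (cdom c \<inter> T) = coord c ` cdom c \<inter> D"
        using W.openin_coord_image[OF at(1) T] by (auto simp: openin_open)
      have in_T: "q \<in> T \<longleftrightarrow> coord c q \<in> D" if "q \<in> cdom c" for q
      proof
        assume "coord c q \<in> D"
        then have "coord c q \<in> coord c ` (cdom c \<inter> T)" using D(2) that by blast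
        then show "q \<in> T" using W.inj_on_coord[OF at(1)] that by (auto dest: inj_onD)
      qed (use D(2) that in blast)
      have "open (B \<inter> H -` D)"
        by (rule continuous_open_preimage[OF C_k_on_continuous_on[OF H] B D(1)])
      from V.openin_coord_vimage[OF at(3) this]
      have "openin (top_of V) {p \<in> cdom d. coord d p \<in> B \<inter> H -` D}" .
      \<comment> \<open>Openness is relative to the image of \<open>U\<close>: \<open>H\<close> is
        defined on all of \<open>B\<close>, but describes the inverse of \<open>\<phi>\<close> only
        at points of the image.\<close>
      moreover have "{p \<in> topspace (subtopology (top_of V) (\<phi> ` U)). the_inv_into U \<phi> p \<in> T} =
          {p \<in> cdom d. coord d p \<in> B \<inter> H -` D} \<inter> \<phi> ` U"
        using UV Ucd inv in_T by auto
      ultimately show "openin (subtopology (top_of V) (\<phi> ` U))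
          {p \<in> topspace (subtopology (top_of V) (\<phi> ` U)). the_inv_into U \<phi> p \<in> T}"
        unfolding openin_subtopology by blast
    qed
  next
    fix d' c' assume d': "d' \<in> atlas V" and c': "c' \<in> atlas W"
    let ?T = "{p \<in> cdom d' \<inter> \<phi> ` U. the_inv_into U \<phi> p \<in> cdom c'}"
    have rep: "coord c' (param c (H (coord d (param d' y)))) = local_rep d' c' (the_inv_into U \<phi>) y"
      "coord d (param d' y) \<in> B" "y \<in> coord d' ` (cdom d' \<inter> cdom d)"
      "H (coord d (param d' y)) \<in> coord c ` (cdom c \<inter> cdom c')" if y: "y \<in> coord d' ` ?T" for y
    proof -
      obtain q where q: "q \<in> U" "\<phi> q \<in> cdom d'" "q \<in> cdom c'" "y = coord d' (\<phi> q)"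
        using y inv by auto
      show "coord c' (param c (H (coord d (param d' y)))) = local_rep d' c' (the_inv_into U \<phi>) y"
        "coord d (param d' y) \<in> B" "y \<in> coord d' ` (cdom d' \<inter> cdom d)"
        "H (coord d (param d' y)) \<in> coord c ` (cdom c \<inter> cdom c')"
        using q Ucd[OF q(1)] d' at(1) inv by (auto simp: local_rep_def)
    qed
    have 1: "smooth_on (\<lambda>y. coord d (param d' y)) (coord d' ` ?T)"
      by (rule smooth_on_subset[OF V.smooth_on_transition[OF d' at(3)]]) (use rep(3) in blast)
    have 2: "smooth_on (\<lambda>y. H (coord d (param d' y))) (coord d' ` ?T)"
      by (rule smooth_on_compose[OF smooth_on_open[OF B H] 1 rep(2)])
    show "smooth_on (local_rep d' c' (the_inv_into U \<phi>)) (coord d' ` ?T)"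
      by (rule smooth_on_cong[OF smooth_on_compose[OF W.smooth_on_transition[OF at(1) c'] 2 rep(4)] rep(1)])
  qed
  then show ?thesis using U wU inj by blast
qed

lemma local_diffeomorphism_phi: "local_diffeomorphism W V \<phi>"
  unfolding local_diffeomorphism_def using smooth_map_phi local_inverse by blast

text \<open>With \<open>c\<close> taken to be the chart selected inside \<open>differential\<close>,
  the derivative formula says that the differential maps \<open>f x w\<close> to
  \<open>x (\<phi> w)\<close>; injectivity on the tangent space permits inverting it.\<close>

lemma f_eq_inv_differential:
  assumes w: "w \<in> points W" and x: "x \<in> compact_vector_fields V"
  shows "f x w = the_inv_into (tangent_space W w) (differential W V \<phi> w) (x (\<phi> w))"
proof -
  define c where "c = (SOME c. c \<in> charts_at W w)"
  have "\<exists>c. c \<in> charts_at W w"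
    using W.chart_atE[OF w] unfolding W.charts_at_iff by blast
  then have c: "c \<in> charts_at W w" unfolding c_def by (rule someI_ex)
  then have at: "c \<in> atlas W" "w \<in> cdom c" by (auto simp: W.charts_at_iff)
  have set: "{q \<in> cdom c. \<phi> q \<in> cdom d} = cdom c \<inter> {q \<in> points W. \<phi> q \<in> cdom d}" for d :: "('a, 'e) chart"
    using W.cdom_subset[OF at(1)] by blast
  have diff: "differential W V \<phi> w v = (\<lambda>d. if d \<in> charts_at V (\<phi> w) then
      frechet_derivative (local_rep c d \<phi>)
        (at (coord c w) within coord c ` (cdom c \<inter> {q \<in> points W. \<phi> q \<in> cdom d})) (v c) else 0)" for v
    unfolding differential_def c_def[symmetric] Let_def set ..
  have eq: "differential W V \<phi> w (f x w) = x (\<phi> w)"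
  proof
    fix d show "differential W V \<phi> w (f x w) d = x (\<phi> w) d"
      using local_rep_derivative[OF w c _ x] V.tangent_space_outside[OF V.vector_fieldsD(1)[OF V.compact_vector_fieldsD[OF x] phi[OF w]]]
      by (simp add: diff)
  qed
  have inj: "inj_on (differential W V \<phi> w) (tangent_space W w)"
  proof (rule inj_onI)
    fix u v assume uv: "u \<in> tangent_space W w" "v \<in> tangent_space W w"
      "differential W V \<phi> w u = differential W V \<phi> w v"
    obtain d where d: "d \<in> charts_at V (\<phi> w)"
      using V.chart_atE[OF phi[OF w]] unfolding V.charts_at_iff by blast
    have "u c = v c"
      using fun_cong[OF uv(3), of d] d local_rep_derivative_bij[OF w c d] by (simp add: diff bij_is_inj inj_eq)
    then show "u = v" by (rule W.tangent_space_eqI[OF uv(1,2) c])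
  qed
  show ?thesis by (rule the_inv_into_f_eq[OF inj eq f_in_tangent_space[OF x w], symmetric])
qed

end

section \<open>Restriction along a local diffeomorphism\<close>

context smooth_mfd
begin

text \<open>The isomorphism is v \<mapsto> v c. Read in another chart, it and its inverse are the
  derivatives of the two chart changes, smooth jointly in point and vector.\<close>

lemma chart_trivializes:
  assumes c: "c \<in> atlas M"
  shows "tangent_bundle_trivial_on M (cdom c)"
proof -
  have at: "c \<in> charts_at M p" if "p \<in> cdom c" for p using that c by (simp add: charts_at_iff)
  have bij: "bij_betw (\<lambda>v. v c) (tangent_space M p) UNIV" if p: "p \<in> cdom c" for p
  proof (rule bij_betwI')
    show "v c = w c \<longleftrightarrow> v = w" if "v \<in> tangent_space M p" "w \<in> tangent_space M p" for v w
      using tangent_space_eqI[OF that at[OF p]] by blast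
    show "\<exists>v\<in>tangent_space M p. u = v c" for u
      by (rule bexI[OF _ tvec_of_coord_in_tangent_space[OF at[OF p]]]) (simp add: tvec_of_coord_self[OF at[OF p]])
  qed simp
  have inv: "the_inv_into (tangent_space M p) (\<lambda>v. v c) z = tvec_of_coord M p c z" if p: "p \<in> cdom c" for p z
    by (rule the_inv_into_f_eq[OF bij_betw_imp_inj_on[OF bij[OF p]] tvec_of_coord_self[OF at[OF p]]
          tvec_of_coord_in_tangent_space[OF at[OF p]]])
  have "smooth_on (\<lambda>(y, u). tvec_of_coord M (param d y) d u c) (coord d ` (cdom d \<inter> cdom c) \<times> UNIV)"
    if d: "d \<in> atlas M" for d
    by (rule smooth_on_cong[OF smooth_on_frechet_derivative_Pair[OF
          half_open_coord_image[OF d openin_cdom[OF c]] smooth_on_transition[OF d c]]])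
      (use c d in \<open>auto simp: tvec_of_coord_def charts_at_iff coord_change_def o_def\<close>)
  moreover have "smooth_on (\<lambda>(y, z). the_inv_into (tangent_space M (param d y)) (\<lambda>v. v c) z d)
      (coord d ` (cdom d \<inter> cdom c) \<times> UNIV)" if d: "d \<in> atlas M" for d
  proof -
    let ?S = "coord d ` (cdom d \<inter> cdom c)"
    let ?T = "coord c ` (cdom c \<inter> cdom d)"
    have S: "smooth_on (\<lambda>q :: 'e \<times> 'e. coord c (param d (fst q))) (?S \<times> UNIV)"
      by (rule smooth_on_compose[OF smooth_on_transition[OF d c] smooth_on_bounded_linear[OF bounded_linear_fst smooth_on_id]]) auto
    have "smooth_on (\<lambda>q. case (coord c (param d (fst q)), snd q) of
        (y, z) \<Rightarrow> frechet_derivative (\<lambda>y. coord d (param c y)) (at y within ?T) z) (?S \<times> UNIV)"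
      by (rule smooth_on_compose[OF smooth_on_frechet_derivative_Pair[OF
            half_open_coord_image[OF c openin_cdom[OF d]] smooth_on_transition[OF c d]]
            smooth_on_Pair[OF S smooth_on_bounded_linear[OF bounded_linear_snd smooth_on_id]]])
        (use d in auto)
    then show ?thesis
      by (rule smooth_on_cong)
        (use c d in \<open>auto simp: inv tvec_of_coord_def charts_at_iff coord_change_def o_def\<close>)
  qed
  ultimately show ?thesis
    unfolding tangent_bundle_trivial_on_def
    by (intro exI[of _ "\<lambda>p v. v c"] conjI ballI bij allI) auto
qed

end

section \<open>Support points when the homomorphism is determined by point evaluation\<close>

context lie_hom_at_points
begin

text \<open>A point other than \<open>\<phi> w\<close> has a neighbourhood separated from
  \<open>\<phi> w\<close>, and fields supported there vanish at \<open>\<phi> w\<close>, hence are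
  killed at \<open>w\<close>. Bump fields around \<open>\<phi> w\<close> itself are not.\<close>

lemma support_points_eq:
  assumes w: "w \<in> points W"
  shows "support_points V (eval_at w \<circ> f) = {\<phi> w}"
proof (intro equalityI subsetI)
  fix p assume p: "p \<in> support_points V (eval_at w \<circ> f)"
  show "p \<in> {\<phi> w}"
  proof (rule ccontr)
    assume "p \<notin> {\<phi> w}"
    moreover have pV: "p \<in> points V" using p by (simp add: support_points_def)
    ultimately obtain A B where AB: "openin (top_of V) A" "openin (top_of V) B" "p \<in> A" "\<phi> w \<in> B" "disjnt A B"
      using V.Hausdorff phi[OF w] unfolding Hausdorff_space_def by (metis singletonI)
    then obtain x where x: "x \<in> compact_vector_fields V" "supp V x \<subseteq> A" "f x w \<noteq> zero_tvec"
      using p by (auto simp: support_points_def eval_at_def)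
    have "\<phi> w \<notin> supp V x" using x(2) AB(4,5) by (auto simp: disjnt_iff)
    then show False using V.zero_outside_supp[OF phi[OF w]] x f_zero_iff[OF w] by blast
  qed
next
  fix p assume "p \<in> {\<phi> w}"
  then have p: "p = \<phi> w" by simp
  obtain c where c: "c \<in> charts_at V p"
    using V.chart_atE[OF phi[OF w]] p unfolding V.charts_at_iff by blast
  obtain b :: 'e where b: "b \<in> Basis" using nonempty_Basis by blast
  have "\<exists>x\<in>compact_vector_fields V. supp V x \<subseteq> U \<and> (eval_at w \<circ> f) x \<noteq> zero_tvec"
    if U: "openin (top_of V) U" "p \<in> U" for U
  proof -
    obtain x where x: "x \<in> compact_vector_fields V" "supp V x \<subseteq> U" "x p c = b"
      by (rule V.bump_field[OF U c]) (rule that)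
    have "x p \<noteq> zero_tvec" using x(3) nonzero_Basis[OF b] by (metis zero_tvec_def)
    then show ?thesis using x(1,2) f_zero_iff[OF w x(1)] p by (auto simp: eval_at_def)
  qed
  then show "p \<in> support_points V (eval_at w \<circ> f)"
    using phi[OF w] p by (simp add: support_points_def)
qed

lemma support_conditions:
  assumes w: "w \<in> points W"
  shows "support_points V (eval_at w \<circ> f) \<noteq> {} \<and>
        compactin (top_of V) (support_points V (eval_at w \<circ> f)) \<and>
        (\<exists>U. openin (top_of V) U \<and> support_points V (eval_at w \<circ> f) \<subseteq> U \<and>
           tangent_bundle_trivial_on V U) \<and>
        (\<forall>x\<in>compact_vector_fields V.
           (\<forall>p\<in>support_points V (eval_at w \<circ> f). x p \<noteq> zero_tvec) \<longrightarrow> f x w \<noteq> zero_tvec) \<and>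
        (mdim V = 1 \<longrightarrow> (\<exists>p. support_points V (eval_at w \<circ> f) = {p}))"
proof -
  obtain c where c: "c \<in> atlas V" "\<phi> w \<in> cdom c" using V.chart_atE[OF phi[OF w]] .
  have "\<exists>U. openin (top_of V) U \<and> {\<phi> w} \<subseteq> U \<and> tangent_bundle_trivial_on V U"
    using V.openin_cdom[OF c(1)] c(2) V.chart_trivializes[OF c(1)] by (intro exI[of _ "cdom c"]) simp
  then show ?thesis
    unfolding support_points_eq[OF w] using f_zero_iff[OF w] phi[OF w] by (simp add: finite_imp_compactin)
qed

end

text \<open>\<open>the_inv_into\<close> is meaningful only on the range of an injective map. The
  work is therefore to show, by the chain rule and the local inverse, that the differential is
  injective with \<open>x (\<phi> w)\<close> in its range; the kernel condition is then
  immediate.\<close>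

lemma (in lie_hom) lie_hom_at_points_of_local_diffeomorphism:
  assumes ld: "local_diffeomorphism W V \<phi>"
    and formula: "\<And>w x. w \<in> points W \<Longrightarrow> x \<in> compact_vector_fields V \<Longrightarrow>
      f x w = the_inv_into (tangent_space W w) (differential W V \<phi> w) (x (\<phi> w))"
  shows "lie_hom_at_points V W f \<phi>"
proof -
  have sm: "smooth_map_on W (points W) V \<phi>"
    using ld by (simp add: local_diffeomorphism_def)
  then have cont: "continuous_map (top_of W) (top_of V) \<phi>"
    by (simp add: smooth_map_on_def subtopology_topspace)
  have phi: "\<phi> w \<in> points V" if "w \<in> points W" for w
    using cont that by (auto simp: continuous_map_def)
  have vimage: "openin (top_of W) {w \<in> points W. \<phi> w \<in> U}" if "openin (top_of V) U" for U
    using cont that by (simp add: continuous_map_def)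
  define S where "S = (\<lambda>(c :: ('b, 'f) chart) (d :: ('a, 'e) chart). coord c ` (cdom c \<inter> {q \<in> points W. \<phi> q \<in> cdom d}))"
  have smooth_rep: "smooth_on (local_rep c d \<phi>) (S c d)" if "c \<in> atlas W" "d \<in> atlas V" for c d
  proof -
    have "smooth_on (local_rep c d \<phi>) (coord c ` {p \<in> cdom c \<inter> points W. \<phi> p \<in> cdom d})"
      using sm that unfolding smooth_map_on_def by blast
    also have "{p \<in> cdom c \<inter> points W. \<phi> p \<in> cdom d} = cdom c \<inter> {q \<in> points W. \<phi> q \<in> cdom d}" by blast
    finally show ?thesis unfolding S_def .
  qed
  have half: "half_open (S c d)" if "c \<in> atlas W" "d \<in> atlas V" for c d
    unfolding S_def by (rule W.half_open_coord_image[OF that(1) vimage[OF V.openin_cdom[OF that(2)]]])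
  have "f x w = zero_tvec \<longleftrightarrow> x (\<phi> w) = zero_tvec"
    if w: "w \<in> points W" and x: "x \<in> compact_vector_fields V" for w x
  proof -
    define c where "c = (SOME c. c \<in> charts_at W w)"
    have "\<exists>c. c \<in> charts_at W w"
      using W.chart_atE[OF w] unfolding W.charts_at_iff by blast
    then have c: "c \<in> charts_at W w" unfolding c_def by (rule someI_ex)
    then have cat: "c \<in> atlas W" "w \<in> cdom c" by (auto simp: W.charts_at_iff)
    define D where "D = (\<lambda>d. frechet_derivative (local_rep c d \<phi>) (at (coord c w) within S c d))"
    have set: "{q \<in> cdom c. \<phi> q \<in> cdom d} = cdom c \<inter> {q \<in> points W. \<phi> q \<in> cdom d}" for d :: "('a, 'e) chart"
      using W.cdom_subset[OF cat(1)] by blast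
    have diff: "differential W V \<phi> w v = (\<lambda>d. if d \<in> charts_at V (\<phi> w) then D d (v c) else 0)" for v
      unfolding differential_def c_def[symmetric] Let_def set D_def S_def ..
    have wS: "coord c w \<in> S c d" if "d \<in> charts_at V (\<phi> w)" for d
      using that cat w by (auto simp: S_def V.charts_at_iff)
    have linD: "linear (D d)" if d: "d \<in> charts_at V (\<phi> w)" for d
      unfolding D_def
      by (rule linear_frechet_derivative_within[OF smooth_rep[OF cat(1)] wS[OF d]]) (use d in \<open>simp add: V.charts_at_iff\<close>)
    \<comment> \<open>The chain rule for \<psi> \<circ> \<phi> = id on \<open>B\<close> gives
      \<open>D d\<close> a left inverse, and equal dimensions do the rest. The set \<open>T\<close>
      may fail to be half-open, so uniqueness of derivatives is invoked on the side of
      \<open>B\<close>.\<close>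
    have bijD: "bij (D d)" if d: "d \<in> charts_at V (\<phi> w)" for d
    proof -
      have dat: "d \<in> atlas V" "\<phi> w \<in> cdom d" using d by (auto simp: V.charts_at_iff)
      obtain U where U: "openin (top_of W) U" "w \<in> U" "inj_on \<phi> U" "smooth_map_on V (\<phi> ` U) W (the_inv_into U \<phi>)"
        using ld w unfolding local_diffeomorphism_def by blast
      define \<psi> where "\<psi> = the_inv_into U \<phi>"
      define T where "T = coord d ` {p \<in> cdom d \<inter> \<phi> ` U. \<psi> p \<in> cdom c}"
      have \<psi>: "\<psi> (\<phi> q) = q" if "q \<in> U" for q unfolding \<psi>_def using U(3) that by (rule the_inv_into_f_f)
      have smooth_inv: "smooth_on (local_rep d c \<psi>) T"
        using U(4) dat(1) cat(1) by (simp add: smooth_map_on_def \<psi>_def T_def)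
      define B where "B = coord c ` (cdom c \<inter> ({q \<in> points W. \<phi> q \<in> cdom d} \<inter> U))"
      have B: "half_open B"
        unfolding B_def by (rule W.half_open_coord_image[OF cat(1) openin_Int[OF vimage[OF V.openin_cdom[OF dat(1)]] U(1)]])
      have wB: "coord c w \<in> B" using cat w dat U(2) by (auto simp: B_def)
      have BS: "B \<subseteq> S c d" by (auto simp: B_def S_def)
      have DB: "D d = frechet_derivative (local_rep c d \<phi>) (at (coord c w) within B)"
        unfolding D_def by (rule frechet_derivative_within_subset[OF B BS wB smooth_rep[OF cat(1) dat(1)]]) simp
      have maps: "local_rep c d \<phi> y \<in> T" "local_rep d c \<psi> (local_rep c d \<phi> y) = y" if "y \<in> B" for y
      proof -
        obtain q where q: "q \<in> cdom c" "\<phi> q \<in> cdom d" "q \<in> U" "y = coord c q" using \<open>y \<in> B\<close> by (auto simp: B_def)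
        then have "local_rep c d \<phi> y = coord d (\<phi> q)" using cat(1) by (simp add: local_rep_def)
        then show "local_rep c d \<phi> y \<in> T" "local_rep d c \<psi> (local_rep c d \<phi> y) = y"
          using q \<psi> dat(1) by (auto simp: T_def local_rep_def)
      qed
      have "((\<lambda>y. local_rep d c \<psi> (local_rep c d \<phi> y)) has_derivative (\<lambda>v. v)) (at (coord c w) within B)"
        by (rule has_derivative_transform[OF wB _ has_derivative_ident]) (use maps in auto)
      then have "(\<lambda>v. v) = frechet_derivative (\<lambda>y. local_rep d c \<psi> (local_rep c d \<phi> y)) (at (coord c w) within B)"
        by (rule frechet_derivative_within_eqI[OF B wB, symmetric])
      then have "v = frechet_derivative (local_rep d c \<psi>) (at (local_rep c d \<phi> (coord c w)) within T) (D d v)" for v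
        unfolding DB
        using frechet_derivative_within_compose[OF B wB smooth_inv smooth_on_subset[OF smooth_rep[OF cat(1) dat(1)] BS] maps(1)]
        by metis
      then have "inj (D d)" by (metis injI)
      then show ?thesis by (rule linear_inj_imp_bij[OF linD[OF d]]) (simp add: DIM_eq)
    qed
    \<comment> \<open>This ensures that a vector whose image matches \<open>x (\<phi> w)\<close> in
      one chart around \<open>\<phi> w\<close> matches it in all of them.\<close>
    have D_change: "D d' v = coord_change d d' (\<phi> w) (D d v)"
      if d: "d \<in> charts_at V (\<phi> w)" and d': "d' \<in> charts_at V (\<phi> w)" for d d' v
    proof -
      have at: "d \<in> atlas V" "d' \<in> atlas V" "\<phi> w \<in> cdom d" "\<phi> w \<in> cdom d'"
        using d d' by (auto simp: V.charts_at_iff)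
      define B where "B = coord c ` (cdom c \<inter> {q \<in> points W. \<phi> q \<in> cdom d \<inter> cdom d'})"
      have B: "half_open B" unfolding B_def
        by (rule W.half_open_coord_image[OF cat(1) vimage[OF openin_Int[OF V.openin_cdom[OF at(1)] V.openin_cdom[OF at(2)]]]])
      have wB: "coord c w \<in> B" using cat w at by (auto simp: B_def)
      have BS: "B \<subseteq> S c d" "B \<subseteq> S c d'" by (auto simp: B_def S_def)
      have eq: "local_rep c d' \<phi> y = coord d' (param d (local_rep c d \<phi> y))"
        and maps: "local_rep c d \<phi> y \<in> coord d ` (cdom d \<inter> cdom d')" if "y \<in> B" for y
        using that cat(1) at(1) by (auto simp: B_def local_rep_def)
      have "D d' = frechet_derivative (\<lambda>y. coord d' (param d (local_rep c d \<phi> y))) (at (coord c w) within B)"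
        unfolding D_def by (rule frechet_derivative_within_subset[OF B BS(2) wB smooth_rep[OF cat(1) at(2)] eq])
      then have "D d' v = frechet_derivative (\<lambda>y. coord d' (param d y))
          (at (local_rep c d \<phi> (coord c w)) within coord d ` (cdom d \<inter> cdom d'))
          (frechet_derivative (local_rep c d \<phi>) (at (coord c w) within B) v)"
        using frechet_derivative_within_compose[OF B wB V.smooth_on_transition[OF at(1,2)]
            smooth_on_subset[OF smooth_rep[OF cat(1) at(1)] BS(1)] maps] by simp
      also have "frechet_derivative (local_rep c d \<phi>) (at (coord c w) within B) = D d"
        unfolding D_def
        by (rule frechet_derivative_within_subset[OF B BS(1) wB smooth_rep[OF cat(1) at(1)], symmetric]) simp
      also have "local_rep c d \<phi> (coord c w) = coord d (\<phi> w)" using cat by (simp add: local_rep_def)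
      finally show ?thesis by (simp add: coord_change_def o_def)
    qed
    obtain d where d: "d \<in> charts_at V (\<phi> w)"
      using V.chart_atE[OF phi[OF w]] unfolding V.charts_at_iff by blast
    have inj: "inj_on (differential W V \<phi> w) (tangent_space W w)"
    proof (rule inj_onI)
      fix u v assume uv: "u \<in> tangent_space W w" "v \<in> tangent_space W w"
        "differential W V \<phi> w u = differential W V \<phi> w v"
      have "u c = v c"
        using fun_cong[OF uv(3), of d] d bijD[OF d] by (simp add: diff bij_is_inj inj_eq)
      then show "u = v" by (rule W.tangent_space_eqI[OF uv(1,2) c])
    qed
    define v where "v = tvec_of_coord W w c (inv (D d) (x (\<phi> w) d))"
    have xT: "x (\<phi> w) \<in> tangent_space V (\<phi> w)"
      by (rule V.vector_fieldsD(1)[OF V.compact_vector_fieldsD[OF x] phi[OF w]])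
    have v: "v \<in> tangent_space W w" unfolding v_def by (rule W.tvec_of_coord_in_tangent_space[OF c])
    have Dv: "D d (v c) = x (\<phi> w) d"
      unfolding v_def W.tvec_of_coord_self[OF c] using bijD[OF d] by (simp add: bij_is_surj surj_f_inv_f)
    have "differential W V \<phi> w v d' = x (\<phi> w) d'" for d'
    proof (cases "d' \<in> charts_at V (\<phi> w)")
      case True
      then show ?thesis using D_change[OF d True, of "v c"] V.tangent_space_change[OF xT d True] Dv by (simp add: diff)
    next
      case False
      then show ?thesis using V.tangent_space_outside[OF xT False] by (simp add: diff)
    qed
    then have dv: "differential W V \<phi> w v = x (\<phi> w)" by blast
    have "f x w = v" unfolding formula[OF w x] by (rule the_inv_into_f_eq[OF inj dv v])
    moreover have "v = zero_tvec \<longleftrightarrow> v c = 0" by (rule W.tangent_space_eq_zero_iff[OF v c])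
    moreover have "v c = 0 \<longleftrightarrow> D d (v c) = 0"
      using bijD[OF d] linear_0[OF linD[OF d]] by (metis bij_is_inj injD)
    moreover have "x (\<phi> w) = zero_tvec \<longleftrightarrow> x (\<phi> w) d = 0" by (rule V.tangent_space_eq_zero_iff[OF xT d])
    ultimately show ?thesis using Dv by simp
  qed
  then show ?thesis using phi by unfold_locales
qed

theorem theorem11p1:
  fixes V :: "('a, 'e::euclidean_space) manifold"
    and W :: "('b, 'f::euclidean_space) manifold"
    and f :: "('a, 'e) vfield \<Rightarrow> ('b, 'f) vfield"
  assumes "smooth_manifold V" and "smooth_manifold W"
    and "mdim V = mdim W"
    and "lie_homomorphism V W f"
  shows
    "(\<forall>w\<in>points W.
        support_points V (eval_at w \<circ> f) \<noteq> {} \<and>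
        compactin (top_of V) (support_points V (eval_at w \<circ> f)) \<and>
        (\<exists>U. openin (top_of V) U \<and> support_points V (eval_at w \<circ> f) \<subseteq> U \<and>
           tangent_bundle_trivial_on V U) \<and>
        (\<forall>x\<in>compact_vector_fields V.
           (\<forall>p\<in>support_points V (eval_at w \<circ> f). x p \<noteq> zero_tvec) \<longrightarrow> f x w \<noteq> zero_tvec) \<and>
        (mdim V = 1 \<longrightarrow> (\<exists>p. support_points V (eval_at w \<circ> f) = {p})))
     \<longleftrightarrow>
     (\<exists>\<phi>. local_diffeomorphism W V \<phi> \<and>
        (\<forall>w\<in>points W. \<forall>x\<in>compact_vector_fields V.
           f x w = the_inv_into (tangent_space W w) (differential W V \<phi> w) (x (\<phi> w))))"
    (is "?i \<longleftrightarrow> ?ii")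
proof
  interpret lie_hom V W f using assms by unfold_locales
  show ?ii if i: ?i
  proof -
    have "\<exists>p\<in>points V. \<forall>x\<in>compact_vector_fields V. f x w = zero_tvec \<longleftrightarrow> x p = zero_tvec"
      if w: "w \<in> points W" for w
    proof -
      let ?S = "support_points V (eval_at w \<circ> f)"
      note cond = bspec[OF i w]
      obtain U where U: "openin (top_of V) U" "?S \<subseteq> U" "tangent_bundle_trivial_on V U"
        using cond by (elim conjE exE)
      show ?thesis
        by (rule evaluation_point[OF w _ _ U]) (use cond in blast)+
    qed
    \<comment> \<open>The points are picked for each \<open>w\<close> separately; the regularity of
      the choice comes out of the locale.\<close>
    then obtain \<phi> where "\<And>w. w \<in> points W \<Longrightarrow> \<phi> w \<in> points V \<and>
        (\<forall>x\<in>compact_vector_fields V. f x w = zero_tvec \<longleftrightarrow> x (\<phi> w) = zero_tvec)"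
      by metis
    then interpret lie_hom_at_points V W f \<phi> by unfold_locales blast+
    show ?ii using local_diffeomorphism_phi f_eq_inv_differential by blast
  qed
  show ?i if ii: ?ii
  proof -
    from ii obtain \<phi> where \<phi>: "local_diffeomorphism W V \<phi>"
      "\<forall>w\<in>points W. \<forall>x\<in>compact_vector_fields V.
        f x w = the_inv_into (tangent_space W w) (differential W V \<phi> w) (x (\<phi> w))" by (elim exE conjE)
    interpret lie_hom_at_points V W f \<phi>
      by (rule lie_hom_at_points_of_local_diffeomorphism[OF \<phi>(1)]) (use \<phi>(2) in blast)
    show ?i by (rule ballI) (rule support_conditions)
  qed
qed

end
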